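(* Let $d\ge2$ and $\vartheta>d+1$, let $a\in L^\infty_\vartheta(\mathbb{R}^d)$ be a divergence-free vector field, and let $u\in\mathcal{C}_w([0,T];L^\infty_{d+1})$ be the corresponding mild solution of the Navier--Stokes system (NS). Assume that there are indices $m\ne n$ in $\{1,\dots,d\}$ such that $$\int_{\mathbb{R}^d}a_m(x)a_n(x)\,dx\ne0\qquad\text{or}\qquad\int_{\mathbb{R}^d}a_m^2(x)\,dx\ne\int_{\mathbb{R}^d}a_n^2(x)\,dx .$$ Then there exist a time $t_0>0$ and two positive constants $c_0,C$ such that for all $t\in(0,t_0]$ and all $j\in\{1,\dots,d\}$: $$\int_{R\le|x|\le2R}|u_j(x,t)|\,dx\ge\frac{c_0\,t}{R}\qquad\text{for all } R\ge C\,t^{-1/\min\{2;\,\vartheta-d-1\}}.$$ In particular, for such $t$ and for $j,k=1,\dots,d$, $$\int_{\mathbb{R}^d}|x_k|^{\alpha p}\,|u_j(x,t)|^p\,dx=+\infty$$ as soon as $1\le p<+\infty$ and $\alpha+\frac dp\ge d+1$.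
   Context: (NS) is the system on $\mathbb{R}^d$: $\partial_t u-\Delta u+(u\cdot\nabla)u=-\nabla p$, $\operatorname{div}u=0$, $u(x,0)=a(x)$. For $\vartheta\ge0$, $L^\infty_\vartheta$ is the space of measurable functions (or vector fields) $f$ on $\mathbb{R}^d$ with $\|f\|_{L^\infty_\vartheta}=\operatorname{ess\,sup}_x(1+|x|)^\vartheta|f(x)|<\infty$. $\mathcal{C}_w([0,T];L^\infty_\vartheta)$ is the space of $u(x,t)$ with $u(t)\in L^\infty_\vartheta$ for all $t$, continuous in $t>0$ for the $L^\infty_\vartheta$ norm, with $u(t)\to u(0)$ in the distributional sense as $t\to0$; its elements are understood to be bounded in $L^\infty_\vartheta$ on $[0,T]$. A mild solution satisfies $u(t)=e^{t\Delta}a-\int_0^te^{(t-s)\Delta}\mathbb{P}\operatorname{div}(u\otimes u)(s)\,ds$, with $\mathbb{P}f=f-\nabla\Delta^{-1}(\operatorname{div}f)$. It is known that every divergence-free $a\in L^\infty_\vartheta$ gives rise, on some $[0,T]$ with $T>0$, to a unique mild solution in $\mathcal{C}_w([0,T];L^\infty)$, and that it belongs to $\mathcal{C}_w([0,T];L^\infty_{\min\{\vartheta;d+1\}})$. *)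

theory Defs
  imports "HOL-Analysis.Analysis" "HOL-Probability.Essential_Supremum"
begin

text \<open>
  The space dimension is \<open>d = CARD('n)\<close>. Elements of Lebesgue spaces are represented by
  functions; identities between them are asserted almost everywhere.
\<close>

subsection \<open>Differential operators and test functions\<close>

definition pd :: "'n::finite \<Rightarrow> (real ^ 'n \<Rightarrow> real) \<Rightarrow> real ^ 'n \<Rightarrow> real" where
  "pd i f x = frechet_derivative f (at x) (axis i 1)"

definition divergence :: "(real ^ 'n::finite \<Rightarrow> real ^ 'n) \<Rightarrow> real ^ 'n \<Rightarrow> real" where
  "divergence f x = (\<Sum>i\<in>UNIV. pd i (\<lambda>y. f y $ i) x)"

definition grad :: "(real ^ 'n::finite \<Rightarrow> real) \<Rightarrow> real ^ 'n \<Rightarrow> real ^ 'n" where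
  "grad f x = (\<chi> j. pd j f x)"

text \<open>
  Every iterated partial derivative being differentiable everywhere is the same as being of class
  \<open>C\<^sup>\<infinity>\<close>: differentiability at one order gives continuity of the partial derivatives
  of the order below.
\<close>

definition smooth_fun :: "(real ^ 'n::finite \<Rightarrow> real) \<Rightarrow> bool" where
  "smooth_fun f \<longleftrightarrow> (\<forall>is x. foldr pd is f differentiable (at x))"

definition test_function :: "(real ^ 'n::finite \<Rightarrow> real) \<Rightarrow> bool" where
  "test_function \<phi> \<longleftrightarrow> smooth_fun \<phi> \<and> compact (closure {x. \<phi> x \<noteq> 0})"

definition div_free :: "(real ^ 'n::finite \<Rightarrow> real ^ 'n) \<Rightarrow> bool" where
  "div_free a \<longleftrightarrow> (\<forall>\<phi>. test_function \<phi> \<longrightarrow> (LINT x|lebesgue. a x \<bullet> grad \<phi> x) = 0)"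

subsection \<open>Weighted function spaces\<close>

definition Linf_norm :: "real \<Rightarrow> (real ^ 'n::finite \<Rightarrow> real ^ 'n) \<Rightarrow> ereal" where
  "Linf_norm \<theta> f = esssup lebesgue (\<lambda>x. ereal ((1 + norm x) powr \<theta> * norm (f x)))"

definition Linf :: "real \<Rightarrow> (real ^ 'n::finite \<Rightarrow> real ^ 'n) set" where
  "Linf \<theta> = {f. f \<in> borel_measurable lebesgue \<and> Linf_norm \<theta> f < \<infinity>}"

text \<open>
  Time is the first argument: \<open>u t x\<close> stands for \<open>u(x,t)\<close>, and only
  \<open>t \<in> [0,T]\<close> matters.
\<close>

definition Cw :: "real \<Rightarrow> real \<Rightarrow> (real \<Rightarrow> real ^ 'n::finite \<Rightarrow> real ^ 'n) set" where
  "Cw T \<theta> = {u.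
     (\<forall>t\<in>{0..T}. u t \<in> Linf \<theta>) \<and>
     (\<exists>M::real. \<forall>t\<in>{0..T}. Linf_norm \<theta> (u t) \<le> ereal M) \<and>
     (\<forall>t\<in>{0<..T}. ((\<lambda>s. Linf_norm \<theta> (\<lambda>x. u s x - u t x)) \<longlongrightarrow> 0) (at t within {0<..T})) \<and>
     (\<forall>\<phi>. test_function \<phi> \<longrightarrow>
        ((\<lambda>t. LINT x|lebesgue. \<phi> x *\<^sub>R u t x) \<longlongrightarrow> (LINT x|lebesgue. \<phi> x *\<^sub>R u 0 x)) (at_right 0))}"

subsection \<open>Heat semigroup, Leray projector and mild solutions\<close>

definition heat_kernel :: "real \<Rightarrow> real ^ 'n::finite \<Rightarrow> real" where
  "heat_kernel t x = (4 * pi * t) powr (- (real CARD('n) / 2)) * exp (- (norm x)\<^sup>2 / (4 * t))"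

definition heat :: "real \<Rightarrow> (real ^ 'n::finite \<Rightarrow> real ^ 'n) \<Rightarrow> real ^ 'n \<Rightarrow> real ^ 'n" where
  "heat t f x = (if t = 0 then f x else LINT y|lebesgue. heat_kernel t (x - y) *\<^sub>R f y)"

text \<open>
  The fundamental solution \<open>E\<close> of the Laplacian, with \<open>\<Delta> E = \<delta>\<close> (the unit sphere has
  area \<open>d\<close> times the volume of the unit ball). It is meant for \<open>d \<ge> 2\<close>.
\<close>

definition laplace_fundamental :: "real ^ 'n::finite \<Rightarrow> real" where
  "laplace_fundamental x =
     (let d = real CARD('n) in
      if CARD('n) = 2 then ln (norm x) / (2 * pi)
      else - (norm x powr (2 - d)) / ((d - 2) * (d * unit_ball_vol d)))"

definition inv_laplace :: "(real ^ 'n::finite \<Rightarrow> real) \<Rightarrow> real ^ 'n \<Rightarrow> real" where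
  "inv_laplace g x = (LINT y|lebesgue. laplace_fundamental (x - y) * g y)"

definition leray :: "(real ^ 'n::finite \<Rightarrow> real ^ 'n) \<Rightarrow> real ^ 'n \<Rightarrow> real ^ 'n" where
  "leray f x = f x - grad (inv_laplace (divergence f)) x"

text \<open>
  For a matrix field \<open>M\<close> with \<open>(div M)\<^sub>k = \<Sum>\<^sub>h \<partial>\<^sub>h M\<^sub>h\<^sub>k\<close>, the operator
  \<open>e\<^sup>t\<^sup>\<Delta> P div\<close> is a sum of convolutions of the entries \<open>M\<^sub>h\<^sub>k\<close> with the
  \<open>L\<^sup>1\<close> kernels \<open>P (\<partial>\<^sub>h G\<^sub>t e\<^sub>k)\<close>, where \<open>G\<^sub>t\<close> is the heat kernel. It makes
  sense for all bounded \<open>M\<close> and \<open>t > 0\<close>, and \<open>P\<close> is only ever applied to smooth rapidly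
  decreasing fields.
\<close>

definition oseen_kernel :: "real \<Rightarrow> 'n \<Rightarrow> 'n \<Rightarrow> real ^ 'n::finite \<Rightarrow> real ^ 'n" where
  "oseen_kernel t h k = leray (\<lambda>x. pd h (heat_kernel t) x *\<^sub>R axis k 1)"

definition heat_leray_div ::
  "real \<Rightarrow> (real ^ 'n::finite \<Rightarrow> real ^ 'n ^ 'n) \<Rightarrow> real ^ 'n \<Rightarrow> real ^ 'n" where
  "heat_leray_div t M x =
     (\<Sum>h\<in>UNIV. \<Sum>k\<in>UNIV. LINT y|lebesgue. M y $ h $ k *\<^sub>R oseen_kernel t h k (x - y))"

definition tensor :: "real ^ 'n::finite \<Rightarrow> real ^ 'n \<Rightarrow> real ^ 'n ^ 'n" where
  "tensor v w = (\<chi> h k. v $ h * w $ k)"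

definition mild_solution ::
  "real \<Rightarrow> (real ^ 'n::finite \<Rightarrow> real ^ 'n) \<Rightarrow> (real \<Rightarrow> real ^ 'n \<Rightarrow> real ^ 'n) \<Rightarrow> bool" where
  "mild_solution T a u \<longleftrightarrow>
     (\<forall>t\<in>{0..T}. AE x in lebesgue.
        u t x = heat t a x
          - (LINT s:{0..t}|lborel. heat_leray_div (t - s) (\<lambda>y. tensor (u s y) (u s y)) x))"

end

theory Submission
  imports Defs "HOL-Probability.Probability"
begin

text \<open>
  Up to an additive constant the fundamental solution of the Laplacian is
  \<open>- \<integral>\<^sub>0\<^sup>\<infinity> (G\<^sub>s(x) - G\<^sub>s(e)) ds\<close> with a fixed unit vector \<open>e\<close>. Second derivatives of the Gaussian
  have mean zero, so the semigroup property turns \<open>\<Delta>\<^sup>-\<^sup>1 \<partial>\<^sub>h \<partial>\<^sub>k G\<^sub>t\<close> into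
  \<open>- \<integral>\<^sub>t\<^sup>\<infinity> \<partial>\<^sub>h \<partial>\<^sub>k G\<^sub>s ds\<close>, and the Oseen kernel becomes
  \<open>\<delta>\<^sub>j\<^sub>k \<partial>\<^sub>h G\<^sub>t + \<integral>\<^sub>t\<^sup>\<infinity> \<partial>\<^sub>j \<partial>\<^sub>h \<partial>\<^sub>k G\<^sub>s ds\<close>. Away from the origin it is therefore close to a
  profile that is homogeneous of degree \<open>- d - 1\<close>. Since \<open>\<integral> u\<^sub>h u\<^sub>k(s)\<close> tends to
  \<open>\<integral> a\<^sub>h a\<^sub>k\<close> as \<open>s \<rightarrow> 0\<close>, Duhamel's formula gives
  \<open>u(x,t) = e\<^sup>t\<^sup>\<Delta> a(x) - t Q(x) + o(t \<bar>x\<bar>\<^sup>-\<^sup>d\<^sup>-\<^sup>1)\<close> for \<open>\<bar>x\<bar> \<ge> C t\<^sup>-\<^sup>1\<^sup>/\<^sup>2\<close>, where \<open>Q\<close> contracts the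
  profile with the matrix \<open>\<integral> a \<otimes> a\<close>. The linear term is \<open>O(\<bar>x\<bar>\<^sup>-\<^sup>\<theta>)\<close>, and \<open>Q\<^sub>j\<close> vanishes
  identically only if that matrix is scalar. Both claims follow from the resulting lower
  bound for \<open>\<bar>u\<^sub>j\<bar>\<close> on the dilates of a fixed ball on which \<open>Q\<^sub>j\<close> has no zero.
\<close>

section \<open>Integrals of the heat kernel over time\<close>

text \<open>Everything about the kernel is reduced to one family of radial functions,
  \<open>heat_tail b t q\<close> with q = |x|^2, which is closed under differentiation in q. This
  makes the gradient in the Leray projector a matter of algebra and leaves the profile as the case t
  = 0. Kernel and profile differ by O(t |x|^(-d-3)), which is worthless near the origin; there only
  the bound (t + |x|^2)^(-(d+1)/2) is available, whose integral is of order t^(-1/2). In Duhamel's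
  formula this singularity costs a relative error |x|^(-1) (t-s)^(-1/2), and its time integral 2
  t^(1/2)/|x| has to be small against t: this is the origin of the exponent 2. The linear term
  |x|^(-\<theta>) is small against t |x|^(-d-1) only for |x| \<ge> C t^(-1/(\<theta>-d-1)), and for
  t \<le> 1 the minimum selects the stronger condition. The limit of the moments is quadratic and
  needs more than distributional convergence: the Duhamel term is O(t^(1/2)) uniformly in x, and the
  heat flow of a converges in L^1. Measurability of the Duhamel integrand in time is drawn from
  continuity of u in the weighted norm.\<close>

lemma powr_exp_minus_le:
  fixes a x :: real
  assumes "a > 0" "x \<ge> 0"
  shows "x powr a * exp (- x) \<le> a powr a"
proof -
  \<comment> \<open>The sharp constant is (a/e)^a; the cruder a^a needs only this inequality, raised
    to the power a.\<close>
  have "x / a \<le> exp (x / a)"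
    using exp_ge_add_one_self[of "x / a"] by linarith
  then have "(x / a) powr a \<le> exp (x / a) powr a"
    using assms by (intro powr_mono2) auto
  also have "\<dots> = exp x" using assms by (simp add: powr_def)
  finally have "x powr a \<le> a powr a * exp x"
    using assms by (simp add: powr_divide field_simps)
  then show ?thesis by (simp add: exp_minus field_simps)
qed

text \<open>The substitution x = q/(4s): a negative power of time in front of a Gaussian is bounded,
  uniformly in s, by the same power of q = |x|^2.\<close>

lemma powr_exp_heat_le:
  fixes s q p :: real
  assumes "s > 0" "q > 0" "p > 0"
  shows "s powr (- p) * exp (- q / (4 * s)) \<le> 4 powr p * p powr p * q powr (- p)"
proof -
  have "(q / (4 * s)) powr p * exp (- (q / (4 * s))) \<le> p powr p"
    using assms by (intro powr_exp_minus_le) auto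
  moreover have "s powr (- p) = 4 powr p * q powr (- p) * (q / (4 * s)) powr p"
    using assms by (simp add: powr_divide powr_mult powr_minus field_simps)
  ultimately show ?thesis
    using mult_left_mono[of "(q / (4 * s)) powr p * exp (- (q / (4 * s)))" "p powr p" "4 powr p * q powr (- p)"]
    by (simp add: mult_ac)
qed

text \<open>Explicit one-dimensional integrals are obtained as gauge integrals, which match
  \<open>lebesgue\<close>; the time integrals are taken over \<open>lborel\<close>.\<close>

lemma set_integrable_lborel_iff_lebesgue:
  fixes f :: "'a::euclidean_space \<Rightarrow> 'b::{banach, second_countable_topology}"
  assumes "f \<in> borel_measurable borel" "S \<in> sets borel"
  shows "set_integrable lborel S f \<longleftrightarrow> set_integrable lebesgue S f"
    and "(LINT x:S|lborel. f x) = (LINT x:S|lebesgue. f x)"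
proof -
  have m: "(\<lambda>x. indicator S x *\<^sub>R f x) \<in> borel_measurable lborel"
    using assms by simp
  show "set_integrable lborel S f \<longleftrightarrow> set_integrable lebesgue S f"
    unfolding set_integrable_def by (rule integrable_completion[OF m, symmetric])
  show "(LINT x:S|lborel. f x) = (LINT x:S|lebesgue. f x)"
    unfolding set_lebesgue_integral_def by (rule integral_completion[OF m, symmetric])
qed

lemma powr_tail_integral:
  fixes b t :: real
  assumes "b > 0" "t > 0"
  shows "set_integrable lborel {t<..} (\<lambda>s. s powr (- b - 1))"
    and "(LINT s:{t<..}|lborel. s powr (- b - 1)) = t powr (- b) / b"
proof -
  have "((\<lambda>s. s powr (- b - 1)) has_integral t powr (- b) / b) {t..}"
    using has_integral_powr_to_inf[of "- b - 1" t] assms by simp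
  then have *: "((\<lambda>s. s powr (- b - 1)) has_integral t powr (- b) / b) {t<..}"
    by (rule has_integral_spike_set_eq[THEN iffD1, rotated -1])
      (auto intro: negligible_subset[of "{t}"])
  then have "set_integrable lebesgue {t<..} (\<lambda>s. s powr (- b - 1))"
    by (intro nonnegative_absolutely_integrable_1) (auto simp: has_integral_iff)
  moreover from this have "(LINT s:{t<..}|lebesgue. s powr (- b - 1)) = t powr (- b) / b"
    using * by (simp add: set_lebesgue_integral_eq_integral(2) integral_unique)
  moreover have m: "(\<lambda>s::real. s powr (- b - 1)) \<in> borel_measurable borel" by measurable
  ultimately show "set_integrable lborel {t<..} (\<lambda>s. s powr (- b - 1))"
    "(LINT s:{t<..}|lborel. s powr (- b - 1)) = t powr (- b) / b"
    by (simp_all add: set_integrable_lborel_iff_lebesgue)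
qed

text \<open>For positive q and t, substituting v = q/(4s) exhibits (4/q)^b times the lower
  incomplete gamma function of order b at q/(4t). The exponent -b-1 makes the order of that function
  b; differentiation in q raises the order by one.\<close>

definition heat_tail :: "real \<Rightarrow> real \<Rightarrow> real \<Rightarrow> real" where
  "heat_tail b t q = (LINT s:{t<..}|lborel. s powr (- b - 1) * exp (- q / (4 * s)))"

text \<open>The substitution v = q/(4s) maps the half-line onto itself and produces Euler's integral
  for the Gamma function.\<close>

lemma heat_tail_0_integral:
  assumes "b > 0" "q > 0"
  shows set_integrable_heat_tail_0:
      "set_integrable lborel {0<..} (\<lambda>s. s powr (- b - 1) * exp (- q / (4 * s)))"
    and heat_tail_0: "heat_tail b 0 q = Gamma b * (4 / q) powr b"
proof -
  let ?f = "\<lambda>v::real. v powr (b - 1) / exp v"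
  let ?h = "\<lambda>s::real. s powr (- b - 1) * exp (- q / (4 * s))"
  have im: "(\<lambda>s. q / (4 * s)) ` {0<..} = {0<..}"
  proof (intro equalityI subsetI)
    fix v :: real assume "v \<in> {0<..}"
    then show "v \<in> (\<lambda>s. q / (4 * s)) ` {0<..}"
      using assms by (intro image_eqI[of _ _ "q / (4 * v)"]) auto
  qed (use assms in auto)
  have "(?f has_integral Gamma b) {0..}"
    by (rule Gamma_integral_real[OF assms(1)])
  then have G: "(?f has_integral Gamma b) {0<..}"
    by (rule has_integral_spike_set_eq[THEN iffD1, rotated -1])
      (auto intro: negligible_subset[of "{0}"])
  then have A: "?f absolutely_integrable_on {0<..}"
    by (intro nonnegative_absolutely_integrable_1) (auto simp: has_integral_iff)
  have "(\<lambda>s. \<bar>- (q / (4 * s\<^sup>2))\<bar> * ?f (q / (4 * s))) absolutely_integrable_on {0<..} \<and>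
        integral {0<..} (\<lambda>s. \<bar>- (q / (4 * s\<^sup>2))\<bar> * ?f (q / (4 * s))) = Gamma b"
  proof (subst has_absolute_integral_change_of_variables_1'[of _ "\<lambda>s. q / (4 * s)"])
    show "inj_on (\<lambda>s. q / (4 * s)) {0<..}"
      using assms by (auto simp: inj_on_def field_simps)
    fix x :: real assume "x \<in> {0<..}"
    then show "((\<lambda>s. q / (4 * s)) has_real_derivative - (q / (4 * x\<^sup>2))) (at x within {0<..})"
      by (auto intro!: derivative_eq_intros simp: field_simps power2_eq_square)
  next
    show "?f absolutely_integrable_on (\<lambda>s. q / (4 * s)) ` {0<..} \<and>
        integral ((\<lambda>s. q / (4 * s)) ` {0<..}) ?f = Gamma b"
      unfolding im using A G by (auto simp: integral_unique)
  qed simp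
  moreover have eq: "\<bar>- (q / (4 * s\<^sup>2))\<bar> * ?f (q / (4 * s)) = (q / 4) powr b * ?h s"
    if "s \<in> {0<..}" for s
  proof -
    have s: "s > 0" using that by simp
    have "(q / (4 * s)) powr (b - 1) = (q / 4) powr b * (4 / q) * (s powr (-b) * s)"
      using s assms by (simp add: powr_divide powr_mult powr_diff powr_minus field_simps)
    moreover have "s powr (- b - 1) = s powr (- b) / s"
      using s by (simp add: powr_diff)
    ultimately show ?thesis
      using s assms by (simp add: exp_minus power2_eq_square field_simps)
  qed
  ultimately have B: "(\<lambda>s. (q / 4) powr b * ?h s) absolutely_integrable_on {0<..}"
    "integral {0<..} (\<lambda>s. (q / 4) powr b * ?h s) = Gamma b"
    using set_integrable_cong[where M=lebesgue and A="{0<..}" and f'="\<lambda>s. (q / 4) powr b * ?h s", OF refl refl eq]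
      integral_cong[of "{0<..}" _ "\<lambda>s. (q / 4) powr b * ?h s", OF eq]
    by simp_all
  have q4: "(q / 4) powr b \<noteq> 0" using assms by simp
  have "?h absolutely_integrable_on {0<..}"
    using B(1) q4 by (subst (asm) set_integrable_mult_right_iff) auto
  moreover have "(q / 4) powr b * integral {0<..} ?h = Gamma b"
    using B(2) by simp
  ultimately have C: "set_integrable lebesgue {0<..} ?h" "(LINT s:{0<..}|lebesgue. ?h s) = Gamma b * (4 / q) powr b"
    using q4 assms by (simp_all add: set_lebesgue_integral_eq_integral(2) powr_divide field_simps)
  have m: "?h \<in> borel_measurable borel" by measurable
  show "set_integrable lborel {0<..} ?h" "heat_tail b 0 q = Gamma b * (4 / q) powr b"
    using C m by (simp_all add: heat_tail_def set_integrable_lborel_iff_lebesgue)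
qed

text \<open>No sign condition on q: beyond a positive time the exponential is at most exp
  (|q|/(4t)). Negative q occur because the derivative at x = 0 is a two-sided derivative at q =
  0.\<close>

lemma set_integrable_heat_tail:
  fixes b t q :: real
  assumes "b > 0" "t > 0"
  shows "set_integrable lborel {t<..} (\<lambda>s. s powr (- b - 1) * exp (- q / (4 * s)))"
proof (rule set_integrable_bound)
  show "set_integrable lborel {t<..} (\<lambda>s. exp (\<bar>q\<bar> / (4 * t)) * s powr (- b - 1))"
    using powr_tail_integral(1)[OF assms] by simp
  show "set_borel_measurable lborel {t<..} (\<lambda>s. s powr (- b - 1) * exp (- q / (4 * s)))"
    unfolding set_borel_measurable_def by measurable
  have "- q / (4 * s) \<le> \<bar>q\<bar> / (4 * t)" if "s > t" for s
  proof -
    have "- q / (4 * s) \<le> \<bar>q\<bar> / (4 * s)"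
      using that assms by (intro divide_right_mono) auto
    also have "\<dots> \<le> \<bar>q\<bar> / (4 * t)"
      using that assms by (intro divide_left_mono) auto
    finally show ?thesis .
  qed
  then show "AE s in lborel. s \<in> {t<..} \<longrightarrow> norm (s powr (- b - 1) * exp (- q / (4 * s)))
      \<le> norm (exp (\<bar>q\<bar> / (4 * t)) * s powr (- b - 1))"
    by (intro AE_I2) (auto simp: abs_mult mult.commute intro!: mult_left_mono)
qed

lemma heat_tail_nonneg: "0 \<le> heat_tail b t q"
  unfolding heat_tail_def set_lebesgue_integral_def by (intro integral_nonneg_AE) (auto split: split_indicator)

lemma heat_tail_le_powr:
  assumes "b > 0" "t > 0" "q \<ge> 0"
  shows "heat_tail b t q \<le> t powr (- b) / b"
proof -
  have "heat_tail b t q \<le> (LINT s:{t<..}|lborel. s powr (- b - 1))"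
    unfolding heat_tail_def
    using assms
    by (intro set_integral_mono set_integrable_heat_tail powr_tail_integral)
       (auto intro!: mult_left_le)
  then show ?thesis using powr_tail_integral(2)[OF assms(1,2)] by simp
qed

lemma heat_tail_split:
  fixes b t t' q :: real
  assumes "b > 0" "0 \<le> t" "t \<le> t'" "q > 0 \<or> t > 0"
  shows "heat_tail b t q = (LINT s:{t<..t'}|lborel. s powr (- b - 1) * exp (- q / (4 * s))) + heat_tail b t' q"
    and "set_integrable lborel {t<..t'} (\<lambda>s. s powr (- b - 1) * exp (- q / (4 * s)))"
proof -
  let ?h = "\<lambda>s::real. s powr (- b - 1) * exp (- q / (4 * s))"
  have int: "set_integrable lborel {t<..} ?h"
    using assms set_integrable_heat_tail[of b t q] set_integrable_heat_tail_0[of b q]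
    by (cases "t > 0") (auto simp: less_eq_real_def)
  have eq: "{t<..} = {t<..t'} \<union> {t'<..}" using assms by auto
  show 1: "set_integrable lborel {t<..t'} ?h"
    by (rule set_integrable_subset[OF int]) auto
  have 2: "set_integrable lborel {t'<..} ?h"
    by (rule set_integrable_subset[OF int]) (use assms in auto)
  show "heat_tail b t q = (LINT s:{t<..t'}|lborel. ?h s) + heat_tail b t' q"
    unfolding heat_tail_def by (subst eq, rule set_integral_Un) (use 1 2 in auto)
qed

lemma heat_tail_le_heat_tail_0:
  assumes "b > 0" "t \<ge> 0" "q > 0"
  shows "heat_tail b t q \<le> heat_tail b 0 q"
proof -
  have "0 \<le> (LINT s:{0<..t}|lborel. s powr (- b - 1) * exp (- q / (4 * s)))"
    unfolding set_lebesgue_integral_def by (intro integral_nonneg_AE) (auto split: split_indicator)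
  then show ?thesis using heat_tail_split(1)[of b 0 t q] assms by simp
qed

text \<open>For q > 0 the integrand is bounded in s by a multiple of q^(-b-1), so the tail is
  Lipschitz in its lower limit down to time 0. This is the source of the O(t) distance between
  kernel and profile.\<close>

lemma heat_tail_increment_le:
  assumes "b > 0" "0 \<le> t" "t \<le> t'" "q > 0"
  shows "\<bar>heat_tail b t q - heat_tail b t' q\<bar> \<le> (t' - t) * (4 powr (b + 1) * (b + 1) powr (b + 1) * q powr (- (b + 1)))"
proof -
  let ?h = "\<lambda>s::real. s powr (- b - 1) * exp (- q / (4 * s))"
  let ?C = "4 powr (b + 1) * (b + 1) powr (b + 1) * q powr (- (b + 1))"
  have le: "?h s \<le> ?C" if "s > 0" for s
    using powr_exp_heat_le[OF that assms(4), of "b + 1"] assms by simp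
  have "(LINT s:{t<..t'}|lborel. ?h s) \<le> (LINT s:{t<..t'}|lborel. ?C)"
    using assms le
    by (intro set_integral_mono heat_tail_split) (auto simp: set_integrable_def)
  also have "\<dots> = (t' - t) * ?C"
    using assms by (simp add: set_lebesgue_integral_def)
  finally have "(LINT s:{t<..t'}|lborel. ?h s) \<le> (t' - t) * ?C" .
  moreover have "0 \<le> (LINT s:{t<..t'}|lborel. ?h s)"
    unfolding set_lebesgue_integral_def by (intro integral_nonneg_AE) (auto split: split_indicator)
  ultimately show ?thesis using heat_tail_split(1)[of b t t' q] assms by simp
qed

lemma continuous_on_heat_tail_time:
  assumes "b > 0" "q > 0"
  shows "continuous_on {0..} (\<lambda>t. heat_tail b t q)"
proof (rule lipschitz_on_continuous_on)
  let ?C = "4 powr (b + 1) * (b + 1) powr (b + 1) * q powr (- (b + 1))"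
  show "?C-lipschitz_on {0..} (\<lambda>t. heat_tail b t q)"
  proof (rule lipschitz_onI)
    fix x y :: real assume "x \<in> {0..}" "y \<in> {0..}"
    then show "dist (heat_tail b x q) (heat_tail b y q) \<le> ?C * dist x y"
      using heat_tail_increment_le[of b x y q] heat_tail_increment_le[of b y x q] assms
      by (cases x y rule: linorder_cases) (auto simp: dist_real_def mult.commute abs_minus_commute)
  qed simp
qed

text \<open>The mean value inequality on the interval bounds every difference quotient by w, and
  dominated convergence along sequences gives the limit.\<close>

lemma has_real_derivative_integral:
  fixes f f' :: "real \<Rightarrow> 'a \<Rightarrow> real"
  assumes int: "\<And>q. q \<in> {a<..<c} \<Longrightarrow> integrable M (f q)"
    and meas: "\<And>q. q \<in> {a<..<c} \<Longrightarrow> f' q \<in> borel_measurable M"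
    and der: "\<And>q s. q \<in> {a<..<c} \<Longrightarrow> s \<in> space M \<Longrightarrow> ((\<lambda>q. f q s) has_real_derivative f' q s) (at q)"
    and bound: "\<And>q s. q \<in> {a<..<c} \<Longrightarrow> s \<in> space M \<Longrightarrow> \<bar>f' q s\<bar> \<le> w s"
    and w: "integrable M w"
    and q: "q \<in> {a<..<c}"
  shows "((\<lambda>q. \<integral>s. f q s \<partial>M) has_real_derivative (\<integral>s. f' q s \<partial>M)) (at q)"
  unfolding has_field_derivative_iff tendsto_at_iff_sequentially comp_def
proof (intro allI impI)
  fix X assume X: "\<forall>i. X i \<in> UNIV - {q}" "X \<longlonglongrightarrow> q"
  have "eventually (\<lambda>n. X n \<in> {a<..<c}) sequentially"
    using X(2) q by (intro topological_tendstoD) auto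
  then obtain N where N: "\<And>n. n \<ge> N \<Longrightarrow> X n \<in> {a<..<c}"
    by (auto simp: eventually_sequentially)
  \<comment> \<open>Dominated convergence wants the bound for every index; the shift drops the
    finitely many terms outside the interval.\<close>
  define Y where "Y n = X (n + N)" for n
  have Y: "Y n \<in> {a<..<c}" "Y n \<noteq> q" for n using N X(1) by (auto simp: Y_def)
  have Yl: "Y \<longlonglongrightarrow> q" unfolding Y_def using X(2) by (rule LIMSEQ_ignore_initial_segment)
  have "(\<lambda>n. \<integral>s. (f (Y n) s - f q s) / (Y n - q) \<partial>M) \<longlonglongrightarrow> (\<integral>s. f' q s \<partial>M)"
  proof (rule integral_dominated_convergence[where w = w])
    show "AE s in M. (\<lambda>n. (f (Y n) s - f q s) / (Y n - q)) \<longlonglongrightarrow> f' q s"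
    proof (rule AE_I2)
      fix s assume "s \<in> space M"
      then have "((\<lambda>y. (f y s - f q s) / (y - q)) \<longlongrightarrow> f' q s) (at q)"
        using der[OF q] by (simp add: has_field_derivative_iff)
      then show "(\<lambda>n. (f (Y n) s - f q s) / (Y n - q)) \<longlonglongrightarrow> f' q s"
        using Y(2) Yl by (auto simp: tendsto_at_iff_sequentially comp_def)
    qed
    show "AE s in M. norm ((f (Y n) s - f q s) / (Y n - q)) \<le> w s" for n
    proof (rule AE_I2)
      fix s assume s: "s \<in> space M"
      have "norm (f (Y n) s - f q s) \<le> w s * norm (Y n - q)"
      proof (rule field_differentiable_bound[where S="{a<..<c}" and f' = "\<lambda>q. f' q s"])
        show "\<And>z. z \<in> {a<..<c} \<Longrightarrow> ((\<lambda>a. f a s) has_field_derivative f' z s) (at z within {a<..<c})"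
          using der s by (blast intro: has_field_derivative_at_within)
      qed (use s q Y bound in auto)
      then show "norm ((f (Y n) s - f q s) / (Y n - q)) \<le> w s"
        using Y(2)[of n] by (simp add: divide_le_eq)
    qed
  qed (use meas[OF q] int[OF q] int[OF Y(1)] w in auto)
  moreover have "(\<integral>s. (f (Y n) s - f q s) / (Y n - q) \<partial>M) =
      ((\<integral>s. f (Y n) s \<partial>M) - (\<integral>s. f q s \<partial>M)) / (Y n - q)" for n
    using int[OF q] int[OF Y(1)] by simp
  ultimately have "(\<lambda>n. ((\<integral>s. f (Y n) s \<partial>M) - (\<integral>s. f q s \<partial>M)) / (Y n - q)) \<longlonglongrightarrow> (\<integral>s. f' q s \<partial>M)"
    by (simp only:)
  then show "(\<lambda>n. ((\<integral>s. f (X n) s \<partial>M) - (\<integral>s. f q s \<partial>M)) / (X n - q)) \<longlonglongrightarrow> (\<integral>s. f' q s \<partial>M)"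
    unfolding Y_def
    by (intro LIMSEQ_offset[of "\<lambda>n. ((\<integral>s. f (X n) s \<partial>M) - (\<integral>s. f q s \<partial>M)) / (X n - q)" N])
qed

text \<open>The exponential brings down -1/(4s), which is the weight of order b + 1. It decreases in
  q, so on a unit neighbourhood the integrand at q - 1 dominates.\<close>

lemma has_real_derivative_heat_tail:
  assumes "b > 0" "t > 0"
  shows "((\<lambda>q. heat_tail b t q) has_real_derivative - heat_tail (b + 1) t q / 4) (at q)"
proof -
  let ?f = "\<lambda>q s. indicator {t<..} s * (s powr (- b - 1) * exp (- q / (4 * s)))"
  let ?f' = "\<lambda>q s. indicator {t<..} s * (s powr (- (b + 1) - 1) * exp (- q / (4 * s))) * (- 1 / 4)"
  let ?w = "\<lambda>s. indicator {t<..} s * (s powr (- (b + 1) - 1) * exp (- (q - 1) / (4 * s))) / 4"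
  have i: "integrable lborel (?f q)" for q
    using set_integrable_heat_tail[OF assms, of q] by (simp add: set_integrable_def)
  have i': "integrable lborel (\<lambda>s. indicator {t<..} s * (s powr (- (b + 1) - 1) * exp (- q / (4 * s))))" for q
    using set_integrable_heat_tail[of "b+1" t q] assms by (simp add: set_integrable_def)
  have "((\<lambda>q. \<integral>s. ?f q s \<partial>lborel) has_real_derivative (\<integral>s. ?f' q s \<partial>lborel)) (at q)"
  proof (rule has_real_derivative_integral[where a = "q - 1" and c = "q + 1" and w = ?w])
    show "integrable lborel ?w" by (intro integrable_divide i')
    fix q' s :: real assume q': "q' \<in> {q-1<..<q+1}"
    show "((\<lambda>q. ?f q s) has_real_derivative ?f' q' s) (at q')"
    proof (cases "s > t")
      case True
      then have p: "s powr (- (b + 1) - 1) = s powr (- b - 1) / s"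
        using assms by (simp add: powr_diff powr_minus powr_add field_simps power2_eq_square)
      have "((\<lambda>q. exp (- q / (4 * s))) has_real_derivative exp (- q' / (4 * s)) * (- 1 / (4 * s))) (at q')"
        using True assms by (auto intro!: derivative_eq_intros)
      from DERIV_cmult[OF this, of "s powr (- b - 1)"] show ?thesis
        using True p assms by (simp add: mult.commute)
    qed simp
    have "exp (- q' / (4 * s)) \<le> exp (- (q - 1) / (4 * s))" if "s > t"
      using that assms q' by (intro exp_le_cancel_iff[THEN iffD2] divide_right_mono) auto
    then show "\<bar>?f' q' s\<bar> \<le> ?w s"
      using assms by (auto split: split_indicator simp: abs_mult intro!: mult_left_mono)
  qed (use i in auto)
  then show ?thesis by (simp add: heat_tail_def set_lebesgue_integral_def)
qed

section \<open>Gaussian moments and the semigroup property\<close>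

text \<open>Lebesgue measure is the image of the product measure on the coordinates, so integrals of
  products of one-variable functions factor.\<close>

lemma lborel_prod_integral:
  fixes f :: "'a::euclidean_space \<Rightarrow> real \<Rightarrow> real"
  assumes "\<And>b. b \<in> Basis \<Longrightarrow> integrable lborel (f b)"
  shows integrable_lborel_prod: "integrable lborel (\<lambda>x::'a. \<Prod>b\<in>Basis. f b (x \<bullet> b))"
    and integral_lborel_prod:
      "(\<integral>x. (\<Prod>b\<in>Basis. f b (x \<bullet> b)) \<partial>lborel) = (\<Prod>b\<in>Basis. \<integral>v. f b v \<partial>lborel)"
proof -
  interpret product_sigma_finite "\<lambda>_::'a. lborel :: real measure" ..
  let ?M = "Pi\<^sub>M (Basis::'a set) (\<lambda>_. lborel :: real measure)"
  have f: "f b \<in> borel_measurable borel" if "b \<in> Basis" for b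
    using assms[OF that] by auto
  have T: "(\<lambda>f. \<Sum>b\<in>Basis. f b *\<^sub>R b) \<in> measurable ?M (borel :: 'a measure)"
    by measurable
  have F: "(\<lambda>x::'a. \<Prod>b\<in>Basis. f b (x \<bullet> b)) \<in> borel_measurable borel"
    using f by (intro borel_measurable_prod measurable_compose[OF _ f]) auto
  have *: "(\<Prod>b\<in>Basis. f b ((\<Sum>c\<in>Basis. g c *\<^sub>R c) \<bullet> b)) = (\<Prod>b\<in>(Basis::'a set). f b (g b))" for g
    by (intro prod.cong refl) simp
  show "integrable lborel (\<lambda>x::'a. \<Prod>b\<in>Basis. f b (x \<bullet> b))"
    by (subst lborel_eq, subst integrable_distr_eq[OF T F], unfold *)
      (intro product_integrable_prod finite_Basis assms)
  show "(\<integral>x. (\<Prod>b\<in>Basis. f b (x \<bullet> b)) \<partial>lborel) = (\<Prod>b\<in>Basis. \<integral>v. f b v \<partial>lborel)"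
    by (subst lborel_eq, subst integral_distr[OF T F], unfold *)
      (intro product_integral_prod finite_Basis assms)
qed

lemma lborel_prod_integral_cart:
  fixes f :: "'n::finite \<Rightarrow> real \<Rightarrow> real"
  assumes "\<And>i. integrable lborel (f i)"
  shows integrable_lborel_prod_cart: "integrable lborel (\<lambda>x::real^'n. \<Prod>i\<in>UNIV. f i (x $ i))"
    and integral_lborel_prod_cart:
      "(\<integral>x. (\<Prod>i\<in>UNIV. f i ((x::real^'n) $ i)) \<partial>lborel) = (\<Prod>i\<in>UNIV. \<integral>v. f i v \<partial>lborel)"
proof -
  have inj: "inj (\<lambda>i::'n. axis i (1::real))"
    by (auto simp: inj_on_def axis_eq_axis)
  define g where "g b = f (inv (\<lambda>i::'n. axis i (1::real)) b)" for b
  have B: "(Basis :: (real^'n) set) = range (\<lambda>i. axis i 1)" by (auto simp: Basis_vec_def)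
  have g: "g (axis i 1) = f i" for i unfolding g_def using inv_f_f[OF inj] by metis
  have *: "(\<Prod>b\<in>Basis. h b) = (\<Prod>i\<in>UNIV. h (axis i 1))" for h :: "real^'n \<Rightarrow> real"
    unfolding B by (subst prod.reindex[OF inj]) simp
  have i: "integrable lborel (g b)" for b unfolding g_def by (rule assms)
  show "integrable lborel (\<lambda>x::real^'n. \<Prod>i\<in>UNIV. f i (x $ i))"
    using integrable_lborel_prod[of g, OF i] by (simp add: * g inner_axis)
  show "(\<integral>x. (\<Prod>i\<in>UNIV. f i ((x::real^'n) $ i)) \<partial>lborel) = (\<Prod>i\<in>UNIV. \<integral>v. f i v \<partial>lborel)"
    using integral_lborel_prod[of g, OF i] by (simp add: * g inner_axis)
qed

lemma lborel_distr_shift_reflect: "distr lborel borel (\<lambda>y::'a::euclidean_space. x - y) = lborel"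
  using lborel_affine[of "-1" x] by (simp add: density_1)

lemma lborel_distr_shift: "distr lborel borel (\<lambda>y::'a::euclidean_space. y - x) = lborel"
  using lborel_affine[of 1 "-x"] by (simp add: density_1)

lemma heat_kernel_nonneg: "0 \<le> heat_kernel t x"
  by (simp add: heat_kernel_def)

lemma heat_kernel_measurable [measurable]: "heat_kernel t \<in> borel_measurable borel"
  unfolding heat_kernel_def by measurable

text \<open>Independent centred normal coordinates of variance 2t: polynomial moments of the heat
  kernel reduce to one-dimensional normal moments.\<close>

lemma heat_kernel_eq_prod:
  fixes x :: "real^'n::finite"
  assumes "t > 0"
  shows "heat_kernel t x = (\<Prod>i\<in>UNIV. normal_density 0 (sqrt (2 * t)) (x $ i))"
proof -
  have "(\<Prod>i\<in>UNIV. normal_density 0 (sqrt (2 * t)) (x $ i)) =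
      (1 / sqrt (4 * pi * t)) ^ CARD('n) * exp (\<Sum>i\<in>UNIV. - (x $ i)\<^sup>2 / (4 * t))"
    unfolding normal_density_def prod.distrib
    using assms by (simp add: exp_sum mult.commute mult.left_commute)
  also have "(\<Sum>i\<in>UNIV. - (x $ i)\<^sup>2 / (4 * t)) = - (norm x)\<^sup>2 / (4 * t)"
    by (simp add: norm_vec_def L2_set_def sum_nonneg sum_negf sum_divide_distrib)
  also have "(1 / sqrt (4 * pi * t)) ^ CARD('n) = (4 * pi * t) powr (- (real CARD('n) / 2))"
  proof -
    have "1 / sqrt (4 * pi * t) = (4 * pi * t) powr (- 1 / 2)"
      using assms by (simp add: powr_minus_divide powr_half_sqrt)
    then show ?thesis using assms by (simp add: powr_realpow[symmetric] powr_powr)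
  qed
  finally show ?thesis by (simp add: heat_kernel_def)
qed

lemma normal_density_moments:
  assumes "\<sigma> > 0"
  shows "integrable lborel (\<lambda>v. normal_density 0 \<sigma> v * v ^ e)"
    and "(\<integral>v. normal_density 0 \<sigma> v * v \<partial>lborel) = 0"
    and "(\<integral>v. normal_density 0 \<sigma> v * v\<^sup>2 \<partial>lborel) = \<sigma>\<^sup>2"
proof -
  show "integrable lborel (\<lambda>v. normal_density 0 \<sigma> v * v ^ e)"
    using integrable_normal_moment[OF assms, of 0 e] by simp
  show "(\<integral>v. normal_density 0 \<sigma> v * v \<partial>lborel) = 0"
    using integral_normal_moment_nz_1[OF assms, of 0] by simp
  show "(\<integral>v. normal_density 0 \<sigma> v * v\<^sup>2 \<partial>lborel) = \<sigma>\<^sup>2"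
    using integral_normal_moment_even[OF assms, of 0 1] by (simp add: fact_2 numeral_2_eq_2)
qed

lemma heat_kernel_moment:
  fixes e :: "'n::finite \<Rightarrow> nat"
  assumes "t > 0"
  shows "integrable lborel (\<lambda>x::real^'n. heat_kernel t x * (\<Prod>i\<in>UNIV. (x $ i) ^ e i))"
    and "(\<integral>x. heat_kernel t (x::real^'n) * (\<Prod>i\<in>UNIV. (x $ i) ^ e i) \<partial>lborel)
      = (\<Prod>i\<in>UNIV. \<integral>v. normal_density 0 (sqrt (2 * t)) v * v ^ e i \<partial>lborel)"
proof -
  have s: "0 < sqrt (2 * t)" using assms by simp
  have *: "heat_kernel t x * (\<Prod>i\<in>UNIV. (x $ i) ^ e i) =
      (\<Prod>i\<in>UNIV. normal_density 0 (sqrt (2 * t)) (x $ i) * (x $ i) ^ e i)" for x :: "real^'n"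
    by (simp add: heat_kernel_eq_prod[OF assms] prod.distrib)
  show "integrable lborel (\<lambda>x::real^'n. heat_kernel t x * (\<Prod>i\<in>UNIV. (x $ i) ^ e i))"
    unfolding * by (intro integrable_lborel_prod_cart normal_density_moments s)
  show "(\<integral>x. heat_kernel t (x::real^'n) * (\<Prod>i\<in>UNIV. (x $ i) ^ e i) \<partial>lborel)
      = (\<Prod>i\<in>UNIV. \<integral>v. normal_density 0 (sqrt (2 * t)) v * v ^ e i \<partial>lborel)"
    unfolding * by (intro integral_lborel_prod_cart normal_density_moments s)
qed

lemma heat_kernel_integral:
  assumes "t > 0"
  shows integrable_heat_kernel: "integrable lborel (heat_kernel t :: real^'n::finite \<Rightarrow> real)"
    and integral_heat_kernel: "(\<integral>x. heat_kernel t (x :: real^'n) \<partial>lborel) = 1"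
  using heat_kernel_moment[OF assms, of "\<lambda>_::'n. 0"] assms by simp_all

lemma heat_kernel_first_moment:
  fixes h :: "'n::finite"
  assumes "t > 0"
  shows "integrable lborel (\<lambda>x::real^'n. heat_kernel t x * x $ h)"
    and "(\<integral>x. heat_kernel t (x::real^'n) * x $ h \<partial>lborel) = 0"
proof -
  let ?e = "\<lambda>i. of_bool (i = h) :: nat"
  have *: "(\<Prod>i\<in>UNIV. (x $ i) ^ ?e i) = x $ h" for x :: "real^'n"
    by (subst prod.remove[of _ h]) (auto intro!: prod.neutral)
  show "integrable lborel (\<lambda>x::real^'n. heat_kernel t x * x $ h)"
    using heat_kernel_moment(1)[OF assms, of ?e] unfolding * .
  have "(\<integral>x. heat_kernel t (x::real^'n) * x $ h \<partial>lborel) =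
      (\<Prod>i\<in>UNIV. \<integral>v. normal_density 0 (sqrt (2 * t)) v * v ^ ?e i \<partial>lborel)"
    using heat_kernel_moment(2)[OF assms, of ?e] unfolding * .
  also have "\<dots> = 0"
    using assms by (intro prod_zero) (auto intro!: bexI[of _ h] simp: normal_density_moments)
  finally show "(\<integral>x. heat_kernel t (x::real^'n) * x $ h \<partial>lborel) = 0" .
qed

lemma heat_kernel_second_moment:
  fixes h k :: "'n::finite"
  assumes "t > 0"
  shows "integrable lborel (\<lambda>x::real^'n. heat_kernel t x * (x $ h * x $ k))"
    and "(\<integral>x. heat_kernel t (x::real^'n) * (x $ h * x $ k) \<partial>lborel) = (if h = k then 2 * t else 0)"
proof -
  \<comment> \<open>Exponents as sums of indicators treat h = k (one exponent 2) and h \<noteq> k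
    (two exponents 1) by one formula.\<close>
  let ?e = "\<lambda>i. of_bool (i = h) + of_bool (i = k) :: nat"
  have 1: "(\<Prod>i\<in>UNIV. (x $ i) ^ (of_bool (i = l) :: nat)) = x $ l" for x :: "real^'n" and l
    by (subst prod.remove[of _ l]) (auto intro!: prod.neutral)
  have *: "(\<Prod>i\<in>UNIV. (x $ i) ^ ?e i) = x $ h * x $ k" for x :: "real^'n"
    by (simp add: power_add prod.distrib 1)
  show "integrable lborel (\<lambda>x::real^'n. heat_kernel t x * (x $ h * x $ k))"
    using heat_kernel_moment(1)[OF assms, of ?e] unfolding * .
  have "(\<integral>x. heat_kernel t (x::real^'n) * (x $ h * x $ k) \<partial>lborel) =
      (\<Prod>i\<in>UNIV. \<integral>v. normal_density 0 (sqrt (2 * t)) v * v ^ ?e i \<partial>lborel)"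
    using heat_kernel_moment(2)[OF assms, of ?e] unfolding * .
  also have "\<dots> = (if h = k then 2 * t else 0)"
  proof (cases "h = k")
    case True
    have "(\<Prod>i\<in>UNIV. \<integral>v. normal_density 0 (sqrt (2 * t)) v * v ^ ?e i \<partial>lborel) =
       (\<integral>v. normal_density 0 (sqrt (2 * t)) v * v\<^sup>2 \<partial>lborel)"
      using True assms by (subst prod.remove[of _ h]) (auto intro!: prod.neutral simp: numeral_2_eq_2)
    then show ?thesis using True assms by (simp add: normal_density_moments)
  next
    case False
    then show ?thesis
      using assms by (intro trans[OF prod_zero]) (auto intro!: bexI[of _ h] simp: normal_density_moments)
  qed
  finally show "(\<integral>x. heat_kernel t (x::real^'n) * (x $ h * x $ k) \<partial>lborel) = (if h = k then 2 * t else 0)" .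
qed

section \<open>Translates and second derivatives of the heat kernel\<close>

lemma integral_heat_kernel_diff:
  fixes x :: "real^'n::finite"
  assumes "t > 0"
  shows "integrable lborel (\<lambda>y. heat_kernel t (x - y))" "(\<integral>y. heat_kernel t (x - y) \<partial>lborel) = 1"
    and "integrable lborel (\<lambda>y. heat_kernel t (y - x))" "(\<integral>y. heat_kernel t (y - x) \<partial>lborel) = 1"
proof -
  have "integrable (distr lborel borel (\<lambda>y. x - y)) (heat_kernel t)"
    "(\<integral>y. heat_kernel t y \<partial>distr lborel borel (\<lambda>y. x - y)) = 1"
    unfolding lborel_distr_shift_reflect using heat_kernel_integral[OF assms] by auto
  then show "integrable lborel (\<lambda>y. heat_kernel t (x - y))" "(\<integral>y. heat_kernel t (x - y) \<partial>lborel) = 1"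
    by (auto simp: integrable_distr_eq integral_distr)
  have "integrable (distr lborel borel (\<lambda>y. y - x)) (heat_kernel t)"
    "(\<integral>y. heat_kernel t y \<partial>distr lborel borel (\<lambda>y. y - x)) = 1"
    unfolding lborel_distr_shift using heat_kernel_integral[OF assms] by auto
  then show "integrable lborel (\<lambda>y. heat_kernel t (y - x))" "(\<integral>y. heat_kernel t (y - x) \<partial>lborel) = 1"
    by (auto simp: integrable_distr_eq integral_distr)
qed

text \<open>The closed form of the second derivative of the heat kernel in directions h and k,
  identified as such in \<open>pd_pd_heat_kernel\<close>. With the formula at hand, convolutions are
  computed from Gaussian moments.\<close>

definition hess_heat :: "'n \<Rightarrow> 'n \<Rightarrow> real \<Rightarrow> real^'n::finite \<Rightarrow> real" where
  "hess_heat h k t x = (x $ h * x $ k / (4 * t\<^sup>2) - of_bool (h = k) / (2 * t)) * heat_kernel t x"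

lemma hess_heat_measurable [measurable]: "hess_heat h k t \<in> borel_measurable borel"
  unfolding hess_heat_def by measurable

text \<open>Completing the square in y in a product of two Gaussians, with X = |x|^2, Y = |y|^2 and
  P the inner product of x and y: the centre is t/(s+t) x and the new time is st/(s+t).\<close>

lemma square_completion:
  fixes s t X Y P::real
  assumes "s>0" "t>0"
  shows "(X - 2*P + Y) / (4 * s) + Y / (4 * t) =
      X / (4 * (s + t)) + (Y - 2 * (t/(s+t)) * P + (t/(s+t))\<^sup>2 * X) / (4 * (s * t / (s + t)))"
proof -
  define w where "w = s + t"
  have w: "w > 0" "t = w - s" using assms by (auto simp: w_def)
  show ?thesis unfolding w_def[symmetric] using assms(1) assms(2) w(1) unfolding w(2)
    by (simp add: field_simps power2_eq_square)
qed

text \<open>Taylor expansion of the Hessian factor about the centre m of the completed square. H and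
  G are the two Gaussian factors and d is a Kronecker symbol; what remains to integrate are moments
  of order 0, 1 and 2.\<close>

lemma shifted_quadratic:
  fixes t::real
  assumes "t>0"
  shows "H * G * (yh * yk / (4 * t\<^sup>2) - d / (2 * t)) =
   H * (G * ((yh - mh) * (yk - mk)) / (4 * t\<^sup>2) + G * (yh - mh) * (mk / (4 * t\<^sup>2))
      + G * (yk - mk) * (mh / (4 * t\<^sup>2))
      + G * (mh * mk / (4 * t\<^sup>2) - d / (2 * t)))"
proof -
  have "yh * yk / (4 * t\<^sup>2) = (yh - mh) * (yk - mk) / (4 * t\<^sup>2) + (yh - mh) * (mk / (4 * t\<^sup>2))
      + (yk - mk) * (mh / (4 * t\<^sup>2)) + mh * mk / (4 * t\<^sup>2)"
    using assms by (simp add: field_simps)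
  then show ?thesis by (simp only: ring_distribs times_divide_eq_right mult.assoc)
qed

text \<open>The covariance 2st/(s+t) and the mean t/(s+t) x recombine to the Hessian factor at time
  s + t.\<close>

lemma gaussian_moment_combination:
  fixes s t::real
  assumes "s>0" "t>0"
  shows "(if P then 2 * (s * t / (s + t)) else 0) / (4 * t\<^sup>2) +
     ((t/(s+t) * xh) * (t/(s+t) * xk) / (4 * t\<^sup>2) - of_bool P / (2 * t)) =
    xh * xk / (4 * (s+t)\<^sup>2) - of_bool P / (2 * (s+t))"
proof -
  define w where "w = s + t"
  have w: "w > 0" "s = w - t" using assms by (auto simp: w_def)
  have "(t / w * xh) * (t / w * xk) / (4 * t\<^sup>2) = xh * xk / (4 * w\<^sup>2)"
    using assms w by (simp add: power2_eq_square)
  moreover have "2 * (s * t / w) / (4 * t\<^sup>2) - 1 / (2 * t) = - 1 / (2 * w)"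
    unfolding w(2) using assms w(1) by (simp add: divide_simps) (simp add: algebra_simps power2_eq_square)
  ultimately show ?thesis unfolding w_def[symmetric] by auto
qed

text \<open>Factorisation of a Gaussian joint density into marginal and conditional: the sum of the
  two variables has time s + t, and given that it equals x, the second one is centred at t/(s+t)
  x.\<close>

lemma heat_kernel_mult:
  fixes x y :: "real^'n::finite"
  assumes "s > 0" "t > 0"
  shows "heat_kernel s (x - y) * heat_kernel t y =
    heat_kernel (s + t) x * heat_kernel (s * t / (s + t)) (y - (t / (s + t)) *\<^sub>R x)"
proof -
  have st: "s + t > 0" using assms by simp
  have e: "(norm (x - y))\<^sup>2 / (4 * s) + (norm y)\<^sup>2 / (4 * t) =
      (norm x)\<^sup>2 / (4 * (s + t)) + (norm (y - (t / (s + t)) *\<^sub>R x))\<^sup>2 / (4 * (s * t / (s + t)))"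
  proof -
    have 1: "(norm (x - y))\<^sup>2 = (norm x)\<^sup>2 - 2 * (x \<bullet> y) + (norm y)\<^sup>2"
      by (simp add: power2_norm_eq_inner inner_diff inner_commute)
    have 2: "(norm (y - c *\<^sub>R x))\<^sup>2 = (norm y)\<^sup>2 - 2 * c * (x \<bullet> y) + c\<^sup>2 * (norm x)\<^sup>2" for c
      unfolding power2_norm_eq_inner by (simp add: inner_diff inner_commute power2_eq_square)
    show ?thesis
      unfolding 1 2 by (rule square_completion[OF assms])
  qed
  have p: "(4 * pi * s) powr (- (real CARD('n) / 2)) * (4 * pi * t) powr (- (real CARD('n) / 2)) =
      (4 * pi * (s + t)) powr (- (real CARD('n) / 2)) * (4 * pi * (s * t / (s + t))) powr (- (real CARD('n) / 2))"
  proof -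
    have "(4 * pi * s) * (4 * pi * t) = (4 * pi * (s + t)) * (4 * pi * (s * t / (s + t)))"
      using st by simp
    then have "((4 * pi * s) * (4 * pi * t)) powr (- (real CARD('n) / 2)) =
        ((4 * pi * (s + t)) * (4 * pi * (s * t / (s + t)))) powr (- (real CARD('n) / 2))"
      by (rule arg_cong)
    then show ?thesis
      by (simp only: powr_mult)
  qed
  have "heat_kernel s (x - y) * heat_kernel t y =
    (4 * pi * s) powr (- (real CARD('n) / 2)) * (4 * pi * t) powr (- (real CARD('n) / 2)) *
    exp (- ((norm (x - y))\<^sup>2 / (4 * s) + (norm y)\<^sup>2 / (4 * t)))"
    by (simp add: heat_kernel_def exp_add[symmetric])
  also have "\<dots> = heat_kernel (s + t) x * heat_kernel (s * t / (s + t)) (y - (t / (s + t)) *\<^sub>R x)"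
    unfolding e p by (simp add: heat_kernel_def exp_add[symmetric])
  finally show ?thesis .
qed

text \<open>The semigroup property for the differentiated kernel, obtained by integrating a
  quadratic polynomial against one shifted Gaussian. This avoids differentiating under the
  convolution.\<close>

lemma heat_kernel_hess_heat_convolution:
  fixes x :: "real^'n::finite"
  assumes "s > 0" "t > 0"
  shows "integrable lborel (\<lambda>y. heat_kernel s (x - y) * hess_heat h k t y)"
    and "(\<integral>y. heat_kernel s (x - y) * hess_heat h k t y \<partial>lborel) = hess_heat h k (s + t) x"
proof -
  define m where "m = (t / (s + t)) *\<^sub>R x"
  define \<tau> where "\<tau> = s * t / (s + t)"
  have tau: "\<tau> > 0" using assms by (simp add: \<tau>_def)
  define g :: "real^'n \<Rightarrow> real" where "g z = heat_kernel (s + t) x *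
     (heat_kernel \<tau> z * (z $ h * z $ k) / (4 * t\<^sup>2) + heat_kernel \<tau> z * z $ h * (m $ k / (4 * t\<^sup>2))
      + heat_kernel \<tau> z * z $ k * (m $ h / (4 * t\<^sup>2))
      + heat_kernel \<tau> z * (m $ h * m $ k / (4 * t\<^sup>2) - of_bool (h = k) / (2 * t)))" for z
  have eq: "heat_kernel s (x - y) * hess_heat h k t y = g (y - m)" for y
  proof -
    have "heat_kernel s (x - y) * hess_heat h k t y =
      (heat_kernel s (x - y) * heat_kernel t y) * (y $ h * y $ k / (4 * t\<^sup>2) - of_bool (h = k) / (2 * t))"
      by (simp add: hess_heat_def mult_ac)
    also have "\<dots> = g (y - m)"
      unfolding heat_kernel_mult[OF assms] g_def m_def[symmetric] \<tau>_def[symmetric]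
        vector_minus_component
      by (rule shifted_quadratic[OF assms(2)])
    finally show ?thesis .
  qed
  have H0: "has_bochner_integral lborel (heat_kernel \<tau> :: real^'n \<Rightarrow> real) 1"
    and H1: "has_bochner_integral lborel (\<lambda>z. heat_kernel \<tau> (z::real^'n) * z $ l) 0"
    and H2: "has_bochner_integral lborel (\<lambda>z. heat_kernel \<tau> (z::real^'n) * (z $ h * z $ k)) (if h = k then 2 * \<tau> else 0)" for l
    using heat_kernel_integral[OF tau, where 'n='n] heat_kernel_first_moment[OF tau, where 'n='n]
      heat_kernel_second_moment[OF tau, where 'n='n] by (simp_all only: has_bochner_integral_iff)
  have H: "has_bochner_integral lborel g (heat_kernel (s + t) x *
     ((if h = k then 2 * \<tau> else 0) / (4 * t\<^sup>2) + 0 * (m $ k / (4 * t\<^sup>2)) + 0 * (m $ h / (4 * t\<^sup>2))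
      + 1 * (m $ h * m $ k / (4 * t\<^sup>2) - of_bool (h = k) / (2 * t))))"
    unfolding g_def
    by (intro has_bochner_integral_mult_right has_bochner_integral_add has_bochner_integral_divide
        has_bochner_integral_mult_left H0 H1 H2)
  then have int: "integrable lborel g" by (simp add: has_bochner_integral_iff)
  have "(\<integral>z. g z \<partial>lborel) = heat_kernel (s + t) x *
     ((if h = k then 2 * \<tau> else 0) / (4 * t\<^sup>2) + (m $ h * m $ k / (4 * t\<^sup>2) - of_bool (h = k) / (2 * t)))"
    using H by (simp add: has_bochner_integral_iff)
  also have "\<dots> = hess_heat h k (s + t) x"
    unfolding hess_heat_def m_def \<tau>_def vector_scaleR_component real_scaleR_def
    by (subst gaussian_moment_combination[OF assms]) (simp add: mult.commute)
  finally have "(\<integral>z. g z \<partial>lborel) = hess_heat h k (s + t) x" .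
  then have "integrable (distr lborel borel (\<lambda>y. y - m)) g"
    "(\<integral>y. g y \<partial>distr lborel borel (\<lambda>y. y - m)) = hess_heat h k (s + t) x"
    unfolding lborel_distr_shift using int by auto
  moreover have "g \<in> borel_measurable borel" using int by auto
  ultimately show "integrable lborel (\<lambda>y. heat_kernel s (x - y) * hess_heat h k t y)"
    "(\<integral>y. heat_kernel s (x - y) * hess_heat h k t y \<partial>lborel) = hess_heat h k (s + t) x"
    unfolding eq by (auto simp: integrable_distr_eq integral_distr)
qed

text \<open>The variance 2t cancels the diagonal term 1/(2t). The zero mean allows constants to be
  added to the fundamental solution without changing its convolution with the Hessian.\<close>

lemma hess_heat_integral:
  fixes h k :: "'n::finite"
  assumes "t > 0"
  shows "integrable lborel (hess_heat h k t)" and "(\<integral>y. hess_heat h k t y \<partial>lborel) = 0"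
proof -
  have eq: "hess_heat h k t = (\<lambda>y. heat_kernel t y * (y $ h * y $ k) / (4 * t\<^sup>2) -
      heat_kernel t y * (of_bool (h = k) / (2 * t)))"
    by (simp add: hess_heat_def fun_eq_iff left_diff_distrib right_diff_distrib mult.commute)
  have H0: "has_bochner_integral lborel (heat_kernel t :: real^'n \<Rightarrow> real) 1"
    and H2: "has_bochner_integral lborel (\<lambda>z. heat_kernel t (z::real^'n) * (z $ h * z $ k)) (if h = k then 2 * t else 0)"
    using heat_kernel_integral[OF assms, where 'n='n]
      heat_kernel_second_moment[OF assms, where 'n='n] by (simp_all only: has_bochner_integral_iff)
  have "has_bochner_integral lborel (hess_heat h k t)
     ((if h = k then 2 * t else 0) / (4 * t\<^sup>2) - 1 * (of_bool (h = k) / (2 * t)))"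
    unfolding eq
    by (intro has_bochner_integral_diff has_bochner_integral_divide
        has_bochner_integral_mult_left H0 H2)
  then show "integrable lborel (hess_heat h k t)" "(\<integral>y. hess_heat h k t y \<partial>lborel) = 0"
    using assms by (auto simp add: has_bochner_integral_iff power2_eq_square split: if_splits)
qed

text \<open>Half of the Gaussian exponent absorbs the polynomial weight; the other half is the
  kernel at time 2t up to the factor 2^(d/2). The absorbing Gaussian widens as t grows, hence the
  bound S on the time.\<close>

lemma weighted_heat_kernel_bound:
  fixes N :: real
  assumes "N \<ge> 0" "S > 0"
  obtains C where "C > 0"
    "\<And>t x. \<lbrakk>0 < t; t \<le> S\<rbrakk> \<Longrightarrow> (1 + norm x) powr N * heat_kernel t (x::real^'n::finite) \<le> C * heat_kernel (2 * t) x"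
proof -
  \<comment> \<open>From 1 + r \<le> 2 + r^2 and the bound for x^N exp (-x) at x = (2 + r^2)/(8S);
    the last factor undoes the shift by 2. The case N = 0 is separate because
    \<open>0 powr 0\<close> is 0.\<close>
  define K where "K = (8 * S) powr N * (if N = 0 then 1 else N powr N) * exp (2 / (8 * S))"
  have K: "(1 + r) powr N * exp (- r\<^sup>2 / (8 * S)) \<le> K" if "r \<ge> 0" for r :: real
  proof -
    have "(1 + r) powr N \<le> (2 + r\<^sup>2) powr N"
    proof (intro powr_mono2)
      have "0 \<le> (r - 1/2)\<^sup>2" by simp
      then show "1 + r \<le> 2 + r\<^sup>2" by (simp add: power2_eq_square algebra_simps)
    qed (use assms that in auto)
    then have "(1 + r) powr N * exp (- r\<^sup>2 / (8 * S)) \<le> (2 + r\<^sup>2) powr N * exp (- r\<^sup>2 / (8 * S))"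
      by (intro mult_right_mono) auto
    also have "\<dots> = (8 * S) powr N * (((2 + r\<^sup>2) / (8 * S)) powr N * exp (- ((2 + r\<^sup>2) / (8 * S)))) * exp (2 / (8 * S))"
    proof -
      have "exp (- ((2 + r\<^sup>2) / (8 * S))) * exp (2 / (8 * S)) = exp (- r\<^sup>2 / (8 * S))"
        unfolding exp_add[symmetric] by (simp add: add_divide_distrib)
      moreover have "(8 * S) powr N * ((2 + r\<^sup>2) / (8 * S)) powr N = (2 + r\<^sup>2) powr N"
        using assms by (simp flip: powr_mult)
      ultimately show ?thesis by (simp add: mult.assoc[symmetric])
    qed
    also have "\<dots> \<le> K"
    proof -
      have "((2 + r\<^sup>2) / (8 * S)) powr N * exp (- ((2 + r\<^sup>2) / (8 * S))) \<le> (if N = 0 then 1 else N powr N)"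
        using powr_exp_minus_le[of N "(2 + r\<^sup>2) / (8 * S)"] assms by (auto simp: powr_def)
      then show ?thesis unfolding K_def by (intro mult_right_mono mult_left_mono) auto
    qed
    finally show ?thesis .
  qed
  have "K > 0" unfolding K_def using assms by auto
  show thesis
  proof (rule that[of "2 powr (real CARD('n) / 2) * K"])
    show "2 powr (real CARD('n) / 2) * K > 0" using \<open>K > 0\<close> by simp
    fix t :: real and x :: "real^'n" assume t: "0 < t" "t \<le> S"
    have "exp (- (norm x)\<^sup>2 / (4 * t)) = exp (- (norm x)\<^sup>2 / (8 * t)) * exp (- (norm x)\<^sup>2 / (8 * t))"
      using t by (simp add: exp_add[symmetric])
    moreover have "(4 * pi * t) powr (- (real CARD('n) / 2)) =
        2 powr (real CARD('n) / 2) * (4 * pi * (2 * t)) powr (- (real CARD('n) / 2))"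
    proof -
      have "A powr (- p) = 2 powr p * (2 * A) powr (- p)" if "A > 0" for A p :: real
        using that by (simp add: powr_mult powr_minus)
      from this[of "4 * pi * t" "real CARD('n) / 2"] show ?thesis using t by (simp add: mult.left_commute)
    qed
    ultimately have "(1 + norm x) powr N * heat_kernel t x =
      2 powr (real CARD('n) / 2) * ((1 + norm x) powr N * exp (- (norm x)\<^sup>2 / (8 * t))) * heat_kernel (2 * t) x"
      by (simp add: heat_kernel_def)
    also have "\<dots> \<le> 2 powr (real CARD('n) / 2) * K * heat_kernel (2 * t) x"
    proof -
      have "- (norm x)\<^sup>2 / (8 * t) \<le> - (norm x)\<^sup>2 / (8 * S)"
        using t by (simp add: frac_le)
      then have "(1 + norm x) powr N * exp (- (norm x)\<^sup>2 / (8 * t)) \<le> (1 + norm x) powr N * exp (- (norm x)\<^sup>2 / (8 * S))"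
        by (intro mult_left_mono) auto
      also have "\<dots> \<le> K" using K by simp
      finally show ?thesis
        by (intro mult_right_mono mult_left_mono heat_kernel_nonneg) auto
    qed
    finally show "(1 + norm x) powr N * heat_kernel t x \<le> 2 powr (real CARD('n) / 2) * K * heat_kernel (2 * t) x" .
  qed
qed

section \<open>The inverse Laplacian of Gaussian derivatives\<close>

definition gauss_const :: "'n::finite itself \<Rightarrow> real" where
  "gauss_const _ = (4 * pi) powr (- (real CARD('n) / 2))"

lemma gauss_const_pos: "gauss_const TYPE('n::finite) > 0"
  by (simp add: gauss_const_def)

lemma heat_kernel_alt:
  fixes x :: "real^'n::finite"
  assumes "s > 0"
  shows "heat_kernel s x = gauss_const TYPE('n) * s powr (- (real CARD('n) / 2)) * exp (- (norm x)\<^sup>2 / (4 * s))"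
  using assms by (simp add: heat_kernel_def gauss_const_def powr_mult)

text \<open>The fundamental solution in the variable q = |x|^2, in which the time integrals are
  differentiated; hence ln q/(4 pi) in the plane and the power 1 - d/2 otherwise.\<close>

definition laplace_radial :: "'n::finite itself \<Rightarrow> real \<Rightarrow> real" where
  "laplace_radial _ q = (if CARD('n) = 2 then ln q / (4 * pi)
     else - (q powr (1 - real CARD('n) / 2)) / ((real CARD('n) - 2) * (real CARD('n) * unit_ball_vol (real CARD('n)))))"

lemma laplace_fundamental_eq_radial:
  fixes x :: "real^'n::finite"
  assumes "x \<noteq> 0"
  shows "laplace_fundamental x = laplace_radial TYPE('n) ((norm x)\<^sup>2)"
proof -
  have "((norm x)\<^sup>2) powr (1 - real CARD('n) / 2) = norm x powr (2 - real CARD('n))"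
    using assms by (simp add: powr_powr flip: powr_numeral)
  then show ?thesis
    using assms by (simp add: laplace_fundamental_def laplace_radial_def Let_def ln_realpow)
qed

text \<open>Both branches have the derivative q^(-d/2) divided by twice the area of the unit sphere.
  The Gamma form is a multiple of \<open>heat_tail\<close> of order d/2 at time 0, ready to cancel
  against the derivative of the time integral of the heat kernel.\<close>

lemma laplace_radial_has_derivative:
  assumes "CARD('n::finite) \<ge> 2" "q > 0"
  shows "(laplace_radial TYPE('n) has_real_derivative
    gauss_const TYPE('n) / 4 * (Gamma (real CARD('n) / 2) * (4 / q) powr (real CARD('n) / 2))) (at q)"
proof -
  define d where "d = real CARD('n)"
  have d: "d \<ge> 2" using assms by (simp add: d_def)
  have "d / 2 \<notin> \<int>\<^sub>\<le>\<^sub>0" using d by (auto elim!: nonpos_Ints_cases)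
  then have G: "Gamma (d / 2 + 1) = d / 2 * Gamma (d / 2)"
    by (intro Gamma_plus1) auto
  have G0: "Gamma (d / 2) > 0" using d by (intro Gamma_real_pos) auto
  have v0: "unit_ball_vol d \<noteq> 0" using unit_ball_vol_pos[of d] d by linarith
  have v: "d * unit_ball_vol d = 2 * pi powr (d / 2) / Gamma (d / 2)"
    using d G0 by (simp add: unit_ball_vol_def G)
  have c: "gauss_const TYPE('n) / 4 * (Gamma (d / 2) * (4 / q) powr (d / 2)) =
      q powr (- d / 2) / (2 * (d * unit_ball_vol d))"
    unfolding v using assms G0
    by (simp add: gauss_const_def d_def[symmetric] powr_mult powr_divide powr_minus field_simps)
  show ?thesis
  proof (cases "CARD('n) = 2")
    case True
    then have "d = 2" by (simp add: d_def)
    have "(laplace_radial TYPE('n) has_real_derivative 1 / (4 * pi * q)) (at q)"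
      unfolding laplace_radial_def using True assms
      by (auto intro!: derivative_eq_intros simp: field_simps)
    moreover have "unit_ball_vol (2::real) = pi"
      using unit_ball_vol_2 by simp
    ultimately have "1 / (4 * pi * q) = q powr (- d / 2) / (2 * (d * unit_ball_vol d))"
      using assms \<open>d = 2\<close> by (simp add: powr_minus field_simps)
    with \<open>(laplace_radial TYPE('n) has_real_derivative 1 / (4 * pi * q)) (at q)\<close>
    show ?thesis unfolding d_def[symmetric] c by (simp only:)
  next
    case False
    with assms have d2: "d > 2" by (simp add: d_def)
    have "((\<lambda>q. - (q powr (1 - d / 2)) / ((d - 2) * (d * unit_ball_vol d))) has_real_derivative
        - ((1 - d / 2) * q powr (1 - d / 2 - 1)) / ((d - 2) * (d * unit_ball_vol d))) (at q)"
      using assms d2 by (auto intro!: derivative_eq_intros simp: v0)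
    moreover have "- ((1 - d / 2) * q powr (1 - d / 2 - 1)) / ((d - 2) * (d * unit_ball_vol d)) =
        q powr (- d / 2) / (2 * (d * unit_ball_vol d))"
    proof -
      have "- ((1 - d / 2) * Q) / ((d - 2) * V) = Q / (2 * V)" for Q V
      proof -
        have "- ((1 - d / 2) * Q) = (d - 2) * (Q / 2)" by (simp add: algebra_simps)
        then have "- ((1 - d / 2) * Q) / ((d - 2) * V) = (d - 2) * (Q / 2) / ((d - 2) * V)" by (simp only:)
        then show ?thesis using d2 by simp
      qed
      then show ?thesis by simp
    qed
    ultimately show ?thesis
      using c False unfolding laplace_radial_def d_def[symmetric] by simp
  qed
qed

text \<open>In the plane the heat kernel is not integrable at large times, so its value at |x| = 1
  is subtracted; the same normalisation serves all d \<ge> 2. The q-derivatives of the integral and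
  of \<open>laplace_radial\<close> cancel, and both sides vanish at q = 1.\<close>

lemma heat_kernel_time_integral:
  assumes "CARD('n::finite) \<ge> 2" "q > 0"
  defines "f \<equiv> \<lambda>q s. indicator {0<..} s * (gauss_const TYPE('n) * s powr (- (real CARD('n) / 2)) *
      (exp (- q / (4 * s)) - exp (- 1 / (4 * s))))"
  shows "integrable lborel (f q)"
    and "(\<integral>s. f q s \<partial>lborel) = laplace_radial TYPE('n) 1 - laplace_radial TYPE('n) q"
proof -
  define b where "b = real CARD('n) / 2"
  define c where "c = gauss_const TYPE('n)"
  have b: "b > 0" using assms by (simp add: b_def)
  have c: "c > 0" unfolding c_def by (rule gauss_const_pos)
  let ?f' = "\<lambda>q s. - c / 4 * (indicator {0<..} s * (s powr (- b - 1) * exp (- q / (4 * s))))"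
  have f: "f q s = indicator {0<..} s * (c * s powr (- b) * (exp (- q / (4 * s)) - exp (- 1 / (4 * s))))" for q s
    by (simp add: f_def b_def c_def)
  have der: "((\<lambda>q. f q s) has_real_derivative ?f' q s) (at q)" for q s
  proof (cases "s > 0")
    case True
    have "((\<lambda>q. c * s powr (- b) * (exp (- q / (4 * s)) - exp (- 1 / (4 * s)))) has_real_derivative
        c * s powr (- b) * (exp (- q / (4 * s)) * (- 1 / (4 * s)))) (at q)"
      using True by (auto intro!: derivative_eq_intros)
    moreover have "c * s powr (- b) * (exp (- q / (4 * s)) * (- 1 / (4 * s))) = ?f' q s"
      using True by (simp add: powr_diff)
    ultimately show ?thesis unfolding f using True by (simp only:) simp
  qed (simp add: f)
  have i': "integrable lborel (\<lambda>s. indicator {0<..} s * (s powr (- b - 1) * exp (- q / (4 * s))))" if "q > 0" for q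
    using set_integrable_heat_tail_0[OF b that] by (simp add: set_integrable_def)
  have bound: "\<bar>?f' q s\<bar> \<le> c / 4 * (indicator {0<..} s * (s powr (- b - 1) * exp (- a / (4 * s))))"
    if "a \<le> q" for q s a
  proof (cases "s > 0")
    case True
    then have "exp (- q / (4 * s)) \<le> exp (- a / (4 * s))"
      using that by (simp add: divide_right_mono)
    then show ?thesis using True c by (simp add: abs_mult mult_left_mono)
  qed simp
  have int: "integrable lborel (f q)" if q: "q > 0" for q
  proof (rule Bochner_Integration.integrable_bound)
    \<comment> \<open>The integrand vanishes at q = 1, so the mean value inequality between q and 1
      bounds it. The bound on its q-derivative is largest at the smaller end a.\<close>
    define a where "a = min q 1"
    have a: "a > 0" using q by (simp add: a_def)
    show "integrable lborel (\<lambda>s. \<bar>q - 1\<bar> * (c / 4 * (indicator {0<..} s * (s powr (- b - 1) * exp (- a / (4 * s))))))"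
      by (intro integrable_mult_right i' a)
    show "f q \<in> borel_measurable lborel" unfolding f by measurable
    show "AE s in lborel. norm (f q s) \<le> norm (\<bar>q - 1\<bar> * (c / 4 * (indicator {0<..} s * (s powr (- b - 1) * exp (- a / (4 * s))))))"
    proof (rule AE_I2)
      fix s
      let ?B = "c / 4 * (indicator {0<..} s * (s powr (- b - 1) * exp (- a / (4 * s))))"
      have "norm (f q s - f 1 s) \<le> ?B * norm (q - 1)"
        by (rule field_differentiable_bound[where S="{a..}" and f' = "\<lambda>q. ?f' q s"])
          (use der bound in \<open>auto simp: a_def intro: has_field_derivative_at_within\<close>)
      moreover have "f 1 s = 0" by (simp add: f)
      moreover have "?B \<ge> 0" using c by simp
      ultimately show "norm (f q s) \<le> norm (\<bar>q - 1\<bar> * ?B)"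
        using c by (simp add: abs_mult mult.commute)
    qed
  qed
  show "integrable lborel (f q)" using int assms by blast
  have D: "((\<lambda>q. \<integral>s. f q s \<partial>lborel) has_real_derivative (\<integral>s. ?f' q s \<partial>lborel)) (at q)" if q: "q > 0" for q
  proof (rule has_real_derivative_integral[where a = "q / 2" and c = "2 * q" and
        w = "\<lambda>s. c / 4 * (indicator {0<..} s * (s powr (- b - 1) * exp (- (q/2) / (4 * s))))"])
    show "integrable lborel (\<lambda>s. c / 4 * (indicator {0<..} s * (s powr (- b - 1) * exp (- (q / 2) / (4 * s)))))"
      using q by (intro integrable_mult_right i') auto
    fix q' s assume "q' \<in> {q / 2<..<2 * q}"
    then show "\<bar>?f' q' s\<bar> \<le> c / 4 * (indicator {0<..} s * (s powr (- b - 1) * exp (- (q/2) / (4 * s))))"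
      by (intro bound) auto
    show "((\<lambda>q. f q s) has_real_derivative ?f' q' s) (at q')" by (rule der)
  qed (use int q in auto)
  have D1: "((\<lambda>q. \<integral>s. f q s \<partial>lborel) has_real_derivative - (c / 4 * (Gamma b * (4 / q) powr b))) (at q)" if "q > 0" for q
  proof -
    have "(\<integral>s. indicator {0<..} s * (s powr (- b - 1) * exp (- q / (4 * s))) \<partial>lborel) = Gamma b * (4 / q) powr b"
      using heat_tail_0[OF b that] by (simp add: heat_tail_def set_lebesgue_integral_def)
    then have "(\<integral>s. ?f' q s \<partial>lborel) = - (c / 4 * (Gamma b * (4 / q) powr b))" by simp
    with D[OF that] show ?thesis by (simp only:)
  qed
  have D2: "(laplace_radial TYPE('n) has_real_derivative c / 4 * (Gamma b * (4 / q) powr b)) (at q)" if "q > 0" for q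
    unfolding b_def c_def by (rule laplace_radial_has_derivative[OF assms(1) that])
  have *: "((\<lambda>q. (\<integral>s. f q s \<partial>lborel) + laplace_radial TYPE('n) q) has_real_derivative 0) (at q within {0<..})"
    if "q > 0" for q
    using DERIV_add[OF D1[OF that] D2[OF that]]
    unfolding add.left_inverse by (rule has_field_derivative_at_within)
  have "(\<integral>s. f q s \<partial>lborel) + laplace_radial TYPE('n) q = (\<integral>s. f 1 s \<partial>lborel) + laplace_radial TYPE('n) 1"
  proof -
    have "\<exists>C. \<forall>q\<in>{0<..}. (\<integral>s. f q s \<partial>lborel) + laplace_radial TYPE('n) q = C"
    proof (rule has_field_derivative_zero_constant)
      fix q :: real assume "q \<in> {0<..}"
      then show "((\<lambda>q. (\<integral>s. f q s \<partial>lborel) + laplace_radial TYPE('n) q) has_real_derivative 0) (at q within {0<..})"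
        by (intro *) simp
    qed simp
    then obtain C where C: "\<forall>q\<in>{0<..}. (\<integral>s. f q s \<partial>lborel) + laplace_radial TYPE('n) q = C" by (elim exE)
    have "q \<in> {0<..}" "1 \<in> {0::real<..}" using assms(2) by simp_all
    then show ?thesis using bspec[OF C, of q] bspec[OF C, of 1] by (simp only:)
  qed
  then show "(\<integral>s. f q s \<partial>lborel) = laplace_radial TYPE('n) 1 - laplace_radial TYPE('n) q"
    by (simp add: f)
qed

text \<open>The quadratic factor of the Hessian is swallowed by raising the weight by two. The case
  N = 0 provides a sup bound, and N = 2 pays for a factor |x - y|^2.\<close>

lemma hess_heat_weighted:
  fixes h k :: "'n::finite"
  assumes "t > 0" "N \<ge> 0"
  obtains C where "C > 0" "\<And>y. (1 + norm y) powr N * \<bar>hess_heat h k t y\<bar> \<le> C * heat_kernel (2 * t) y"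
proof -
  have N2: "N + 2 \<ge> 0" using assms by simp
  obtain C where C: "C > 0" "\<And>s x. \<lbrakk>0 < s; s \<le> t\<rbrakk> \<Longrightarrow> (1 + norm x) powr (N + 2) * heat_kernel s (x::real^'n) \<le> C * heat_kernel (2 * s) x"
    by (rule weighted_heat_kernel_bound[OF N2 assms(1), where 'n='n]) blast
  define K where "K = 1 / (4 * t\<^sup>2) + 1 / (2 * t)"
  have K: "K > 0" using assms by (simp add: K_def add_pos_pos)
  show thesis
  proof (rule that[of "K * C"])
    show "K * C > 0" using K C by simp
    fix y :: "real^'n"
    have "\<bar>y $ h * y $ k\<bar> \<le> norm y * norm y"
      unfolding abs_mult by (intro mult_mono component_le_norm_cart) auto
    also have "\<dots> \<le> (1 + norm y)\<^sup>2" by (simp add: power2_eq_square mult_mono)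
    finally have 1: "\<bar>y $ h * y $ k\<bar> \<le> (1 + norm y)\<^sup>2" .
    have 2: "1 \<le> (1 + norm y)\<^sup>2" by (simp add: power2_eq_square algebra_simps)
    have "\<bar>y $ h * y $ k / (4 * t\<^sup>2) - of_bool (h = k) / (2 * t)\<bar> \<le>
        \<bar>y $ h * y $ k\<bar> / (4 * t\<^sup>2) + 1 / (2 * t)"
      using assms by (intro order_trans[OF abs_triangle_ineq4] add_mono) (auto simp: abs_mult)
    also have "\<dots> \<le> (1 + norm y)\<^sup>2 / (4 * t\<^sup>2) + (1 + norm y)\<^sup>2 / (2 * t)"
      using assms 1 2 by (intro add_mono divide_right_mono) auto
    also have "\<dots> = K * (1 + norm y)\<^sup>2"
      by (simp add: K_def distrib_right)
    also have "(1 + norm y)\<^sup>2 = (1 + norm y) powr 2"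
      by (simp add: add_pos_nonneg)
    finally have "\<bar>y $ h * y $ k / (4 * t\<^sup>2) - of_bool (h = k) / (2 * t)\<bar> \<le> K * (1 + norm y) powr 2" .
    then have "\<bar>hess_heat h k t y\<bar> \<le> K * (1 + norm y) powr 2 * heat_kernel t y"
      unfolding hess_heat_def abs_mult abs_of_nonneg[OF heat_kernel_nonneg]
      by (intro mult_right_mono heat_kernel_nonneg)
    then have "(1 + norm y) powr N * \<bar>hess_heat h k t y\<bar> \<le> (1 + norm y) powr N * (K * (1 + norm y) powr 2 * heat_kernel t y)"
      by (intro mult_left_mono) auto
    also have "\<dots> = K * ((1 + norm y) powr (N + 2) * heat_kernel t y)"
      by (simp only: powr_add mult_ac)
    also have "\<dots> \<le> K * (C * heat_kernel (2 * t) y)"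
      using C(2)[of t y] K assms by (intro mult_left_mono) auto
    finally show "(1 + norm y) powr N * \<bar>hess_heat h k t y\<bar> \<le> K * C * heat_kernel (2 * t) y" by simp
  qed
qed

text \<open>A form of Fubini's criterion in which the inner L^1 norms are only majorised, not
  computed.\<close>

lemma (in pair_sigma_finite) integrable_pair_bound:
  fixes f :: "_ \<Rightarrow> _::{banach, second_countable_topology}"
  assumes f [measurable]: "f \<in> borel_measurable (M1 \<Otimes>\<^sub>M M2)"
    and "\<And>x. x \<in> space M1 \<Longrightarrow> integrable M2 (\<lambda>y. f (x, y))"
    and "\<And>x. x \<in> space M1 \<Longrightarrow> (\<integral>y. norm (f (x, y)) \<partial>M2) \<le> B x"
    and B: "integrable M1 B"
  shows "integrable (M1 \<Otimes>\<^sub>M M2) f"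
proof (rule Fubini_integrable[OF f])
  show "integrable M1 (\<lambda>x. \<integral>y. norm (f (x, y)) \<partial>M2)"
  proof (rule Bochner_Integration.integrable_bound[OF B])
    show "AE x in M1. norm (\<integral>y. norm (f (x, y)) \<partial>M2) \<le> norm (B x)"
    proof (rule AE_I2)
      fix x assume "x \<in> space M1"
      then have "(\<integral>y. norm (f (x, y)) \<partial>M2) \<le> B x" by (rule assms(3))
      moreover have "0 \<le> (\<integral>y. norm (f (x, y)) \<partial>M2)" by simp
      ultimately show "norm (\<integral>y. norm (f (x, y)) \<partial>M2) \<le> norm (B x)"
        unfolding real_norm_def by linarith
    qed
  qed measurable
qed (use assms in auto)

lemma laplace_fundamental_measurable [measurable]:
  "laplace_fundamental \<in> borel_measurable (borel :: (real^'n::finite) measure)"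
  unfolding laplace_fundamental_def Let_def by measurable

lemma heat_kernel_le: "heat_kernel t x \<le> (4 * pi * t) powr (- (real CARD('n) / 2))" if "t > 0" for x :: "real^'n::finite"
  unfolding heat_kernel_def using that by (intro mult_left_le) auto

text \<open>Two orders of integration for the normalised heat kernel times the Hessian. The point is
  absolute integrability: for small times the heat kernel has unit mass, and for large times the
  normalisation gains a factor 1/s, which gives s^(-2) already in the plane.\<close>

lemma inv_laplace_hess_heat:
  fixes x :: "real^'n::finite"
  assumes n: "CARD('n) \<ge> 2" and t: "t > 0"
  shows "inv_laplace (hess_heat h k t) x = - (LINT s:{t<..}|lborel. hess_heat h k s x)"
proof -
  define b where "b = real CARD('n) / 2"
  define c where "c = gauss_const TYPE('n)"
  have c: "c > 0" unfolding c_def by (rule gauss_const_pos)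
  have b: "b \<ge> 1" using n by (simp add: b_def)
  let ?g = "hess_heat h k t"
  let ?E = "laplace_fundamental :: real^'n \<Rightarrow> real"
  define E1 where "E1 = laplace_radial TYPE('n) 1"
  \<comment> \<open>The second exponential is the normalisation at |x| = 1; integrated against the
    mean-zero Hessian it disappears.\<close>
  define f where "f = (\<lambda>(s, y). indicator {0<..} s *
      (c * s powr (- b) * (exp (- (norm (x - y))\<^sup>2 / (4 * s)) - exp (- 1 / (4 * s)))) * ?g y)"
  have fm [measurable]: "f \<in> borel_measurable (lborel \<Otimes>\<^sub>M lborel)"
    unfolding f_def by measurable
  have fs: "f (s, y) = heat_kernel s (x - y) * ?g y - c * s powr (- b) * exp (- 1 / (4 * s)) * ?g y" if "s > 0" for s y
    using that by (simp add: f_def heat_kernel_alt b_def c_def algebra_simps)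
  note conv = heat_kernel_hess_heat_convolution[OF _ t, of _ x h k]
  have g: "integrable lborel ?g" "(\<integral>y. ?g y \<partial>lborel) = 0" using hess_heat_integral[OF t] by auto
  have fi: "integrable lborel (\<lambda>y. f (s, y))" for s
  proof (cases "s > 0")
    case True
    show ?thesis unfolding fs[OF True]
      by (intro Bochner_Integration.integrable_diff conv(1) integrable_mult_right g True)
  qed (simp add: f_def)
  have fv: "(\<integral>y. f (s, y) \<partial>lborel) = indicator {0<..} s * hess_heat h k (s + t) x" for s
  proof (cases "s > 0")
    case True
    show ?thesis unfolding fs[OF True]
      using conv[OF True] g True by (subst Bochner_Integration.integral_diff) auto
  qed (simp add: f_def)
  obtain C0 where C0: "C0 > 0" "\<And>y. (1 + norm y) powr 0 * \<bar>?g y\<bar> \<le> C0 * heat_kernel (2 * t) y"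
    using hess_heat_weighted[OF t, of 0] by auto
  obtain C2 where C2: "C2 > 0" "\<And>y. (1 + norm y) powr 2 * \<bar>?g y\<bar> \<le> C2 * heat_kernel (2 * t) y"
    using hess_heat_weighted[OF t, of 2] by auto
  define S where "S = C0 * (4 * pi * (2 * t)) powr (- (real CARD('n) / 2))"
  have S: "\<bar>?g y\<bar> \<le> S" for y
  proof -
    have "1 + norm y \<noteq> 0" by (smt (verit) norm_ge_zero)
    then have "\<bar>?g y\<bar> \<le> C0 * heat_kernel (2 * t) y" using C0(2)[of y] by simp
    also have "\<dots> \<le> S"
      unfolding S_def using C0(1) t by (intro mult_left_mono heat_kernel_le) auto
    finally show ?thesis .
  qed
  define G where "G = (\<integral>y. \<bar>?g y\<bar> \<partial>lborel)"
  have G0: "G \<ge> 0" unfolding G_def by simp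
  have g2: "integrable lborel (\<lambda>y. (1 + norm y) powr 2 * \<bar>?g y\<bar>)"
  proof (rule Bochner_Integration.integrable_bound)
    show "integrable lborel (\<lambda>y::real^'n. C2 * heat_kernel (2 * t) y)"
      using t by (intro integrable_mult_right integrable_heat_kernel) auto
    show "AE y in lborel. norm ((1 + norm y) powr 2 * \<bar>?g y\<bar>) \<le> norm (C2 * heat_kernel (2 * t) y)"
      using C2 by (intro AE_I2) (simp add: abs_mult heat_kernel_nonneg)
  qed measurable
  define L where "L = (\<integral>y. (1 + norm y) powr 2 * \<bar>?g y\<bar> \<partial>lborel)"
  have L0: "L \<ge> 0" unfolding L_def by simp
  define K where "K = c * 4 powr b * b powr b"
  have K: "c * s powr (- b) * exp (- 1 / (4 * s)) \<le> K" if "s > 0" for s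
  proof -
    have "(1 / (4 * s)) powr b * exp (- (1 / (4 * s))) \<le> b powr b"
      using that b by (intro powr_exp_minus_le) auto
    moreover have "s powr (- b) = 4 powr b * (1 / (4 * s)) powr b"
      using that by (simp add: powr_divide powr_mult powr_minus field_simps)
    ultimately show ?thesis
      using c by (simp add: K_def mult.assoc)
  qed
  \<comment> \<open>Majorant of the inner L^1 norm: constant up to time 1 and of order s^(-2)
    afterwards, from s^(-b) \<le> s^(-1) and the factor 1/s in the difference of the
    exponentials.\<close>
  define B where "B s = (indicator {0<..1} s * (S + K * G) + indicator {1<..} s * (s powr (- 1 - 1) * (c / 4 * (1 + norm x)\<^sup>2 * L)))" for s :: real
  have fint: "integrable (lborel \<Otimes>\<^sub>M lborel) f"
  proof (rule lborel_pair.integrable_pair_bound[OF fm, where B = B])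
    show "integrable lborel B"
    proof -
      have "integrable lborel (\<lambda>s::real. indicator {1<..} s * s powr (- 1 - 1) * (c / 4 * (1 + norm x)\<^sup>2 * L))"
        using powr_tail_integral(1)[of 1 1] by (intro integrable_mult_left) (simp add: set_integrable_def)
      moreover have "integrable lborel (\<lambda>s::real. indicator {0<..1} s * (S + K * G))"
        by (intro integrable_mult_left) auto
      ultimately show ?thesis unfolding B_def
        by (intro Bochner_Integration.integrable_add) (simp_all add: mult.assoc)
    qed
    fix s :: real
    show "(\<integral>y. norm (f (s, y)) \<partial>lborel) \<le> B s"
    proof (cases "s > 0")
      case False
      then show ?thesis by (simp add: f_def B_def indicator_def)
    next
      case s: True
      show ?thesis
      proof (cases "s \<le> 1")
        case True
        have "(\<integral>y. norm (f (s, y)) \<partial>lborel) \<le> (\<integral>y. heat_kernel s (x - y) * S + K * \<bar>?g y\<bar> \<partial>lborel)"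
        proof (rule integral_mono)
          fix y :: "real^'n"
          have "norm (f (s, y)) \<le> \<bar>heat_kernel s (x - y) * ?g y\<bar> + \<bar>c * s powr (- b) * exp (- 1 / (4 * s)) * ?g y\<bar>"
            unfolding fs[OF s] by simp
          also have "\<dots> = heat_kernel s (x - y) * \<bar>?g y\<bar> + c * s powr (- b) * exp (- 1 / (4 * s)) * \<bar>?g y\<bar>"
            using c by (simp add: abs_mult heat_kernel_nonneg)
          also have "\<dots> \<le> heat_kernel s (x - y) * S + K * \<bar>?g y\<bar>"
            using K[OF s] S by (intro add_mono mult_left_mono mult_right_mono heat_kernel_nonneg) auto
          finally show "norm (f (s, y)) \<le> heat_kernel s (x - y) * S + K * \<bar>?g y\<bar>" .
        next
          show "integrable lborel (\<lambda>y. heat_kernel s (x - y) * S + K * \<bar>?g y\<bar>)"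
            using integral_heat_kernel_diff(1)[OF s] g(1)
            by (intro Bochner_Integration.integrable_add integrable_mult_left integrable_mult_right integrable_abs)
        qed (use fi in auto)
        also have "\<dots> = S + K * G"
          using integral_heat_kernel_diff[OF s, of x] g by (simp add: G_def)
        finally show ?thesis using True s by (simp add: B_def)
      next
        case False
        have "(\<integral>y. norm (f (s, y)) \<partial>lborel) \<le> (\<integral>y. s powr (- 1 - 1) * (c / 4 * (1 + norm x)\<^sup>2) * ((1 + norm y) powr 2 * \<bar>?g y\<bar>) \<partial>lborel)"
        proof (rule integral_mono)
          fix y
          let ?q = "(norm (x - y))\<^sup>2"
          have e: "\<bar>exp (- u) - exp (- v)\<bar> \<le> \<bar>u - v\<bar>" if "u \<ge> 0" "v \<ge> 0" for u v :: real
          proof -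
            have "norm (exp (- u) - exp (- v)) \<le> 1 * norm (u - v)"
              by (rule field_differentiable_bound[where S="{0..}" and f' = "\<lambda>u. - exp (- u)"])
                (use that in \<open>auto intro!: derivative_eq_intros\<close>)
            then show ?thesis by simp
          qed
          have "\<bar>exp (- ?q / (4 * s)) - exp (- 1 / (4 * s))\<bar> \<le> \<bar>?q / (4 * s) - 1 / (4 * s)\<bar>"
            using e[of "?q / (4 * s)" "1 / (4 * s)"] s by simp
          also have "\<dots> = \<bar>?q - 1\<bar> / (4 * s)" using s by (simp flip: diff_divide_distrib)
          also have "\<dots> \<le> (?q + 1) / (4 * s)"
          proof (rule divide_right_mono)
            have "0 \<le> ?q" by simp
            then show "\<bar>?q - 1\<bar> \<le> ?q + 1" by linarith
          qed (use s in simp)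
          also have "?q + 1 \<le> (1 + norm x)\<^sup>2 * (1 + norm y)\<^sup>2"
          proof -
            have "?q + 1 \<le> (norm x + norm y)\<^sup>2 + 1"
              using norm_triangle_ineq4[of x y] by (simp add: power_mono)
            also have "\<dots> \<le> (1 + norm x + norm y)\<^sup>2"
              by (simp add: power2_eq_square algebra_simps)
            also have "\<dots> \<le> ((1 + norm x) * (1 + norm y))\<^sup>2"
              by (intro power_mono) (auto simp: algebra_simps)
            finally show ?thesis by (simp add: power_mult_distrib)
          qed
          finally have e1: "\<bar>exp (- ?q / (4 * s)) - exp (- 1 / (4 * s))\<bar> \<le> (1 + norm x)\<^sup>2 * (1 + norm y)\<^sup>2 / (4 * s)"
            using s by (simp add: divide_right_mono)
          have e2: "s powr (- b) \<le> s powr (- 1)"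
            using False b by (intro powr_mono) auto
          have "norm (f (s, y)) = c * s powr (- b) * \<bar>exp (- ?q / (4 * s)) - exp (- 1 / (4 * s))\<bar> * \<bar>?g y\<bar>"
            using s c by (simp add: f_def abs_mult)
          also have "\<dots> \<le> c * s powr (- 1) * ((1 + norm x)\<^sup>2 * (1 + norm y)\<^sup>2 / (4 * s)) * \<bar>?g y\<bar>"
            using e1 e2 c s by (intro mult_mono) auto
          also have "\<dots> = s powr (- 1 - 1) * (c / 4 * (1 + norm x)\<^sup>2) * ((1 + norm y) powr 2 * \<bar>?g y\<bar>)"
          proof -
            have "s powr (- 1 - 1) = 1 / (s * s)" using s by (simp add: powr_minus_divide power2_eq_square)
            then show ?thesis using s by (simp add: powr_minus_divide add_pos_nonneg)
          qed
          finally show "norm (f (s, y)) \<le> s powr (- 1 - 1) * (c / 4 * (1 + norm x)\<^sup>2) * ((1 + norm y) powr 2 * \<bar>?g y\<bar>)" .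
        qed (use fi g2 in auto)
        also have "\<dots> = s powr (- 1 - 1) * (c / 4 * (1 + norm x)\<^sup>2 * L)"
          using g2 by (simp add: L_def)
        finally show ?thesis using False by (simp add: B_def)
      qed
    qed
  qed (rule fi)
  have fs': "AE y in lborel. (\<integral>s. f (s, y) \<partial>lborel) = E1 * ?g y - ?E (x - y) * ?g y"
  proof -
    have "AE y in lborel. y \<noteq> x" by (rule AE_lborel_singleton)
    then show ?thesis
    proof eventually_elim
      case (elim y)
      then have q: "(norm (x - y))\<^sup>2 > 0" by simp
      have "(\<integral>s. f (s, y) \<partial>lborel) = (E1 - laplace_radial TYPE('n) ((norm (x - y))\<^sup>2)) * ?g y"
        using heat_kernel_time_integral(2)[OF n q]
        by (simp add: f_def E1_def b_def c_def)
      then show ?case using elim by (simp add: laplace_fundamental_eq_radial left_diff_distrib)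
    qed
  qed
  have fm2: "(\<lambda>y. \<integral>s. f (s, y) \<partial>lborel) \<in> borel_measurable lborel"
    by measurable
  \<comment> \<open>Integrability of the convolution with the singular fundamental solution is read
    off from Fubini, in place of an estimate of the singularity.\<close>
  have "integrable lborel (\<lambda>y. \<integral>s. f (s, y) \<partial>lborel)"
    using lborel_pair.integrable_snd[of "\<lambda>s y. f (s, y)"] fint by simp
  then have "integrable lborel (\<lambda>y. E1 * ?g y - ?E (x - y) * ?g y)"
    by (rule integrable_cong_AE_imp) (use fs' in \<open>auto simp: eq_commute\<close>)
  from Bochner_Integration.integrable_diff[OF integrable_mult_right[OF g(1), of E1] this]
  have Eg: "integrable lborel (\<lambda>y. ?E (x - y) * ?g y)" by simp
  have "(\<integral>y. (\<integral>s. f (s, y) \<partial>lborel) \<partial>lborel) = (\<integral>y. E1 * ?g y - ?E (x - y) * ?g y \<partial>lborel)"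
    by (rule integral_cong_AE[OF _ _ fs']) (use fm2 in auto)
  also have "\<dots> = - (\<integral>y. ?E (x - y) * ?g y \<partial>lborel)"
    using g Eg by simp
  finally have "(\<integral>y. ?E (x - y) * ?g y \<partial>lborel) = - (\<integral>y. (\<integral>s. f (s, y) \<partial>lborel) \<partial>lborel)" by simp
  also have "(\<integral>y. (\<integral>s. f (s, y) \<partial>lborel) \<partial>lborel) = (\<integral>s. (\<integral>y. f (s, y) \<partial>lborel) \<partial>lborel)"
    using lborel_pair.Fubini_integral[of "\<lambda>s y. f (s, y)"] fint by simp
  also have "\<dots> = (\<integral>s. indicator {t<..} (t + 1 * s) * hess_heat h k (t + 1 * s) x \<partial>lborel)"
    unfolding fv by (intro Bochner_Integration.integral_cong) (auto simp: indicator_def add.commute)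
  also have "\<dots> = (\<integral>s. indicator {t<..} s * hess_heat h k s x \<partial>lborel)"
    by (subst lborel_integral_real_affine[where c=1 and t=t]) simp_all
  finally show ?thesis
    unfolding inv_laplace_def set_lebesgue_integral_def
    by (subst integral_completion) auto
qed

text \<open>The factors 1/(4 s^2) and 1/(2s) of the Hessian shift the power of s, so the two terms
  land on the orders d/2 + 1 and d/2 of \<open>heat_tail\<close>.\<close>

lemma inv_laplace_hess_heat_closed_form:
  fixes x :: "real^'n::finite"
  assumes n: "CARD('n) \<ge> 2" and t: "t > 0"
  shows "inv_laplace (hess_heat h k t) x = gauss_const TYPE('n) *
     (of_bool (h = k) / 2 * heat_tail (real CARD('n) / 2) t ((norm x)\<^sup>2)
       - x $ h * x $ k / 4 * heat_tail (real CARD('n) / 2 + 1) t ((norm x)\<^sup>2))"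
proof -
  define b where "b = real CARD('n) / 2"
  define q where "q = (norm x)\<^sup>2"
  have b: "b > 0" using n by (simp add: b_def)
  let ?c = "gauss_const TYPE('n)"
  have "(LINT s:{t<..}|lborel. hess_heat h k s x) =
    (LINT s:{t<..}|lborel. ?c * (x $ h * x $ k / 4) * (s powr (- (b + 1) - 1) * exp (- q / (4 * s)))
       - ?c * (of_bool (h = k) / 2) * (s powr (- b - 1) * exp (- q / (4 * s))))"
  proof (rule set_lebesgue_integral_cong)
    show "\<forall>s. s \<in> {t<..} \<longrightarrow> hess_heat h k s x = ?c * (x $ h * x $ k / 4) * (s powr (- (b + 1) - 1) * exp (- q / (4 * s)))
       - ?c * (of_bool (h = k) / 2) * (s powr (- b - 1) * exp (- q / (4 * s)))"
    proof (intro allI impI)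
      fix s assume "s \<in> {t<..}"
      then have s: "s > 0" using t by simp
      have 1: "s powr (- (b + 1) - 1) = s powr (- b) / s\<^sup>2" "s powr (- b - 1) = s powr (- b) / s"
        using s by (simp_all add: powr_diff powr_minus powr_add field_simps power2_eq_square)
      show "hess_heat h k s x = ?c * (x $ h * x $ k / 4) * (s powr (- (b + 1) - 1) * exp (- q / (4 * s)))
       - ?c * (of_bool (h = k) / 2) * (s powr (- b - 1) * exp (- q / (4 * s)))"
        unfolding hess_heat_def heat_kernel_alt[OF s] 1 b_def[symmetric] q_def[symmetric]
        by (simp add: left_diff_distrib right_diff_distrib mult_ac)
    qed
  qed simp
  also have "\<dots> = ?c * (x $ h * x $ k / 4) * heat_tail (b + 1) t q - ?c * (of_bool (h = k) / 2) * heat_tail b t q"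
    using set_integrable_heat_tail[OF b t] set_integrable_heat_tail[of "b+1" t] b t
    by (subst set_integral_diff) (auto simp: heat_tail_def)
  finally show ?thesis
    unfolding inv_laplace_hess_heat[OF assms] b_def q_def by (simp add: algebra_simps)
qed

section \<open>The Oseen kernel and its profile\<close>

lemma pd_eq_derivative:
  assumes "(f has_derivative D) (at x)"
  shows "pd i f x = D (axis i 1)"
  unfolding pd_def using frechet_derivative_at[OF assms] by simp

lemma heat_kernel_has_derivative:
  fixes x :: "real^'n::finite"
  shows "(heat_kernel t has_derivative (\<lambda>v. - (x \<bullet> v) / (2 * t) * heat_kernel t x)) (at x)"
proof (cases "t = 0")
  case True
  \<comment> \<open>The prefactor is a power of 0, which is 0, and the claimed derivative vanishes
    with it.\<close>
  then have "heat_kernel t = (\<lambda>_::real^'n. 0)" by (auto simp: heat_kernel_def)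
  then show ?thesis by (simp add: True)
next
  case False
  have "((\<lambda>y. - (y \<bullet> y) / (4 * t)) has_derivative (\<lambda>v. - (x \<bullet> v) / (2 * t))) (at x)"
    using False by (auto intro!: derivative_eq_intros simp: fun_eq_iff field_simps inner_commute)
  from has_derivative_exp[OF this]
  have "((\<lambda>y. exp (- (y \<bullet> y) / (4 * t))) has_derivative (\<lambda>v. - (x \<bullet> v) / (2 * t) * exp (- (x \<bullet> x) / (4 * t)))) (at x)"
    by (simp add: mult.commute)
  from has_derivative_mult_right[OF this, of "(4 * pi * t) powr (- (real CARD('n) / 2))"]
  show ?thesis
    unfolding heat_kernel_def[abs_def] power2_norm_eq_inner by (simp add: mult_ac)
qed

lemma pd_heat_kernel: "pd h (heat_kernel t) = (\<lambda>x. - (x $ h) / (2 * t) * heat_kernel t x)"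
  by (rule ext) (simp add: pd_eq_derivative[OF heat_kernel_has_derivative] inner_axis)

lemma pd_pd_heat_kernel:
  fixes h k :: "'n::finite"
  assumes "t > 0"
  shows "pd k (pd h (heat_kernel t)) = hess_heat h k t"
proof
  fix x :: "real^'n"
  have "((\<lambda>x. x $ h) has_derivative (\<lambda>v. v $ h)) (at x)"
    by (rule bounded_linear_imp_has_derivative) (rule bounded_linear_vec_nth)
  from has_derivative_mult[OF this heat_kernel_has_derivative, of t]
  have "((\<lambda>x. x $ h * heat_kernel t x) has_derivative
      (\<lambda>v. x $ h * (- (x \<bullet> v) / (2 * t) * heat_kernel t x) + v $ h * heat_kernel t x)) (at x)" .
  from has_derivative_mult_right[OF this, of "- 1 / (2 * t)"]
  have D: "((\<lambda>x. - (x $ h) / (2 * t) * heat_kernel t x) has_derivative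
      (\<lambda>v. - 1 / (2 * t) * (x $ h * (- (x \<bullet> v) / (2 * t) * heat_kernel t x) + v $ h * heat_kernel t x))) (at x)"
    by simp
  have "x \<bullet> axis k 1 = x $ k" by (simp add: inner_axis)
  moreover have "axis k 1 $ h = (of_bool (h = k) :: real)" by (simp add: axis_def)
  ultimately show "pd k (pd h (heat_kernel t)) x = hess_heat h k t x"
    unfolding pd_heat_kernel pd_eq_derivative[OF D] hess_heat_def
    using assms by (simp add: power2_eq_square field_simps)
qed

lemma pd_zero: "pd i (\<lambda>_. 0) x = 0"
  by (simp add: pd_def)

lemma divergence_pd_heat_kernel_axis:
  fixes h k :: "'n::finite"
  assumes "t > 0"
  shows "divergence (\<lambda>x. pd h (heat_kernel t) x *\<^sub>R axis k 1) = hess_heat h k t"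
proof
  fix x :: "real^'n"
  have "pd i (\<lambda>y. (pd h (heat_kernel t) y *\<^sub>R axis k 1 :: real^'n) $ i) x =
      (if i = k then hess_heat h k t x else 0)" for i
  proof -
    have "(\<lambda>y. (pd h (heat_kernel t) y *\<^sub>R axis k 1 :: real^'n) $ i) = (if i = k then pd h (heat_kernel t) else (\<lambda>_. 0))"
      by (auto simp: axis_def)
    then show ?thesis
      using fun_cong[OF pd_pd_heat_kernel[OF assms, of k h], of x] by (simp add: pd_zero)
  qed
  then show "divergence (\<lambda>x. pd h (heat_kernel t) x *\<^sub>R axis k 1) x = hess_heat h k t x"
    by (simp add: divergence_def)
qed

lemma heat_tail_norm_has_derivative:
  fixes x :: "'a::real_inner"
  assumes "b > 0" "t > 0"
  shows "((\<lambda>x. heat_tail b t ((norm x)\<^sup>2)) has_derivative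
    (\<lambda>v. 2 * (x \<bullet> v) * (- heat_tail (b + 1) t ((norm x)\<^sup>2) / 4))) (at x)"
proof -
  have "((\<lambda>x. x \<bullet> x) has_derivative (\<lambda>v. 2 * (x \<bullet> v))) (at x)"
    by (auto intro!: derivative_eq_intros simp: inner_commute)
  from DERIV_compose_FDERIV[OF has_real_derivative_heat_tail[OF assms] this]
  show ?thesis by (simp add: power2_norm_eq_inner)
qed

text \<open>The linear part of the third derivative: in directions j, h, k the heat kernel at time s
  is multiplied by \<open>oseen_sym j h k x / (4 * s^2)\<close> minus x_j x_h x_k/(8 s^3).\<close>

definition oseen_sym :: "'n \<Rightarrow> 'n \<Rightarrow> 'n \<Rightarrow> real^'n::finite \<Rightarrow> real" where
  "oseen_sym j h k x = of_bool (j = h) * x $ k + of_bool (j = k) * x $ h + of_bool (h = k) * x $ j"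

text \<open>The identity part of the projector contributes the first derivative of the heat kernel.
  In the other part the factors s^(-2) and s^(-3) of the third derivative raise the order of
  \<open>heat_tail\<close> to d/2 + 1 and d/2 + 2.\<close>

lemma oseen_kernel_nth:
  fixes x :: "real^'n::finite"
  assumes n: "CARD('n) \<ge> 2" and t: "t > 0"
  shows "oseen_kernel t h k x $ j =
    - of_bool (j = k) * (x $ h / (2 * t)) * heat_kernel t x
    + gauss_const TYPE('n) * (oseen_sym j h k x / 4 * heat_tail (real CARD('n) / 2 + 1) t ((norm x)\<^sup>2)
       - x $ j * x $ h * x $ k / 8 * heat_tail (real CARD('n) / 2 + 2) t ((norm x)\<^sup>2))"
proof -
  define b where "b = real CARD('n) / 2"
  define c where "c = gauss_const TYPE('n)"
  have b: "b > 0" "b + 1 > 0" using n by (simp_all add: b_def)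
  have L: "((\<lambda>x. x $ l) has_derivative (\<lambda>v. v $ l)) (at x)" for l
    by (rule bounded_linear_imp_has_derivative) (rule bounded_linear_vec_nth)
  note D1 = heat_tail_norm_has_derivative[OF b(1) t, of x]
  note D2 = heat_tail_norm_has_derivative[OF b(2) t, of x]
  have D: "(inv_laplace (hess_heat h k t) has_derivative
     (\<lambda>v. c * (of_bool (h = k) / 2 * (2 * (x \<bullet> v) * (- heat_tail (b + 1) t ((norm x)\<^sup>2) / 4)) -
        1 / 4 * (x $ h * x $ k * (2 * (x \<bullet> v) * (- heat_tail (b + 1 + 1) t ((norm x)\<^sup>2) / 4)) +
          (x $ h * v $ k + v $ h * x $ k) * heat_tail (b + 1) t ((norm x)\<^sup>2))))) (at x)"
  proof -
    have eq: "inv_laplace (hess_heat h k t) = (\<lambda>x. c * (of_bool (h = k) / 2 * heat_tail b t ((norm x)\<^sup>2)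
       - 1 / 4 * (x $ h * x $ k * heat_tail (b + 1) t ((norm x)\<^sup>2))))"
      unfolding b_def c_def by (rule ext, subst inv_laplace_hess_heat_closed_form[OF assms]) simp
    show ?thesis unfolding eq
      by (intro has_derivative_mult_right has_derivative_diff has_derivative_mult D1 D2 L)
  qed
  have "oseen_kernel t h k x $ j = pd h (heat_kernel t) x * axis k 1 $ j - pd j (inv_laplace (hess_heat h k t)) x"
    unfolding oseen_kernel_def leray_def divergence_pd_heat_kernel_axis[OF t] by (simp add: grad_def)
  also have "\<dots> = - of_bool (j = k) * (x $ h / (2 * t)) * heat_kernel t x
    + c * (oseen_sym j h k x / 4 * heat_tail (b + 1) t ((norm x)\<^sup>2)
       - x $ j * x $ h * x $ k / 8 * heat_tail (b + 1 + 1) t ((norm x)\<^sup>2))"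
  proof -
    have "x \<bullet> axis j 1 = x $ j" by (simp add: inner_axis)
    moreover have "axis k 1 $ j = (of_bool (j = k) :: real)" "axis j 1 $ l = (of_bool (j = l) :: real)" for l
      by (auto simp: axis_def)
    ultimately show ?thesis
      unfolding pd_eq_derivative[OF D] pd_heat_kernel oseen_sym_def
      by (cases "j = h"; cases "j = k"; cases "h = k") (simp_all add: algebra_simps)
  qed
  finally show ?thesis by (simp add: b_def c_def add.assoc)
qed

text \<open>Limit of the Oseen kernel away from the origin as the time tends to zero.\<close>

definition oseen_profile :: "'n \<Rightarrow> 'n \<Rightarrow> 'n \<Rightarrow> real^'n::finite \<Rightarrow> real" where
  "oseen_profile j h k x =
    gauss_const TYPE('n) * (oseen_sym j h k x / 4 * heat_tail (real CARD('n) / 2 + 1) 0 ((norm x)\<^sup>2)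
       - x $ j * x $ h * x $ k / 8 * heat_tail (real CARD('n) / 2 + 2) 0 ((norm x)\<^sup>2))"

definition profile_const :: "'n::finite itself \<Rightarrow> real" where
  "profile_const _ = gauss_const TYPE('n) * Gamma (real CARD('n) / 2 + 1) * 4 powr (real CARD('n) / 2)"

lemma profile_const_pos: "profile_const TYPE('n::finite) > 0"
  unfolding profile_const_def by (intro mult_pos_pos gauss_const_pos Gamma_real_pos) auto

text \<open>The functional equation of Gamma pulls out a common constant and leaves the factor d/2 +
  1 in the cubic term, whence d + 2. The result is a cubic over |x|^(d+4), homogeneous of degree
  -d-1.\<close>

lemma oseen_profile_eq:
  fixes x :: "real^'n::finite"
  assumes "x \<noteq> 0"
  shows "oseen_profile j h k x = profile_const TYPE('n) *
    ((norm x)\<^sup>2 * oseen_sym j h k x - (real CARD('n) + 2) * (x $ j * x $ h * x $ k)) *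
      ((norm x)\<^sup>2) powr (- (real CARD('n) / 2 + 2))"
proof -
  define b where "b = real CARD('n) / 2 + 1"
  define q where "q = (norm x)\<^sup>2"
  have b: "b > 0" by (simp add: b_def)
  have q: "q > 0" using assms by (simp add: q_def)
  have "b \<notin> \<int>\<^sub>\<le>\<^sub>0" using b by (auto elim!: nonpos_Ints_cases)
  then have G: "Gamma (b + 1) = b * Gamma b" by (intro Gamma_plus1) auto
  have 1: "heat_tail b 0 q = Gamma b * 4 powr b * (q * q powr (- (b + 1)))"
    using heat_tail_0[OF b q] q by (simp add: powr_divide powr_diff powr_minus powr_add field_simps)
  have 2: "heat_tail (b + 1) 0 q = b * Gamma b * (4 * 4 powr b) * q powr (- (b + 1))"
  proof -
    have "heat_tail (b + 1) 0 q = b * Gamma b * (4 / q) powr (b + 1)"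
      using heat_tail_0[of "b + 1" q] b q unfolding G by simp
    also have "(4 / q) powr (b + 1) = 4 * 4 powr b * q powr (- (b + 1))"
      using q by (simp only: powr_divide powr_minus_divide) (simp add: powr_add)
    finally show ?thesis by simp
  qed
  have 3: "4 powr b = 4 * 4 powr (real CARD('n) / 2)" by (simp add: b_def powr_add)
  have 4: "real CARD('n) / 2 + 2 = b + 1" "real CARD('n) / 2 + 1 = b" "real CARD('n) + 2 = 2 * b"
    by (simp_all add: b_def)
  show ?thesis
    unfolding oseen_profile_def profile_const_def q_def[symmetric] 4 1 2 3
    by (simp add: algebra_simps)
qed

section \<open>Pointwise bounds for the Oseen kernel and its profile\<close>

lemma powr_exp_heat_le_max:
  fixes s q p :: real
  assumes "s > 0" "q \<ge> 0" "p > 0"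
  shows "s powr (- p) * exp (- q / (4 * s)) \<le> (1 + 4 powr p * p powr p) * max s q powr (- p)"
proof (cases "q \<le> s")
  case True
  have "s powr (- p) * exp (- q / (4 * s)) \<le> s powr (- p)"
    using assms by (intro mult_left_le) auto
  then show ?thesis using True by (simp add: max_def distrib_right add_increasing2)
next
  case False
  then show ?thesis using powr_exp_heat_le[of s q p] assms by (simp add: max_def distrib_right add_increasing)
qed

text \<open>For q \<le> t the exponential is dropped; for q > t the tail is at most the full
  integral from time 0. The sum of the two constants serves both regimes.\<close>

lemma heat_tail_le_max:
  assumes "t > 0" "q \<ge> 0" "b > 0"
  shows "heat_tail b t q \<le> (1 / b + Gamma b * 4 powr b) * max t q powr (- b)"
proof (cases "q \<le> t")
  case True
  have "Gamma b > 0" using assms by (simp add: Gamma_real_pos)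
  then have "0 \<le> Gamma b * 4 powr b * t powr (- b)" by simp
  then show ?thesis using True heat_tail_le_powr[OF assms(3,1,2)] by (simp add: max_def distrib_right)
next
  case False
  then have q: "q > 0" using assms by simp
  have "heat_tail b t q \<le> Gamma b * 4 powr b * q powr (- b)"
    using heat_tail_le_heat_tail_0[of b t q] heat_tail_0[OF assms(3) q] assms q
    by (simp add: powr_divide powr_minus field_simps)
  then show ?thesis using False assms by (simp add: max_def distrib_right add_increasing)
qed

lemma abs_oseen_sym_le: "\<bar>oseen_sym j h k x\<bar> \<le> 3 * norm x"
proof -
  have "\<bar>of_bool P * x $ l\<bar> \<le> norm x" for P l
    using component_le_norm_cart[of x l] by (cases P) auto
  from this[of "j = h" k] this[of "j = k" h] this[of "h = k" j] show ?thesis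
    unfolding oseen_sym_def by linarith
qed

lemma abs_component_product_le: "\<bar>x $ j * x $ h * x $ k\<bar> \<le> norm x ^ 3" for x :: "real^'n::finite"
  unfolding abs_mult power3_eq_cube by (intro mult_mono component_le_norm_cart) auto

lemma norm_eq_powr: "norm x = ((norm x)\<^sup>2) powr (1/2)" "norm x ^ 3 = ((norm x)\<^sup>2) powr (3/2)"
proof -
  show 1: "norm x = ((norm x)\<^sup>2) powr (1/2)" by (simp add: powr_half_sqrt)
  show "norm x ^ 3 = ((norm x)\<^sup>2) powr (3/2)"
    by (cases "x = 0") (simp_all add: powr_powr flip: powr_numeral)
qed

text \<open>With m = max t |x|^2, each of the three terms is at most a multiple of m^(-(d+1)/2),
  since all have the same parabolic degree. The sum t + |x|^2 replaces m because its power is a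
  Poisson kernel, whose integral is explicit.\<close>

lemma oseen_kernel_bound:
  assumes n: "CARD('n::finite) \<ge> 2"
  obtains C where "C > 0"
    "\<And>t j h k (x::real^'n). t > 0 \<Longrightarrow> \<bar>oseen_kernel t h k x $ j\<bar> \<le> C * (t + (norm x)\<^sup>2) powr (- ((real CARD('n) + 1) / 2))"
proof -
  define a where "a = real CARD('n) / 2"
  define c where "c = gauss_const TYPE('n)"
  have a: "a > 0" "a + 1 > 0" "a + 2 > 0" using n by (simp_all add: a_def)
  have c: "c > 0" unfolding c_def by (rule gauss_const_pos)
  define K0 where "K0 = 1 + 4 powr (a + 1) * (a + 1) powr (a + 1)"
  define K1 where "K1 = 1 / (a + 1) + Gamma (a + 1) * 4 powr (a + 1)"
  define K2 where "K2 = 1 / (a + 2) + Gamma (a + 2) * 4 powr (a + 2)"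
  have K: "K0 > 0" "K1 > 0" "K2 > 0"
    unfolding K0_def K1_def K2_def using a by (auto intro!: add_pos_pos mult_pos_pos Gamma_real_pos)
  define K where "K = c * (K0 / 2 + 3 / 4 * K1 + K2 / 8)"
  show thesis
  proof (rule that[of "K * 2 powr (a + 1/2)"])
    have "K > 0" unfolding K_def using c K by (intro mult_pos_pos add_pos_pos) auto
    then show "K * 2 powr (a + 1/2) > 0" by simp
    fix t :: real and j h k :: 'n and x :: "real^'n" assume t: "t > 0"
    define q where "q = (norm x)\<^sup>2"
    have rq: "norm x = q powr (1/2)" "norm x ^ 3 = q powr (3/2)" unfolding q_def by (rule norm_eq_powr)+
    define m where "m = max t q"
    have q: "q \<ge> 0" by (simp add: q_def)
    have m: "m > 0" "q \<le> m" using t by (auto simp: m_def)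
    have r1: "norm x \<le> m powr (1/2)" unfolding rq(1) using m q by (intro powr_mono2) auto
    have r3: "norm x ^ 3 \<le> m powr (3/2)" unfolding rq(2) using m q by (intro powr_mono2) auto
    have "\<bar>of_bool (j = k) * (x $ h / (2 * t)) * heat_kernel t x\<bar> \<le> norm x / (2 * t) * heat_kernel t x"
      unfolding abs_mult abs_of_nonneg[OF heat_kernel_nonneg] using t component_le_norm_cart[of x h]
      by (intro mult_right_mono heat_kernel_nonneg) (auto simp: divide_right_mono)
    also have "\<dots> = c / 2 * norm x * (t powr (- (a + 1)) * exp (- q / (4 * t)))"
    proof -
      have "t powr (- (a + 1)) = t powr (- a) / t" using t powr_diff[of t "- a" 1] by simp
      then show ?thesis
        using t unfolding heat_kernel_alt[OF t] a_def[symmetric] c_def[symmetric] q_def[symmetric] by simp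
    qed
    also have "\<dots> \<le> c / 2 * m powr (1/2) * (K0 * m powr (- (a + 1)))"
      unfolding K0_def m_def using t q a r1 c
      by (intro mult_mono powr_exp_heat_le_max) (auto simp: m_def)
    also have "\<dots> = c * (K0 / 2) * (m powr (1/2) * m powr (- (a + 1)))" by simp
    also have "m powr (1/2) * m powr (- (a + 1)) = m powr (- (a + 1/2))"
      unfolding powr_add[symmetric] by (intro arg_cong2[where f="(powr)"] refl) linarith
    finally have T0: "\<bar>of_bool (j = k) * (x $ h / (2 * t)) * heat_kernel t x\<bar> \<le> c * (K0 / 2) * m powr (- (a + 1/2))" .
    have "\<bar>oseen_sym j h k x / 4 * heat_tail (a + 1) t q\<bar> \<le> 3 / 4 * norm x * heat_tail (a + 1) t q"
      using abs_oseen_sym_le[of j h k x] by (simp add: abs_mult heat_tail_nonneg mult_right_mono)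
    also have "\<dots> \<le> 3 / 4 * m powr (1/2) * (K1 * m powr (- (a + 1)))"
      unfolding K1_def m_def using t q a r1
      by (intro mult_mono heat_tail_le_max) (auto simp: m_def heat_tail_nonneg)
    also have "\<dots> = 3 / 4 * K1 * (m powr (1/2) * m powr (- (a + 1)))" by simp
    also have "m powr (1/2) * m powr (- (a + 1)) = m powr (- (a + 1/2))"
      unfolding powr_add[symmetric] by (intro arg_cong2[where f="(powr)"] refl) linarith
    finally have T1: "\<bar>oseen_sym j h k x / 4 * heat_tail (a + 1) t q\<bar> \<le> 3 / 4 * K1 * m powr (- (a + 1/2))" .
    have "\<bar>x $ j * x $ h * x $ k / 8 * heat_tail (a + 2) t q\<bar> \<le> 1 / 8 * norm x ^ 3 * heat_tail (a + 2) t q"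
      using abs_component_product_le[of x j h k] by (simp add: abs_mult heat_tail_nonneg mult_right_mono)
    also have "\<dots> \<le> 1 / 8 * m powr (3/2) * (K2 * m powr (- (a + 2)))"
      unfolding K2_def m_def using t q a r3
      by (intro mult_mono heat_tail_le_max) (auto simp: m_def heat_tail_nonneg)
    also have "\<dots> = K2 / 8 * (m powr (3/2) * m powr (- (a + 2)))" by simp
    also have "m powr (3/2) * m powr (- (a + 2)) = m powr (- (a + 1/2))"
      unfolding powr_add[symmetric] by (intro arg_cong2[where f="(powr)"] refl) linarith
    finally have T2: "\<bar>x $ j * x $ h * x $ k / 8 * heat_tail (a + 2) t q\<bar> \<le> K2 / 8 * m powr (- (a + 1/2))" .
    have "\<bar>oseen_sym j h k x / 4 * heat_tail (a + 1) t q - x $ j * x $ h * x $ k / 8 * heat_tail (a + 2) t q\<bar>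
       \<le> (3 / 4 * K1 + K2 / 8) * m powr (- (a + 1/2))"
      using T1 T2 by (simp add: distrib_right abs_le_iff)
    then have "\<bar>c * (oseen_sym j h k x / 4 * heat_tail (a + 1) t q - x $ j * x $ h * x $ k / 8 * heat_tail (a + 2) t q)\<bar>
       \<le> c * ((3 / 4 * K1 + K2 / 8) * m powr (- (a + 1/2)))"
      using c by (simp add: abs_mult)
    with T0 have "\<bar>oseen_kernel t h k x $ j\<bar> \<le> c * (K0 / 2) * m powr (- (a + 1/2)) + c * ((3 / 4 * K1 + K2 / 8) * m powr (- (a + 1/2)))"
      unfolding oseen_kernel_nth[OF n t] a_def[symmetric] c_def[symmetric] q_def[symmetric] mult_minus_left
      by (intro order_trans[OF abs_triangle_ineq] add_mono) (simp_all only: abs_minus_cancel)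
    also have "\<dots> = K * m powr (- (a + 1/2))" by (simp add: K_def algebra_simps)
    also have "\<dots> \<le> K * (2 powr (a + 1/2) * (t + q) powr (- (a + 1/2)))"
    proof -
      \<comment> \<open>Since t + q \<le> 2m, replacing the maximum by the sum costs the factor 2^(a
        + 1/2).\<close>
      have "(2 * m) powr (- (a + 1/2)) \<le> (t + q) powr (- (a + 1/2))"
        using t q a by (intro powr_mono2') (auto simp: m_def)
      then have "2 powr (a + 1/2) * (2 * m) powr (- (a + 1/2)) \<le> 2 powr (a + 1/2) * (t + q) powr (- (a + 1/2))"
        by (rule mult_left_mono) simp
      moreover have "2 powr p * (2 * m) powr (- p) = m powr (- p)" for p :: real
        using m by (simp add: powr_mult powr_minus)
      ultimately have "m powr (- (a + 1/2)) \<le> 2 powr (a + 1/2) * (t + q) powr (- (a + 1/2))"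
        by (simp only:)
      then show ?thesis using \<open>K > 0\<close> by (intro mult_left_mono) auto
    qed
    also have "a + 1/2 = (real CARD('n) + 1) / 2" by (simp add: a_def add_divide_distrib)
    finally show "\<bar>oseen_kernel t h k x $ j\<bar> \<le> K * 2 powr (a + 1/2) * (t + (norm x)\<^sup>2) powr (- ((real CARD('n) + 1) / 2))"
      by (simp add: q_def add_divide_distrib a_def mult.assoc)
  qed
qed

text \<open>The Gaussian term leaves no trace in the profile: away from the origin it is beaten by
  every power of t, and one factor t is kept. The two tails differ from their values at time 0 by
  the Lipschitz bound in time.\<close>

lemma oseen_kernel_profile_diff:
  assumes n: "CARD('n::finite) \<ge> 2"
  obtains C where "C > 0"
    "\<And>t j h k (x::real^'n). t > 0 \<Longrightarrow> x \<noteq> 0 \<Longrightarrow>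
      \<bar>oseen_kernel t h k x $ j - oseen_profile j h k x\<bar> \<le> C * t * ((norm x)\<^sup>2) powr (- ((real CARD('n) + 3) / 2))"
proof -
  define a where "a = real CARD('n) / 2"
  define c where "c = gauss_const TYPE('n)"
  have a: "a > 0" "a + 1 > 0" "a + 2 > 0" using n by (simp_all add: a_def)
  have c: "c > 0" unfolding c_def by (rule gauss_const_pos)
  define K2 where "K2 = 4 powr (a + 2) * (a + 2) powr (a + 2)"
  define K3 where "K3 = 4 powr (a + 3) * (a + 3) powr (a + 3)"
  have K: "K2 > 0" "K3 > 0" unfolding K2_def K3_def using a by auto
  define K where "K = c * (K2 / 2 + 3 / 4 * K2 + K3 / 8)"
  show thesis
  proof (rule that[of K])
    show "K > 0" unfolding K_def using c K by (intro mult_pos_pos add_pos_pos) auto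
    fix t :: real and j h k :: 'n and x :: "real^'n" assume t: "t > 0" and x: "x \<noteq> 0"
    define q where "q = (norm x)\<^sup>2"
    have rq: "norm x = q powr (1/2)" "norm x ^ 3 = q powr (3/2)" unfolding q_def by (rule norm_eq_powr)+
    have q: "q > 0" using x by (simp add: q_def)
    have r1: "norm x * q powr (- (a + 2)) = q powr (- (a + 3/2))"
      unfolding rq(1) powr_add[symmetric] by (intro arg_cong2[where f="(powr)"] refl) linarith
    have r3: "norm x ^ 3 * q powr (- (a + 3)) = q powr (- (a + 3/2))"
      unfolding rq(2) powr_add[symmetric] by (intro arg_cong2[where f="(powr)"] refl) linarith
    have "\<bar>of_bool (j = k) * (x $ h / (2 * t)) * heat_kernel t x\<bar> \<le> norm x / (2 * t) * heat_kernel t x"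
      unfolding abs_mult abs_of_nonneg[OF heat_kernel_nonneg] using t component_le_norm_cart[of x h]
      by (intro mult_right_mono heat_kernel_nonneg) (auto simp: divide_right_mono)
    also have "\<dots> = c / 2 * norm x * t * (t powr (- (a + 2)) * exp (- q / (4 * t)))"
    proof -
      have "t powr (- (a + 2)) = t powr (- a) / t\<^sup>2" using t powr_diff[of t "- a" 2] by simp
      then show ?thesis
        using t unfolding heat_kernel_alt[OF t] a_def[symmetric] c_def[symmetric] q_def[symmetric]
        by (simp add: power2_eq_square)
    qed
    also have "\<dots> \<le> c / 2 * norm x * t * (K2 * q powr (- (a + 2)))"
      unfolding K2_def using t q a c by (intro mult_left_mono powr_exp_heat_le) auto
    also have "\<dots> = c * (K2 / 2) * t * (norm x * q powr (- (a + 2)))" by simp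
    finally have T0: "\<bar>of_bool (j = k) * (x $ h / (2 * t)) * heat_kernel t x\<bar> \<le> c * (K2 / 2) * t * q powr (- (a + 3/2))"
      unfolding r1 .
    have inc: "\<bar>heat_tail b t q - heat_tail b 0 q\<bar> \<le> t * (4 powr (b + 1) * (b + 1) powr (b + 1) * q powr (- (b + 1)))" if "b > 0" for b
      using heat_tail_increment_le[of b 0 t q] that t q abs_minus_commute[of "heat_tail b t q"] by simp
    have "\<bar>oseen_sym j h k x / 4 * (heat_tail (a + 1) t q - heat_tail (a + 1) 0 q)\<bar> \<le>
        3 / 4 * norm x * (t * (K2 * q powr (- (a + 2))))"
      unfolding abs_mult K2_def using inc[of "a + 1"] abs_oseen_sym_le[of j h k x] a
      by (intro mult_mono) (auto simp: add.assoc)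
    also have "\<dots> = 3 / 4 * K2 * t * (norm x * q powr (- (a + 2)))" by simp
    finally have T1: "\<bar>oseen_sym j h k x / 4 * (heat_tail (a + 1) t q - heat_tail (a + 1) 0 q)\<bar> \<le>
        3 / 4 * K2 * t * q powr (- (a + 3/2))" unfolding r1 .
    have "\<bar>x $ j * x $ h * x $ k / 8 * (heat_tail (a + 2) t q - heat_tail (a + 2) 0 q)\<bar> \<le>
        1 / 8 * norm x ^ 3 * (t * (K3 * q powr (- (a + 3))))"
      unfolding abs_mult[of "_ / 8"] K3_def using inc[of "a + 2"] abs_component_product_le[of x j h k] a
      by (intro mult_mono) (auto simp: add.assoc)
    also have "\<dots> = K3 / 8 * t * (norm x ^ 3 * q powr (- (a + 3)))" by simp
    finally have T2: "\<bar>x $ j * x $ h * x $ k / 8 * (heat_tail (a + 2) t q - heat_tail (a + 2) 0 q)\<bar> \<le>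
        K3 / 8 * t * q powr (- (a + 3/2))" unfolding r3 .
    have "\<bar>oseen_sym j h k x / 4 * (heat_tail (a + 1) t q - heat_tail (a + 1) 0 q) -
        x $ j * x $ h * x $ k / 8 * (heat_tail (a + 2) t q - heat_tail (a + 2) 0 q)\<bar>
       \<le> 3 / 4 * K2 * t * q powr (- (a + 3/2)) + K3 / 8 * t * q powr (- (a + 3/2))"
      using T1 T2 by (simp add: abs_le_iff)
    then have T3: "\<bar>c * (oseen_sym j h k x / 4 * (heat_tail (a + 1) t q - heat_tail (a + 1) 0 q) -
        x $ j * x $ h * x $ k / 8 * (heat_tail (a + 2) t q - heat_tail (a + 2) 0 q))\<bar>
       \<le> c * (3 / 4 * K2 * t * q powr (- (a + 3/2)) + K3 / 8 * t * q powr (- (a + 3/2)))"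
      using c by (simp add: abs_mult)
    have "oseen_kernel t h k x $ j - oseen_profile j h k x =
      c * (oseen_sym j h k x / 4 * (heat_tail (a + 1) t q - heat_tail (a + 1) 0 q) -
        x $ j * x $ h * x $ k / 8 * (heat_tail (a + 2) t q - heat_tail (a + 2) 0 q))
      - of_bool (j = k) * (x $ h / (2 * t)) * heat_kernel t x"
      unfolding oseen_kernel_nth[OF n t] oseen_profile_def a_def[symmetric] c_def[symmetric] q_def[symmetric]
      by (simp only: mult_minus_left right_diff_distrib left_diff_distrib)
    then have "\<bar>oseen_kernel t h k x $ j - oseen_profile j h k x\<bar> \<le>
        c * (3 / 4 * K2 * t * q powr (- (a + 3/2)) + K3 / 8 * t * q powr (- (a + 3/2))) + c * (K2 / 2) * t * q powr (- (a + 3/2))"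
      using T0 T3 by (simp only:)
    also have "\<dots> = K * t * q powr (- (a + 3/2))" by (simp add: K_def algebra_simps)
    also have "a + 3/2 = (real CARD('n) + 3) / 2" by (simp add: a_def add_divide_distrib)
    finally show "\<bar>oseen_kernel t h k x $ j - oseen_profile j h k x\<bar> \<le> K * t * ((norm x)\<^sup>2) powr (- ((real CARD('n) + 3) / 2))"
      by (simp add: q_def)
  qed
qed

lemma oseen_profile_bound:
  obtains C where "C > 0"
    "\<And>j h k (x::real^'n::finite). x \<noteq> 0 \<Longrightarrow> \<bar>oseen_profile j h k x\<bar> \<le> C * ((norm x)\<^sup>2) powr (- ((real CARD('n) + 1) / 2))"
proof (rule that[of "profile_const TYPE('n) * (real CARD('n) + 5)"])
  show "profile_const TYPE('n) * (real CARD('n) + 5) > 0"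
    by (intro mult_pos_pos profile_const_pos) auto
  fix j h k :: 'n and x :: "real^'n" assume x: "x \<noteq> 0"
  define a where "a = real CARD('n) / 2"
  define q where "q = (norm x)\<^sup>2"
  have rq: "norm x = q powr (1/2)" "norm x ^ 3 = q powr (3/2)" unfolding q_def by (rule norm_eq_powr)+
  have r: "norm x ^ 3 * q powr (- (a + 2)) = q powr (- (a + 1/2))"
    unfolding rq(2) powr_add[symmetric] by (intro arg_cong2[where f="(powr)"] refl) linarith
  have "\<bar>(norm x)\<^sup>2 * oseen_sym j h k x\<bar> \<le> (norm x)\<^sup>2 * (3 * norm x)"
    unfolding abs_mult by (intro mult_mono abs_oseen_sym_le) auto
  moreover have "\<bar>(real CARD('n) + 2) * (x $ j * x $ h * x $ k)\<bar> \<le> (real CARD('n) + 2) * norm x ^ 3"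
    unfolding abs_mult[of "real CARD('n) + 2"] by (intro mult_mono abs_component_product_le) auto
  ultimately have "\<bar>(norm x)\<^sup>2 * oseen_sym j h k x - (real CARD('n) + 2) * (x $ j * x $ h * x $ k)\<bar> \<le>
      (norm x)\<^sup>2 * (3 * norm x) + (real CARD('n) + 2) * norm x ^ 3"
    by linarith
  also have "\<dots> = (real CARD('n) + 5) * norm x ^ 3"
    by (simp add: algebra_simps power2_eq_square power3_eq_cube)
  finally have "\<bar>oseen_profile j h k x\<bar> \<le> profile_const TYPE('n) * ((real CARD('n) + 5) * norm x ^ 3) * q powr (- (a + 2))"
    unfolding oseen_profile_eq[OF x] abs_mult a_def[symmetric] q_def[symmetric]
    using profile_const_pos[where 'n='n] by (intro mult_right_mono mult_mono) auto
  also have "\<dots> = profile_const TYPE('n) * (real CARD('n) + 5) * (norm x ^ 3 * q powr (- (a + 2)))" by simp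
  also have "norm x ^ 3 * q powr (- (a + 2)) = q powr (- ((real CARD('n) + 1) / 2))"
    unfolding r by (simp add: a_def add_divide_distrib)
  finally show "\<bar>oseen_profile j h k x\<bar> \<le> profile_const TYPE('n) * (real CARD('n) + 5) * ((norm x)\<^sup>2) powr (- ((real CARD('n) + 1) / 2))"
    unfolding q_def .
qed

lemma oseen_kernel_measurable:
  assumes "CARD('n::finite) \<ge> 2" "t > 0"
  shows "(\<lambda>x::real^'n. oseen_kernel t h k x $ j) \<in> borel_measurable borel"
proof -
  have "heat_tail b t \<in> borel_measurable borel" if "b > 0" for b
    by (intro borel_measurable_continuous_onI continuous_at_imp_continuous_on ballI
        DERIV_isCont[OF has_real_derivative_heat_tail] that assms)
  from this[of "real CARD('n) / 2 + 1"] this[of "real CARD('n) / 2 + 2"]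
  have [measurable]: "heat_tail (real CARD('n) / 2 + 1) t \<in> borel_measurable borel"
    "heat_tail (real CARD('n) / 2 + 2) t \<in> borel_measurable borel" by auto
  show ?thesis unfolding oseen_kernel_nth[OF assms] oseen_sym_def by measurable
qed

lemma continuous_on_oseen_kernel_time:
  fixes x :: "real^'n::finite"
  assumes n: "CARD('n) \<ge> 2" and "x \<noteq> 0"
  shows "continuous_on {0<..} (\<lambda>t. oseen_kernel t h k x $ j)"
proof -
  have ht: "continuous_on {0<..} (\<lambda>t. heat_tail b t ((norm x)\<^sup>2))" if "b > 0" for b
    by (rule continuous_on_subset[OF continuous_on_heat_tail_time]) (use that assms in auto)
  have "continuous_on {0<..} (\<lambda>t. - of_bool (j = k) * (x $ h / (2 * t)) * heat_kernel t x
    + gauss_const TYPE('n) * (oseen_sym j h k x / 4 * heat_tail (real CARD('n) / 2 + 1) t ((norm x)\<^sup>2)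
       - x $ j * x $ h * x $ k / 8 * heat_tail (real CARD('n) / 2 + 2) t ((norm x)\<^sup>2)))"
    unfolding heat_kernel_def by (intro continuous_intros ht) auto
  then show ?thesis
    by (rule continuous_on_cong[THEN iffD1, rotated -1]) (simp_all add: oseen_kernel_nth[OF n])
qed

text \<open>Subordination: by Euler's integral, (t + |z|^2)^(-(d+1)/2) is a mixture of heat kernels
  with weight s^(-3/2) exp (-t/(4s)). Fubini and the unit mass of the heat kernel then give its
  integral. It is the Poisson kernel at height t^(1/2) up to a factor depending on t and d.\<close>

lemma poisson_kernel_integral:
  obtains C where "C > 0"
    "\<And>t x::real^'n::finite. t > 0 \<Longrightarrow> integrable lborel (\<lambda>y. (t + (norm (x - y))\<^sup>2) powr (- ((real CARD('n) + 1) / 2)))"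
    "\<And>t x::real^'n::finite. t > 0 \<Longrightarrow> (\<integral>y. (t + (norm (x - y))\<^sup>2) powr (- ((real CARD('n) + 1) / 2)) \<partial>lborel) = C * t powr (- 1/2)"
proof -
  define a where "a = real CARD('n) / 2"
  define b where "b = (real CARD('n) + 1) / 2"
  define c where "c = gauss_const TYPE('n)"
  have ab: "b = a + 1/2" "b > 0" by (simp_all add: a_def b_def add_divide_distrib)
  have c: "c > 0" unfolding c_def by (rule gauss_const_pos)
  \<comment> \<open>D is the factor produced by the integral over s at fixed y, and E t^(-1/2) is
    the total mass of the weight.\<close>
  define D where "D = c * Gamma b * 4 powr b"
  have D: "D > 0" unfolding D_def using c ab by (intro mult_pos_pos Gamma_real_pos) auto
  define E where "E = Gamma (1/2) * 4 powr (1/2::real)"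
  have E: "E > 0" unfolding E_def by (intro mult_pos_pos Gamma_real_pos) auto
  have main: "integrable lborel (\<lambda>y. (t + (norm (x - y))\<^sup>2) powr (- b)) \<and>
      (\<integral>y. (t + (norm (x - y))\<^sup>2) powr (- b) \<partial>lborel) = E / D * t powr (- 1/2)" if t: "t > 0" for t and x :: "real^'n"
  proof -
    define w where "w s = indicator {0<..} s * (s powr (- (1/2) - 1) * exp (- t / (4 * s)))" for s :: real
    define f where "f = (\<lambda>(s, y). w s * heat_kernel s (x - y))"
    have wm [measurable]: "w \<in> borel_measurable borel" unfolding w_def by measurable
    have fm: "f \<in> borel_measurable (lborel \<Otimes>\<^sub>M lborel)"
      unfolding f_def heat_kernel_def by measurable
    have w0: "w s \<ge> 0" for s by (simp add: w_def)
    have w: "integrable lborel w" "(\<integral>s. w s \<partial>lborel) = E * t powr (- 1/2)"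
    proof -
      show "integrable lborel w"
        unfolding w_def using set_integrable_heat_tail_0[of "1/2" t] t by (simp add: set_integrable_def)
      have "(\<integral>s. w s \<partial>lborel) = heat_tail (1/2) 0 t"
        unfolding w_def heat_tail_def set_lebesgue_integral_def by simp
      also have "\<dots> = E * t powr (- 1/2)"
        unfolding E_def using t by (subst heat_tail_0) (simp_all add: powr_divide powr_minus field_simps)
      finally show "(\<integral>s. w s \<partial>lborel) = E * t powr (- 1/2)" .
    qed
    have fy: "integrable lborel (\<lambda>y. f (s, y))" "(\<integral>y. f (s, y) \<partial>lborel) = w s"
       "(\<integral>y. norm (f (s, y)) \<partial>lborel) = w s" for s
    proof -
      show 1: "integrable lborel (\<lambda>y. f (s, y))" "(\<integral>y. f (s, y) \<partial>lborel) = w s"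
        using integral_heat_kernel_diff[of s x] by (cases "s > 0"; simp add: f_def w_def)+
      have "norm (f (s, y)) = f (s, y)" for y
        using w0[of s] heat_kernel_nonneg[of s "x - y"] by (simp add: f_def)
      then show "(\<integral>y. norm (f (s, y)) \<partial>lborel) = w s" using 1 by simp
    qed
    have fint: "integrable (lborel \<Otimes>\<^sub>M lborel) f"
      by (rule lborel_pair.integrable_pair_bound[OF fm, where B = w]) (use fy w in auto)
    have fs: "(\<integral>s. f (s, y) \<partial>lborel) = D * (t + (norm (x - y))\<^sup>2) powr (- b)" for y
    proof -
      define Q where "Q = t + (norm (x - y))\<^sup>2"
      have Q: "Q > 0" using t by (simp add: Q_def add_pos_nonneg)
      have "f (s, y) = c * (indicator {0<..} s * (s powr (- b - 1) * exp (- Q / (4 * s))))" for s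
      proof (cases "s > 0")
        case True
        have 1: "s powr (- (1/2) - 1) * s powr (- a) = s powr (- b - 1)"
          by (simp add: ab flip: powr_add)
        have 2: "exp (- t / (4 * s)) * exp (- (norm (x - y))\<^sup>2 / (4 * s)) = exp (- Q / (4 * s))"
          by (simp add: Q_def add_divide_distrib diff_divide_distrib flip: exp_add)
        have "f (s, y) = c * ((s powr (- (1/2) - 1) * s powr (- a)) * (exp (- t / (4 * s)) * exp (- (norm (x - y))\<^sup>2 / (4 * s))))"
          using True unfolding f_def w_def case_prod_conv heat_kernel_alt[OF True] a_def[symmetric] c_def[symmetric]
          by simp
        then show ?thesis unfolding 1 2 using True by simp
      qed (simp add: f_def w_def)
      then have "(\<integral>s. f (s, y) \<partial>lborel) = c * heat_tail b 0 Q"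
        by (simp add: heat_tail_def set_lebesgue_integral_def)
      also have "\<dots> = D * Q powr (- b)"
        using heat_tail_0[OF ab(2) Q] Q by (simp add: D_def powr_divide powr_minus field_simps)
      finally show ?thesis by (simp add: Q_def)
    qed
    have "integrable lborel (\<lambda>y. \<integral>s. f (s, y) \<partial>lborel)"
      using lborel_pair.integrable_snd[of "\<lambda>s y. f (s, y)"] fint by simp
    then have 1: "integrable lborel (\<lambda>y. (t + (norm (x - y))\<^sup>2) powr (- b))"
      unfolding fs using D by (subst (asm) integrable_mult_left_iff) auto
    have "D * (\<integral>y. (t + (norm (x - y))\<^sup>2) powr (- b) \<partial>lborel) = (\<integral>y. (\<integral>s. f (s, y) \<partial>lborel) \<partial>lborel)"
      unfolding fs by simp
    also have "\<dots> = (\<integral>s. (\<integral>y. f (s, y) \<partial>lborel) \<partial>lborel)"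
      using lborel_pair.Fubini_integral[of "\<lambda>s y. f (s, y)"] fint by simp
    also have "\<dots> = E * t powr (- 1/2)" unfolding fy w(2) ..
    finally have "(\<integral>y. (t + (norm (x - y))\<^sup>2) powr (- b) \<partial>lborel) = E / D * t powr (- 1/2)"
      using D by (simp add: field_simps)
    with 1 show ?thesis by blast
  qed
  show thesis
    by (rule that[of "E / D"]) (use main D E in \<open>auto simp: b_def\<close>)
qed

section \<open>Estimates for the heat semigroup\<close>

text \<open>A function that is not integrable has integral 0, so no measurability of f
  enters.\<close>

lemma norm_integral_le_AE:
  fixes f :: "'a \<Rightarrow> 'b::{banach, second_countable_topology}"
  assumes g: "integrable M g" and le: "AE x in M. norm (f x) \<le> g x"
  shows "norm (\<integral>x. f x \<partial>M) \<le> (\<integral>x. g x \<partial>M)"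
proof (cases "integrable M f")
  case True
  have "norm (\<integral>x. f x \<partial>M) \<le> (\<integral>x. norm (f x) \<partial>M)" by (rule integral_norm_bound)
  also have "\<dots> \<le> (\<integral>x. g x \<partial>M)" using le True g by (intro integral_mono_AE) auto
  finally show ?thesis .
next
  case False
  have "AE x in M. 0 \<le> g x" using le by eventually_elim (rule order_trans[OF norm_ge_zero])
  then show ?thesis using False by (simp add: not_integrable_integral_eq integral_nonneg_AE)
qed

lemma integrable_lebesgueI:
  "integrable lborel f \<Longrightarrow> integrable lebesgue f"
  for f :: "'a::euclidean_space \<Rightarrow> 'b::{banach, second_countable_topology}"
  using integrable_completion[of f lborel] borel_measurable_integrable[of lborel f] by auto

lemma integral_lebesgue_eq_lborel:
  "f \<in> borel_measurable borel \<Longrightarrow> (\<integral>x. f x \<partial>lebesgue) = (\<integral>x. f x \<partial>lborel)"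
  for f :: "'a::euclidean_space \<Rightarrow> 'b::{banach, second_countable_topology}"
  by (rule integral_completion) simp

definition decay_weight :: "real^'n::finite \<Rightarrow> real" where
  "decay_weight x = (1 + norm x) powr (- (real CARD('n) + 1))"

lemma decay_weight_measurable [measurable]: "decay_weight \<in> borel_measurable borel"
  unfolding decay_weight_def by measurable

lemma decay_weight_pos: "0 < decay_weight x"
proof -
  have "1 + norm x \<noteq> 0" by (smt (verit) norm_ge_zero)
  then show ?thesis by (simp add: decay_weight_def)
qed

lemma decay_weight_le_1: "decay_weight (x :: real^'n::finite) \<le> 1"
  using powr_mono2'[of "- (real CARD('n) + 1)" 1 "1 + norm x"] by (simp add: decay_weight_def)

text \<open>(1 + |y|)^2 \<ge> 1 + |y|^2 compares the weight with the Poisson kernel at t =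
  1.\<close>

lemma integrable_decay_weight: "integrable lborel (decay_weight :: real^'n::finite \<Rightarrow> real)"
proof -
  obtain C where "\<And>t x::real^'n. t > 0 \<Longrightarrow>
      integrable lborel (\<lambda>y. (t + (norm (x - y))\<^sup>2) powr (- ((real CARD('n) + 1) / 2)))"
    by (rule poisson_kernel_integral) blast
  from this[of 1 0] have i: "integrable lborel (\<lambda>y::real^'n. (1 + (norm y)\<^sup>2) powr (- ((real CARD('n) + 1) / 2)))"
    by simp
  show ?thesis
  proof (rule Bochner_Integration.integrable_bound[OF i])
    show "AE y in lborel. norm (decay_weight (y::real^'n)) \<le> norm ((1 + (norm y)\<^sup>2) powr (- ((real CARD('n) + 1) / 2)))"
    proof (rule AE_I2)
      fix y :: "real^'n"
      have "decay_weight y = ((1 + norm y) powr 2) powr (- ((real CARD('n) + 1) / 2))"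
        unfolding decay_weight_def powr_powr by (intro arg_cong2[where f = "(powr)"] refl) (simp add: field_simps)
      also have "(1 + norm y) powr 2 = (1 + norm y)\<^sup>2" by (simp add: add_pos_nonneg)
      also have "((1 + norm y)\<^sup>2) powr (- ((real CARD('n) + 1) / 2)) \<le> (1 + (norm y)\<^sup>2) powr (- ((real CARD('n) + 1) / 2))"
        by (intro powr_mono2') (auto simp: power2_eq_square algebra_simps add_pos_nonneg)
      finally show "norm (decay_weight y) \<le> norm ((1 + (norm y)\<^sup>2) powr (- ((real CARD('n) + 1) / 2)))"
        using decay_weight_pos[of y] by simp
    qed
  qed simp
qed

lemma integrable_decay_weight_lebesgue: "integrable lebesgue (decay_weight :: real^'n::finite \<Rightarrow> real)"
  by (rule integrable_lebesgueI[OF integrable_decay_weight])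

text \<open>Submultiplicativity: 1 + |x| \<le> (1 + |x - y|)(1 + |y|). Decay in y becomes decay in x
  at the price of a weight in x - y that a Gaussian can absorb.\<close>

lemma peetre:
  fixes x y :: "'a::real_normed_vector"
  assumes "\<theta> \<ge> 0"
  shows "(1 + norm y) powr (- \<theta>) \<le> (1 + norm (x - y)) powr \<theta> * (1 + norm x) powr (- \<theta>)"
proof -
  have pos: "1 + norm z > 0" for z :: 'a by (simp add: add_pos_nonneg)
  have "1 + norm x \<le> (1 + norm (x - y)) * (1 + norm y)"
  proof -
    have "norm x \<le> norm (x - y) + norm y" using norm_triangle_ineq[of "x - y" y] by simp
    moreover have "0 \<le> norm (x - y) * norm y" by simp
    moreover have "(1 + norm (x - y)) * (1 + norm y) = 1 + norm (x - y) + norm y + norm (x - y) * norm y"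
      by (simp add: algebra_simps)
    ultimately show ?thesis by linarith
  qed
  then have "(1 + norm x) powr \<theta> \<le> ((1 + norm (x - y)) * (1 + norm y)) powr \<theta>"
    using assms pos[of x] by (intro powr_mono2) auto
  also have "\<dots> = (1 + norm (x - y)) powr \<theta> * (1 + norm y) powr \<theta>"
    by (rule powr_mult)
  finally have "(1 + norm x) powr \<theta> \<le> (1 + norm (x - y)) powr \<theta> * (1 + norm y) powr \<theta>" .
  then have "(1 + norm x) powr \<theta> * ((1 + norm x) powr (- \<theta>) * (1 + norm y) powr (- \<theta>)) \<le>
      (1 + norm (x - y)) powr \<theta> * (1 + norm y) powr \<theta> * ((1 + norm x) powr (- \<theta>) * (1 + norm y) powr (- \<theta>))"
    by (rule mult_right_mono) simp
  moreover have "(1 + norm z) powr \<theta> * (1 + norm z) powr (- \<theta>) = 1" for z :: 'a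
    using pos[of z] by (simp flip: powr_add)
  then have "(1 + norm x) powr \<theta> * ((1 + norm x) powr (- \<theta>) * Y) = Y"
    "X * (1 + norm y) powr \<theta> * (Z * (1 + norm y) powr (- \<theta>)) = X * Z" for X Y Z
    by (simp_all add: mult.assoc[symmetric])
  ultimately show ?thesis by (simp only:)
qed

text \<open>The weight produced by \<open>peetre\<close> is absorbed by the Gaussian for t \<le> 1,
  and a kernel of unit mass is left. Values in a Banach space cover both scalar functions and vector
  fields.\<close>

lemma heat_decay_bound:
  assumes "\<theta> \<ge> 0"
  obtains C where "C > 0"
    "\<And>(t::real) M x (f :: real^'n::finite \<Rightarrow> 'b::{banach, second_countable_topology}). 0 < t \<Longrightarrow> t \<le> 1 \<Longrightarrow> M \<ge> 0 \<Longrightarrow>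
      (AE y in lebesgue. norm (f y) \<le> M * (1 + norm y) powr (- \<theta>)) \<Longrightarrow>
      norm (\<integral>y. heat_kernel t (x - y) *\<^sub>R f y \<partial>lebesgue) \<le> M * C * (1 + norm x) powr (- \<theta>)"
proof -
  obtain C where C: "C > 0"
    "\<And>t x. \<lbrakk>0 < t; t \<le> 1\<rbrakk> \<Longrightarrow> (1 + norm x) powr \<theta> * heat_kernel t (x::real^'n) \<le> C * heat_kernel (2 * t) x"
    by (rule weighted_heat_kernel_bound[OF assms zero_less_one, where 'n='n]) blast
  show thesis
  proof (rule that[OF C(1)])
    fix t M :: real and x and f :: "real^'n \<Rightarrow> 'b" assume t: "0 < t" "t \<le> 1" and M: "M \<ge> 0"
      and f: "AE y in lebesgue. norm (f y) \<le> M * (1 + norm y) powr (- \<theta>)"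
    have t2: "2 * t > 0" using t by simp
    have "norm (\<integral>y. heat_kernel t (x - y) *\<^sub>R f y \<partial>lebesgue) \<le>
       (\<integral>y. M * C * (1 + norm x) powr (- \<theta>) * heat_kernel (2 * t) (x - y) \<partial>lebesgue)"
    proof (rule norm_integral_le_AE)
      show "integrable lebesgue (\<lambda>y. M * C * (1 + norm x) powr (- \<theta>) * heat_kernel (2 * t) (x - y))"
        by (intro integrable_mult_right integrable_lebesgueI integral_heat_kernel_diff t2)
      show "AE y in lebesgue. norm (heat_kernel t (x - y) *\<^sub>R f y) \<le> M * C * (1 + norm x) powr (- \<theta>) * heat_kernel (2 * t) (x - y)"
        using f
      proof eventually_elim
        case (elim y)
        have "norm (heat_kernel t (x - y) *\<^sub>R f y) \<le> heat_kernel t (x - y) * (M * (1 + norm y) powr (- \<theta>))"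
          using elim by (simp add: heat_kernel_nonneg mult_left_mono)
        also have "\<dots> \<le> heat_kernel t (x - y) * (M * ((1 + norm (x - y)) powr \<theta> * (1 + norm x) powr (- \<theta>)))"
          using peetre[OF assms, of y x] M by (intro mult_left_mono heat_kernel_nonneg)
        also have "\<dots> = M * (1 + norm x) powr (- \<theta>) * ((1 + norm (x - y)) powr \<theta> * heat_kernel t (x - y))"
          by simp
        also have "\<dots> \<le> M * (1 + norm x) powr (- \<theta>) * (C * heat_kernel (2 * t) (x - y))"
          using C(2)[OF t, of "x - y"] M by (intro mult_left_mono) auto
        finally show ?case by (simp add: mult_ac)
      qed
    qed
    also have "\<dots> = M * C * (1 + norm x) powr (- \<theta>)"
      using integral_heat_kernel_diff(2)[OF t2, of x]
      by (subst integral_lebesgue_eq_lborel) auto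
    finally show "norm (\<integral>y. heat_kernel t (x - y) *\<^sub>R f y \<partial>lebesgue) \<le> M * C * (1 + norm x) powr (- \<theta>)" .
  qed
qed

section \<open>The heat semigroup as an approximate identity\<close>

lemma heat_kernel_norm2_moment:
  fixes x :: "real^'n::finite"
  assumes "t > 0"
  shows "integrable lborel (\<lambda>y. heat_kernel t (x - y) * (norm (x - y))\<^sup>2)"
    and "(\<integral>y. heat_kernel t (x - y) * (norm (x - y))\<^sup>2 \<partial>lborel) = 2 * real CARD('n) * t"
proof -
  define g where "g z = heat_kernel t (z::real^'n) * (norm z)\<^sup>2" for z
  have gm: "g \<in> borel_measurable borel" unfolding g_def by measurable
  have "g = (\<lambda>z. \<Sum>i\<in>UNIV. heat_kernel t z * (z $ i * z $ i))"
    by (simp add: g_def fun_eq_iff norm_vec_def L2_set_def sum_nonneg power2_eq_square flip: sum_distrib_left)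
  then have g: "integrable lborel g" "(\<integral>z. g z \<partial>lborel) = 2 * real CARD('n) * t"
    using heat_kernel_second_moment[OF assms, where 'n='n] by simp_all
  then have "integrable (distr lborel borel (\<lambda>y. x - y)) g"
    "(\<integral>y. g y \<partial>distr lborel borel (\<lambda>y. x - y)) = 2 * real CARD('n) * t"
    unfolding lborel_distr_shift_reflect by auto
  then show "integrable lborel (\<lambda>y. heat_kernel t (x - y) * (norm (x - y))\<^sup>2)"
    "(\<integral>y. heat_kernel t (x - y) * (norm (x - y))\<^sup>2 \<partial>lborel) = 2 * real CARD('n) * t"
    using gm by (auto simp: integrable_distr_eq integral_distr g_def[symmetric])
qed

lemma integrable_heat_kernel_mult_bounded:
  fixes f :: "real^'n::finite \<Rightarrow> real"
  assumes "t > 0" "f \<in> borel_measurable borel" "\<And>y. \<bar>f y\<bar> \<le> B"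
  shows "integrable lborel (\<lambda>y. heat_kernel t (x - y) * f y)"
proof (rule Bochner_Integration.integrable_bound)
  show "integrable lborel (\<lambda>y. heat_kernel t (x - y) * B)"
    by (intro integrable_mult_left integral_heat_kernel_diff assms)
  have "\<bar>f y\<bar> \<le> \<bar>B\<bar>" for y using assms(3)[of y] by linarith
  then show "AE y in lborel. norm (heat_kernel t (x - y) * f y) \<le> norm (heat_kernel t (x - y) * B)"
    by (auto simp: abs_mult intro!: mult_left_mono)
qed (use assms in measurable)

text \<open>A Chebyshev argument: |g y - g x| \<le> e/2 + K |x - y|^2 for all y, by continuity near
  x and by boundedness elsewhere. Integration against the kernel gives e/2 + 2dKt.\<close>

lemma heat_pointwise_convergence:
  fixes g :: "real^'n::finite \<Rightarrow> real"
  assumes cont: "isCont g x" and gm: "g \<in> borel_measurable borel" and B: "\<And>y. \<bar>g y\<bar> \<le> B"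
  shows "((\<lambda>t. \<integral>y. heat_kernel t (x - y) * g y \<partial>lborel) \<longlongrightarrow> g x) (at_right 0)"
proof (rule tendstoI)
  fix e :: real assume e: "e > 0"
  obtain r where r: "r > 0" "\<And>y. dist y x < r \<Longrightarrow> dist (g y) (g x) < e / 2"
    using cont e unfolding continuous_at_eps_delta by (metis half_gt_zero)
  define K where "K = 2 * B / r\<^sup>2"
  have B0: "B \<ge> 0" using B[of x] by linarith
  have K: "K \<ge> 0" using B0 r by (simp add: K_def)
  have bound: "\<bar>g y - g x\<bar> \<le> e / 2 + K * (norm (x - y))\<^sup>2" for y
  proof (cases "dist y x < r")
    case True
    then have "\<bar>g y - g x\<bar> \<le> e / 2" using r(2)[of y] by (simp add: dist_real_def)
    then show ?thesis using K by (simp add: add_increasing2)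
  next
    case False
    then have "r\<^sup>2 \<le> (norm (x - y))\<^sup>2"
      using r by (intro power_mono) (auto simp: dist_norm norm_minus_commute)
    then have "2 * B \<le> K * (norm (x - y))\<^sup>2"
      using r B0 by (simp add: K_def divide_simps mult_left_mono)
    moreover have "\<bar>g y - g x\<bar> \<le> 2 * B" using B[of x] B[of y] by linarith
    ultimately show ?thesis using e by linarith
  qed
  have main: "\<bar>(\<integral>y. heat_kernel t (x - y) * g y \<partial>lborel) - g x\<bar> \<le> e / 2 + K * (2 * real CARD('n) * t)" if t: "t > 0" for t
  proof -
    note hk = integral_heat_kernel_diff[OF t, of x] heat_kernel_norm2_moment[OF t, of x]
    have i: "integrable lborel (\<lambda>y. heat_kernel t (x - y) * g y)"
      by (rule integrable_heat_kernel_mult_bounded[OF t gm B])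
    have "(\<integral>y. heat_kernel t (x - y) * g y \<partial>lborel) - g x = (\<integral>y. heat_kernel t (x - y) * g y - heat_kernel t (x - y) * g x \<partial>lborel)"
      using i hk by simp
    also have "\<bar>\<dots>\<bar> \<le> (\<integral>y. heat_kernel t (x - y) * (e / 2) + K * (heat_kernel t (x - y) * (norm (x - y))\<^sup>2) \<partial>lborel)"
      unfolding real_norm_def[symmetric]
    proof (rule norm_integral_le_AE)
      show "integrable lborel (\<lambda>y. heat_kernel t (x - y) * (e / 2) + K * (heat_kernel t (x - y) * (norm (x - y))\<^sup>2))"
        by (intro Bochner_Integration.integrable_add integrable_mult_left integrable_mult_right hk)
      show "AE y in lborel. norm (heat_kernel t (x - y) * g y - heat_kernel t (x - y) * g x) \<le>
          heat_kernel t (x - y) * (e / 2) + K * (heat_kernel t (x - y) * (norm (x - y))\<^sup>2)"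
      proof (rule AE_I2)
        fix y
        have "norm (heat_kernel t (x - y) * g y - heat_kernel t (x - y) * g x) = heat_kernel t (x - y) * \<bar>g y - g x\<bar>"
          by (simp add: abs_mult heat_kernel_nonneg flip: right_diff_distrib)
        also have "\<dots> \<le> heat_kernel t (x - y) * (e / 2 + K * (norm (x - y))\<^sup>2)"
          by (intro mult_left_mono bound heat_kernel_nonneg)
        finally show "norm (heat_kernel t (x - y) * g y - heat_kernel t (x - y) * g x) \<le>
          heat_kernel t (x - y) * (e / 2) + K * (heat_kernel t (x - y) * (norm (x - y))\<^sup>2)"
          by (simp add: distrib_left mult_ac)
      qed
    qed
    also have "\<dots> = e / 2 + K * (2 * real CARD('n) * t)"
      using hk by (subst Bochner_Integration.integral_add) auto
    finally show ?thesis .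
  qed
  have "((\<lambda>t. K * (2 * real CARD('n) * t)) \<longlongrightarrow> K * (2 * real CARD('n) * 0)) (at_right 0)"
    by (intro tendsto_intros)
  then have "eventually (\<lambda>t. K * (2 * real CARD('n) * t) < e / 2) (at_right 0)"
    by (rule order_tendstoD) (use e in simp)
  moreover have "eventually (\<lambda>t::real. t > 0) (at_right 0)" by (simp add: eventually_at_right_less)
  ultimately show "eventually (\<lambda>t. dist (\<integral>y. heat_kernel t (x - y) * g y \<partial>lborel) (g x) < e) (at_right 0)"
  proof eventually_elim
    case (elim t)
    then show ?case using main[of t] by (simp add: dist_real_def)
  qed
qed

text \<open>Fubini: integrated in x first, the kernel has mass one.\<close>

lemma heat_L1_contraction:
  fixes f :: "real^'n::finite \<Rightarrow> real"
  assumes t: "t > 0" and f: "integrable lborel f"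
  shows "integrable lborel (\<lambda>x. \<integral>y. heat_kernel t (x - y) * f y \<partial>lborel)"
    and "(\<integral>x. \<bar>\<integral>y. heat_kernel t (x - y) * f y \<partial>lborel\<bar> \<partial>lborel) \<le> (\<integral>y. \<bar>f y\<bar> \<partial>lborel)"
proof -
  define F where "F = (\<lambda>(y, x). heat_kernel t (x - y) * f y)"
  have [measurable]: "f \<in> borel_measurable borel" using f by auto
  have Fm: "F \<in> borel_measurable (lborel \<Otimes>\<^sub>M lborel)"
    unfolding F_def heat_kernel_def by measurable
  have i: "integrable lborel (\<lambda>x. F (y, x))" for y
    unfolding F_def case_prod_conv by (intro integrable_mult_left integral_heat_kernel_diff t)
  have n: "(\<integral>x. norm (F (y, x)) \<partial>lborel) = \<bar>f y\<bar>" for y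
    unfolding F_def case_prod_conv using integral_heat_kernel_diff[OF t, of y] by (simp add: abs_mult heat_kernel_nonneg)
  have FI: "integrable (lborel \<Otimes>\<^sub>M lborel) F"
    by (rule lborel_pair.integrable_pair_bound[OF Fm, where B = "\<lambda>y. \<bar>f y\<bar>"]) (use i n f in auto)
  then have FI': "integrable (lborel \<Otimes>\<^sub>M lborel) (\<lambda>(y, x). F (y, x))" by simp
  have FN: "integrable (lborel \<Otimes>\<^sub>M lborel) (\<lambda>(y, x). norm (F (y, x)))"
    using integrable_norm[OF FI] by (simp add: case_prod_unfold)
  show 1: "integrable lborel (\<lambda>x. \<integral>y. heat_kernel t (x - y) * f y \<partial>lborel)"
    using lborel_pair.integrable_snd[OF FI'] by (simp add: F_def)
  have "(\<integral>x. \<bar>\<integral>y. heat_kernel t (x - y) * f y \<partial>lborel\<bar> \<partial>lborel) \<le> (\<integral>x. (\<integral>y. norm (F (y, x)) \<partial>lborel) \<partial>lborel)"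
  proof (rule integral_mono)
    show "integrable lborel (\<lambda>x. \<integral>y. norm (F (y, x)) \<partial>lborel)"
      using lborel_pair.integrable_snd[OF FN] .
    show "\<bar>\<integral>y. heat_kernel t (x - y) * f y \<partial>lborel\<bar> \<le> (\<integral>y. norm (F (y, x)) \<partial>lborel)" for x
      using integral_norm_bound[of lborel "\<lambda>y. F (y, x)"] by (simp add: F_def)
  qed (use 1 in auto)
  also have "\<dots> = (\<integral>y. (\<integral>x. norm (F (y, x)) \<partial>lborel) \<partial>lborel)"
    by (rule lborel_pair.Fubini_integral[OF FN])
  finally show "(\<integral>x. \<bar>\<integral>y. heat_kernel t (x - y) * f y \<partial>lborel\<bar> \<partial>lborel) \<le> (\<integral>y. \<bar>f y\<bar> \<partial>lborel)"
    unfolding n .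
qed

lemma heat_L1_convergence_continuous:
  fixes g :: "real^'n::finite \<Rightarrow> real"
  assumes cont: "continuous_on UNIV g" and B: "B \<ge> 0" and g: "\<And>x. \<bar>g x\<bar> \<le> B * decay_weight x"
  shows "((\<lambda>t. \<integral>x. \<bar>(\<integral>y. heat_kernel t (x - y) * g y \<partial>lborel) - g x\<bar> \<partial>lborel) \<longlongrightarrow> 0) (at_right 0)"
proof -
  have gm [measurable]: "g \<in> borel_measurable borel"
    using cont by (intro borel_measurable_continuous_onI) auto
  obtain C where C: "C > 0"
    "\<And>(t::real) M x (f :: real^'n \<Rightarrow> real). 0 < t \<Longrightarrow> t \<le> 1 \<Longrightarrow> M \<ge> 0 \<Longrightarrow>
      (AE y in lebesgue. norm (f y) \<le> M * (1 + norm y) powr (- (real CARD('n) + 1))) \<Longrightarrow>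
      norm (\<integral>y. heat_kernel t (x - y) *\<^sub>R f y \<partial>lebesgue) \<le> M * C * (1 + norm x) powr (- (real CARD('n) + 1))"
    by (rule heat_decay_bound[of "real CARD('n) + 1", where 'n='n and 'b=real]) auto
  have HC: "\<bar>\<integral>y. heat_kernel t (x - y) * g y \<partial>lborel\<bar> \<le> B * C * decay_weight x" if t: "0 < t" "t \<le> 1" for t and x :: "real^'n"
  proof -
    have m: "(\<lambda>y. heat_kernel t (x - y) * g y) \<in> borel_measurable borel" by measurable
    show ?thesis
      using C(2)[OF t B, of g x] g unfolding real_scaleR_def integral_lebesgue_eq_lborel[OF m]
      by (simp add: decay_weight_def)
  qed
  have gB: "\<bar>g y\<bar> \<le> B" for y
    using g[of y] mult_left_mono[OF decay_weight_le_1[of y] B] by simp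
  \<comment> \<open>The time is written as 1/T, so that dominated convergence is applied along T
    tending to infinity.\<close>
  let ?s = "\<lambda>T x. \<bar>(\<integral>y. heat_kernel (inverse T) (x - y) * g y \<partial>lborel) - g x\<bar>"
  have "((\<lambda>T. \<integral>x. ?s T x \<partial>lborel) \<longlongrightarrow> (\<integral>x. 0 \<partial>(lborel :: (real^'n) measure))) at_top"
  proof (rule integral_dominated_convergence_at_top[where w = "\<lambda>x. B * C * decay_weight x + B * decay_weight x"])
    show "?s T \<in> borel_measurable lborel" for T
      unfolding heat_kernel_def by measurable
    show "integrable lborel (\<lambda>x::real^'n. B * C * decay_weight x + B * decay_weight x)"
      by (intro Bochner_Integration.integrable_add integrable_mult_right integrable_decay_weight)
    show "AE x in lborel. ((\<lambda>T. ?s T x) \<longlongrightarrow> 0) at_top"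
    proof (rule AE_I2)
      fix x
      have "isCont g x" using cont by (simp add: continuous_on_eq_continuous_at)
      then have "((\<lambda>t. \<integral>y. heat_kernel t (x - y) * g y \<partial>lborel) \<longlongrightarrow> g x) (at_right 0)"
        by (rule heat_pointwise_convergence[OF _ gm gB])
      then have "((\<lambda>T. \<integral>y. heat_kernel (inverse T) (x - y) * g y \<partial>lborel) \<longlongrightarrow> g x) at_top"
        by (simp add: filterlim_at_right_to_top)
      from tendsto_rabs[OF tendsto_diff[OF this tendsto_const[of "g x"]]]
      show "((\<lambda>T. ?s T x) \<longlongrightarrow> 0) at_top" by simp
    qed
    show "\<forall>\<^sub>F T in at_top. AE x in lborel. norm (?s T x) \<le> B * C * decay_weight x + B * decay_weight x"
      using eventually_ge_at_top[of "1::real"]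
    proof eventually_elim
      case (elim T)
      then have t: "0 < inverse T" "inverse T \<le> 1" by (auto simp: inverse_le_1_iff)
      have "norm (?s T x) \<le> B * C * decay_weight x + B * decay_weight x" for x
        using HC[OF t, of x] g[of x] abs_triangle_ineq4[of "\<integral>y. heat_kernel (inverse T) (x - y) * g y \<partial>lborel" "g x"]
        by (simp only: real_norm_def abs_abs)
      then show ?case by simp
    qed
  qed simp
  then show ?thesis
    unfolding filterlim_at_right_to_top by simp
qed

text \<open>Density in L^1: f is approximated by continuous functions under the same envelope, and
  the contraction property controls the heat flow of the error. The three contributions are e/3
  each.\<close>

lemma heat_L1_convergence:
  fixes f :: "real^'n::finite \<Rightarrow> real"
  assumes fm: "f \<in> borel_measurable lebesgue" and B: "B \<ge> 0"
    and f: "AE x in lebesgue. \<bar>f x\<bar> \<le> B * decay_weight x"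
  shows "t > 0 \<Longrightarrow> integrable lebesgue (\<lambda>x. \<bar>(\<integral>y. heat_kernel t (x - y) * f y \<partial>lebesgue) - f x\<bar>)"
    and "((\<lambda>t. \<integral>x. \<bar>(\<integral>y. heat_kernel t (x - y) * f y \<partial>lebesgue) - f x\<bar> \<partial>lebesgue) \<longlongrightarrow> 0) (at_right 0)"
proof -
  obtain f1 where f1 [measurable]: "f1 \<in> borel_measurable borel" "AE x in lborel. f x = f1 x"
    using completion_ex_borel_measurable_real[OF fm] by auto
  \<comment> \<open>Truncation to the envelope B * \<open>decay_weight\<close>. It turns the almost
    everywhere bound for f into one valid everywhere for a Borel version, and it keeps the
    continuous approximants dominated.\<close>
  define clamp where "clamp v x = max (- (B * decay_weight x)) (min (B * decay_weight x) v)" for v and x :: "real^'n"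
  have W: "0 \<le> B * decay_weight x" for x :: "real^'n"
    using B decay_weight_pos[of x] by simp
  have clamp: "\<bar>clamp v x\<bar> \<le> B * decay_weight x" for v x
    using W[of x] by (auto simp: clamp_def)
  have clamp_id: "clamp v x = v" if "\<bar>v\<bar> \<le> B * decay_weight x" for v x
    using that by (auto simp: clamp_def)
  define f2 where "f2 x = clamp (f1 x) x" for x
  have f2m [measurable]: "f2 \<in> borel_measurable borel"
    unfolding f2_def clamp_def by measurable
  have f2: "\<bar>f2 x\<bar> \<le> B * decay_weight x" for x unfolding f2_def by (rule clamp)
  have ff2: "AE x in lebesgue. f x = f2 x"
    using f AE_completion[OF f1(2)]
  proof eventually_elim
    case (elim x)
    then show ?case by (simp add: f2_def clamp_id)
  qed
  have integ: "integrable lborel v" if "v \<in> borel_measurable borel" "\<And>x. \<bar>v x\<bar> \<le> B * decay_weight x" for v :: "real^'n \<Rightarrow> real"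
  proof (rule Bochner_Integration.integrable_bound)
    show "integrable lborel (\<lambda>x::real^'n. B * decay_weight x)"
      by (intro integrable_mult_right integrable_decay_weight)
    show "AE x in lborel. norm (v x) \<le> norm (B * decay_weight x)"
      using that(2) by (intro AE_I2) (metis abs_ge_self order_trans real_norm_def)
  qed (use that in simp)
  define H where "H v t x = (\<integral>y. heat_kernel t (x - y) * v y \<partial>lborel)" for v t and x :: "real^'n"
  have Hf: "(\<integral>y. heat_kernel t (x - y) * f y \<partial>lebesgue) = H f2 t x" for t x
  proof -
    have "(\<integral>y. heat_kernel t (x - y) * f y \<partial>lebesgue) = (\<integral>y. heat_kernel t (x - y) * f2 y \<partial>lebesgue)"
    proof (rule integral_cong_AE)
      show "(\<lambda>y. heat_kernel t (x - y) * f y) \<in> borel_measurable lebesgue"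
        by (intro borel_measurable_times measurable_completion fm) measurable
      show "(\<lambda>y. heat_kernel t (x - y) * f2 y) \<in> borel_measurable lebesgue"
        by (intro measurable_completion) measurable
      show "AE y in lebesgue. heat_kernel t (x - y) * f y = heat_kernel t (x - y) * f2 y"
        using ff2 by eventually_elim simp
    qed
    also have "\<dots> = H f2 t x" unfolding H_def by (rule integral_lebesgue_eq_lborel) measurable
    finally show ?thesis .
  qed
  have Hint: "integrable lborel (H v t)" "(\<integral>x. \<bar>H v t x\<bar> \<partial>lborel) \<le> (\<integral>x. \<bar>v x\<bar> \<partial>lborel)"
    if "t > 0" "integrable lborel v" for v t
    unfolding H_def using heat_L1_contraction[OF that] by auto
  have f2i: "integrable lborel f2" by (rule integ[OF f2m f2])
  have dm: "(\<lambda>x. \<bar>(\<integral>y. heat_kernel t (x - y) * f y \<partial>lebesgue) - f x\<bar>) \<in> borel_measurable lebesgue" if "t > 0" for t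
  proof -
    have "H f2 t \<in> borel_measurable lebesgue"
      using Hint(1)[OF that f2i] by (intro measurable_completion) auto
    then show ?thesis unfolding Hf by (intro borel_measurable_abs borel_measurable_diff fm)
  qed
  have dm2: "(\<lambda>x. \<bar>H f2 t x - f2 x\<bar>) \<in> borel_measurable borel" if "t > 0" for t
    using Hint(1)[OF that f2i] by (intro borel_measurable_abs borel_measurable_diff f2m) auto
  have dAE: "AE x in lebesgue. \<bar>(\<integral>y. heat_kernel t (x - y) * f y \<partial>lebesgue) - f x\<bar> = \<bar>H f2 t x - f2 x\<bar>" for t
    using ff2 by eventually_elim (simp add: Hf)
  have di: "integrable lborel (\<lambda>x. \<bar>H f2 t x - f2 x\<bar>)" if "t > 0" for t
    by (intro integrable_abs Bochner_Integration.integrable_diff Hint that f2i)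
  show "integrable lebesgue (\<lambda>x. \<bar>(\<integral>y. heat_kernel t (x - y) * f y \<partial>lebesgue) - f x\<bar>)" if "t > 0"
    using integrable_cong_AE[OF dm[OF that] _ dAE] integrable_lebesgueI[OF di[OF that]] by auto
  have deq: "(\<integral>x. \<bar>(\<integral>y. heat_kernel t (x - y) * f y \<partial>lebesgue) - f x\<bar> \<partial>lebesgue) = (\<integral>x. \<bar>H f2 t x - f2 x\<bar> \<partial>lborel)" if "t > 0" for t
  proof -
    have "(\<integral>x. \<bar>(\<integral>y. heat_kernel t (x - y) * f y \<partial>lebesgue) - f x\<bar> \<partial>lebesgue) = (\<integral>x. \<bar>H f2 t x - f2 x\<bar> \<partial>lebesgue)"
      by (rule integral_cong_AE[OF dm[OF that] _ dAE]) (intro measurable_completion, use dm2[OF that] in simp)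
    also have "\<dots> = (\<integral>x. \<bar>H f2 t x - f2 x\<bar> \<partial>lborel)"
      by (rule integral_lebesgue_eq_lborel[OF dm2[OF that]])
    finally show ?thesis .
  qed
  \<comment> \<open>This notion of measurability supplies continuous functions converging to f2 off
    a null set; after truncation, dominated convergence upgrades this to L^1.\<close>
  have "f2 measurable_on UNIV"
    by (rule lebesgue_measurable_imp_measurable_on) (auto intro!: measurable_completion)
  then obtain N g where N: "negligible N" and g: "\<And>n. continuous_on UNIV (g n)"
    and lim: "\<And>x. x \<notin> N \<Longrightarrow> (\<lambda>n. g n x) \<longlonglongrightarrow> f2 x"
    unfolding measurable_on_def by auto
  define gc where "gc n x = clamp (g n x) x" for n :: nat and x
  have gcc: "continuous_on UNIV (gc n)" for n
    unfolding gc_def clamp_def decay_weight_def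
    by (intro continuous_intros g) (auto simp: add_nonneg_eq_0_iff)
  have gcm [measurable]: "gc n \<in> borel_measurable borel" for n
    using gcc by (intro borel_measurable_continuous_onI) auto
  have gcb: "\<bar>gc n x\<bar> \<le> B * decay_weight x" for n x unfolding gc_def by (rule clamp)
  have gci: "integrable lborel (gc n)" for n by (rule integ[OF gcm gcb])
  have "(\<lambda>n. \<integral>x. \<bar>gc n x - f2 x\<bar> \<partial>lborel) \<longlonglongrightarrow> (\<integral>x. 0 \<partial>(lborel :: (real^'n) measure))"
  proof (rule integral_dominated_convergence[where w = "\<lambda>x. 2 * (B * decay_weight x)"])
    show "integrable lborel (\<lambda>x::real^'n. 2 * (B * decay_weight x))"
      by (intro integrable_mult_right integrable_decay_weight)
    have "AE x in lebesgue. x \<notin> N"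
      using N by (auto simp: negligible_iff_null_sets intro: AE_not_in)
    then have "AE x in lborel. x \<notin> N" by (simp add: AE_completion_iff)
    then show "AE x in lborel. (\<lambda>n. \<bar>gc n x - f2 x\<bar>) \<longlonglongrightarrow> 0"
    proof eventually_elim
      case (elim x)
      have "(\<lambda>n. clamp (g n x) x) \<longlonglongrightarrow> clamp (f2 x) x"
        unfolding clamp_def by (intro tendsto_intros lim elim)
      then have "(\<lambda>n. gc n x) \<longlonglongrightarrow> f2 x"
        using clamp_id[OF f2[of x]] by (simp add: gc_def)
      from tendsto_rabs[OF tendsto_diff[OF this tendsto_const[of "f2 x"]]] show ?case by simp
    qed
    show "AE x in lborel. norm \<bar>gc n x - f2 x\<bar> \<le> 2 * (B * decay_weight x)" for n
    proof (rule AE_I2)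
      fix x
      show "norm \<bar>gc n x - f2 x\<bar> \<le> 2 * (B * decay_weight x)"
        using gcb[of n x] f2[of x] abs_triangle_ineq4[of "gc n x" "f2 x"] by simp
    qed
  qed auto
  then have approx: "(\<lambda>n. \<integral>x. \<bar>gc n x - f2 x\<bar> \<partial>lborel) \<longlonglongrightarrow> 0" by simp
  show "((\<lambda>t. \<integral>x. \<bar>(\<integral>y. heat_kernel t (x - y) * f y \<partial>lebesgue) - f x\<bar> \<partial>lebesgue) \<longlongrightarrow> 0) (at_right 0)"
  proof (rule tendstoI)
    fix e :: real assume e: "e > 0"
    have "eventually (\<lambda>n. (\<integral>x. \<bar>gc n x - f2 x\<bar> \<partial>lborel) < e / 3) sequentially"
      by (rule order_tendstoD[OF approx]) (use e in simp)
    then obtain n where n: "(\<integral>x. \<bar>gc n x - f2 x\<bar> \<partial>lborel) < e / 3"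
      by (auto simp: eventually_sequentially)
    have "eventually (\<lambda>t. (\<integral>x. \<bar>H (gc n) t x - gc n x\<bar> \<partial>lborel) < e / 3) (at_right 0)"
      unfolding H_def by (rule order_tendstoD[OF heat_L1_convergence_continuous[OF gcc B gcb]]) (use e in simp)
    moreover have "eventually (\<lambda>t::real. t > 0) (at_right 0)" by (simp add: eventually_at_right_less)
    ultimately show "eventually (\<lambda>t. dist (\<integral>x. \<bar>(\<integral>y. heat_kernel t (x - y) * f y \<partial>lebesgue) - f x\<bar> \<partial>lebesgue) 0 < e) (at_right 0)"
    proof eventually_elim
      case (elim t)
      then have t: "t > 0" by simp
      define h where "h x = f2 x - gc n x" for x
      have hi: "integrable lborel h" unfolding h_def by (intro Bochner_Integration.integrable_diff f2i gci)
      have Hh: "H f2 t x = H h t x + H (gc n) t x" for x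
      proof -
        have b: "\<bar>v y\<bar> \<le> B" if "\<And>x. \<bar>v x\<bar> \<le> B * decay_weight x" for v :: "real^'n \<Rightarrow> real" and y
          using that[of y] mult_left_mono[OF decay_weight_le_1[of y] B] by simp
        have "integrable lborel (\<lambda>y. heat_kernel t (x - y) * f2 y)" "integrable lborel (\<lambda>y. heat_kernel t (x - y) * gc n y)"
          by (intro integrable_heat_kernel_mult_bounded[OF t _ b] f2m gcm f2 gcb)+
        then show ?thesis by (simp add: H_def h_def right_diff_distrib)
      qed
      have i: "integrable lborel (\<lambda>x. \<bar>H h t x\<bar>)" "integrable lborel (\<lambda>x. \<bar>H (gc n) t x - gc n x\<bar>)" "integrable lborel (\<lambda>x. \<bar>h x\<bar>)"
        by (intro integrable_abs Bochner_Integration.integrable_diff Hint(1) t hi gci)+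
      have "(\<integral>x. \<bar>H f2 t x - f2 x\<bar> \<partial>lborel) \<le> (\<integral>x. \<bar>H h t x\<bar> + \<bar>H (gc n) t x - gc n x\<bar> + \<bar>h x\<bar> \<partial>lborel)"
      proof (rule integral_mono)
        show "integrable lborel (\<lambda>x. \<bar>H h t x\<bar> + \<bar>H (gc n) t x - gc n x\<bar> + \<bar>h x\<bar>)"
          by (intro Bochner_Integration.integrable_add i)
        show "\<bar>H f2 t x - f2 x\<bar> \<le> \<bar>H h t x\<bar> + \<bar>H (gc n) t x - gc n x\<bar> + \<bar>h x\<bar>" for x
          unfolding Hh h_def by linarith
      qed (rule di[OF t])
      also have "\<dots> = (\<integral>x. \<bar>H h t x\<bar> \<partial>lborel) + (\<integral>x. \<bar>H (gc n) t x - gc n x\<bar> \<partial>lborel) + (\<integral>x. \<bar>h x\<bar> \<partial>lborel)"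
        using i by simp
      also have "\<dots> < e"
      proof -
        have "(\<integral>x. \<bar>h x\<bar> \<partial>lborel) < e / 3" using n by (simp add: h_def abs_minus_commute)
        then show ?thesis using Hint(2)[OF t hi] elim by linarith
      qed
      finally have "(\<integral>x. \<bar>H f2 t x - f2 x\<bar> \<partial>lborel) < e" .
      moreover have "0 \<le> (\<integral>x. \<bar>H f2 t x - f2 x\<bar> \<partial>lborel)" by simp
      ultimately show ?case unfolding deq[OF t] by (simp add: dist_real_def)
    qed
  qed
qed

section \<open>The Duhamel term\<close>

lemma integrable_vecI:
  fixes f :: "'a \<Rightarrow> real^'n::finite"
  assumes "\<And>j. integrable M (\<lambda>x. f x $ j)"
  shows "integrable M f" and "(\<integral>x. f x \<partial>M) $ j = (\<integral>x. f x $ j \<partial>M)"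
proof -
  have "integrable M (\<lambda>x. \<Sum>j\<in>UNIV. f x $ j *\<^sub>R (axis j 1 :: real^'n))"
    by (intro Bochner_Integration.integrable_sum integrable_scaleR_left assms)
  moreover have "(\<Sum>j\<in>UNIV. f x $ j *\<^sub>R (axis j 1 :: real^'n)) = f x" for x
    using basis_expansion[of "f x"] by (simp add: scalar_mult_eq_scaleR)
  ultimately show 1: "integrable M f" by simp
  show "(\<integral>x. f x \<partial>M) $ j = (\<integral>x. f x $ j \<partial>M)"
    by (rule integral_bounded_linear[OF bounded_linear_vec_nth 1, symmetric])
qed

lemma AE_lebesgue_neq: "AE y in lebesgue. y \<noteq> (x :: 'a::euclidean_space)"
  by (intro AE_completion AE_lborel_singleton)

text \<open>Young's inequality for a bounded factor and an integrable kernel: the Poisson majorant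
  has integral of order \<tau>^(-1/2), and by translation invariance K does not depend on x.\<close>

lemma oseen_convolution:
  assumes n: "CARD('n::finite) \<ge> 2"
  obtains K where "K > 0"
    "\<And>\<tau> B x h k j v. \<tau> > 0 \<Longrightarrow> B \<ge> 0 \<Longrightarrow> v \<in> borel_measurable lebesgue \<Longrightarrow> (AE y in lebesgue. \<bar>v y\<bar> \<le> B) \<Longrightarrow>
      integrable lebesgue (\<lambda>y::real^'n. v y * oseen_kernel \<tau> h k (x - y) $ j) \<and>
      (\<integral>y. \<bar>v y * oseen_kernel \<tau> h k (x - y) $ j\<bar> \<partial>lebesgue) \<le> B * K * \<tau> powr (- 1/2)"
proof -
  obtain C where C: "C > 0"
    "\<And>t j h k (x::real^'n). t > 0 \<Longrightarrow> \<bar>oseen_kernel t h k x $ j\<bar> \<le> C * (t + (norm x)\<^sup>2) powr (- ((real CARD('n) + 1) / 2))"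
    by (rule oseen_kernel_bound[OF n]) blast
  obtain P where P: "P > 0"
    "\<And>t x::real^'n. t > 0 \<Longrightarrow> integrable lborel (\<lambda>y. (t + (norm (x - y))\<^sup>2) powr (- ((real CARD('n) + 1) / 2)))"
    "\<And>t x::real^'n. t > 0 \<Longrightarrow> (\<integral>y. (t + (norm (x - y))\<^sup>2) powr (- ((real CARD('n) + 1) / 2)) \<partial>lborel) = P * t powr (- 1/2)"
    by (rule poisson_kernel_integral[where 'n='n]) blast
  show thesis
  proof (rule that[of "C * P"])
    show "C * P > 0" using C P by simp
    fix \<tau> B :: real and x :: "real^'n" and h k j and v :: "real^'n \<Rightarrow> real"
    assume \<tau>: "\<tau> > 0" and B: "B \<ge> 0" and vm: "v \<in> borel_measurable lebesgue" and v: "AE y in lebesgue. \<bar>v y\<bar> \<le> B"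
    let ?w = "\<lambda>y. B * (C * (\<tau> + (norm (x - y))\<^sup>2) powr (- ((real CARD('n) + 1) / 2)))"
    have w: "integrable lebesgue ?w"
      by (intro integrable_mult_right integrable_lebesgueI P \<tau>)
    have le: "AE y in lebesgue. norm (v y * oseen_kernel \<tau> h k (x - y) $ j) \<le> ?w y"
      using v
    proof eventually_elim
      case (elim y)
      then show ?case
        unfolding real_norm_def abs_mult using C B \<tau> by (intro mult_mono) auto
    qed
    have "(\<lambda>y. oseen_kernel \<tau> h k (x - y) $ j) \<in> borel_measurable borel"
      by (rule measurable_compose[OF _ oseen_kernel_measurable[OF n \<tau>]]) measurable
    then have m: "(\<lambda>y. oseen_kernel \<tau> h k (x - y) $ j) \<in> borel_measurable lebesgue"
      by (intro measurable_completion) simp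
    have i: "integrable lebesgue (\<lambda>y. v y * oseen_kernel \<tau> h k (x - y) $ j)"
    proof (rule Bochner_Integration.integrable_bound[OF w])
      show "(\<lambda>y. v y * oseen_kernel \<tau> h k (x - y) $ j) \<in> borel_measurable lebesgue"
        by (intro borel_measurable_times vm m)
      show "AE y in lebesgue. norm (v y * oseen_kernel \<tau> h k (x - y) $ j) \<le> norm (?w y)"
        using le
      proof eventually_elim
        case (elim y)
        then show ?case by (rule order_trans) simp
      qed
    qed
    have "(\<integral>y. \<bar>v y * oseen_kernel \<tau> h k (x - y) $ j\<bar> \<partial>lebesgue) \<le> (\<integral>y. ?w y \<partial>lebesgue)"
      using le by (intro integral_mono_AE integrable_abs i w) simp
    also have "\<dots> = (\<integral>y. ?w y \<partial>lborel)"
      by (rule integral_lebesgue_eq_lborel) measurable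
    also have "\<dots> = B * (C * P) * \<tau> powr (- 1/2)"
      using P(3)[OF \<tau>, of x] by simp
    finally show "integrable lebesgue (\<lambda>y. v y * oseen_kernel \<tau> h k (x - y) $ j) \<and>
      (\<integral>y. \<bar>v y * oseen_kernel \<tau> h k (x - y) $ j\<bar> \<partial>lebesgue) \<le> B * (C * P) * \<tau> powr (- 1/2)"
      using i by blast
  qed
qed

lemma heat_leray_div_nth:
  fixes V :: "real^'n::finite \<Rightarrow> real^'n^'n"
  assumes n: "CARD('n) \<ge> 2" and \<tau>: "\<tau> > 0" and B: "B \<ge> 0"
    and Vm: "\<And>h k. (\<lambda>y. V y $ h $ k) \<in> borel_measurable lebesgue"
    and V: "\<And>h k. AE y in lebesgue. \<bar>V y $ h $ k\<bar> \<le> B"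
  shows "heat_leray_div \<tau> V x $ j =
    (\<Sum>h\<in>UNIV. \<Sum>k\<in>UNIV. \<integral>y. V y $ h $ k * oseen_kernel \<tau> h k (x - y) $ j \<partial>lebesgue)"
proof -
  obtain K where "\<And>\<tau> B x h k j v. \<tau> > 0 \<Longrightarrow> B \<ge> 0 \<Longrightarrow> v \<in> borel_measurable lebesgue \<Longrightarrow> (AE y in lebesgue. \<bar>v y\<bar> \<le> B) \<Longrightarrow>
      integrable lebesgue (\<lambda>y::real^'n. v y * oseen_kernel \<tau> h k (x - y) $ j) \<and>
      (\<integral>y. \<bar>v y * oseen_kernel \<tau> h k (x - y) $ j\<bar> \<partial>lebesgue) \<le> B * K * \<tau> powr (- 1/2)"
    by (rule oseen_convolution[OF n]) blast
  then have i: "integrable lebesgue (\<lambda>y. (V y $ h $ k *\<^sub>R oseen_kernel \<tau> h k (x - y)) $ l)" for h k l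
    using \<tau> B Vm V by simp
  have "(LINT y|lebesgue. V y $ h $ k *\<^sub>R oseen_kernel \<tau> h k (x - y)) $ j =
     (\<integral>y. V y $ h $ k * oseen_kernel \<tau> h k (x - y) $ j \<partial>lebesgue)" for h k
    using integrable_vecI(2)[OF i, of h k j] by simp
  then show ?thesis unfolding heat_leray_div_def by simp
qed

text \<open>The integral of s^(-1/2) over the interval, reflected by s to t - s.\<close>

lemma integral_time_singularity:
  fixes t :: real
  assumes "t > 0"
  shows "set_integrable lborel {0<..<t} (\<lambda>s. (t - s) powr (- 1/2))"
    and "(LINT s:{0<..<t}|lborel. (t - s) powr (- 1/2)) = 2 * sqrt t"
proof -
  let ?f = "\<lambda>s. indicator {0<..<t} s * s powr (- 1/2)"
  have "((\<lambda>s. s powr (- 1/2)) has_integral t powr (- 1/2 + 1) / (- 1/2 + 1)) {0..t}"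
    by (rule has_integral_powr_from_0) (use assms in auto)
  then have h: "((\<lambda>s. s powr (- 1/2)) has_integral 2 * sqrt t) {0<..<t}"
    using assms by (simp add: has_integral_Icc_iff_Ioo powr_half_sqrt mult.commute)
  then have "set_integrable lebesgue {0<..<t} (\<lambda>s. s powr (- 1/2))"
    by (intro nonnegative_absolutely_integrable_1) (auto simp: has_integral_iff)
  moreover from this have "(LINT s:{0<..<t}|lebesgue. s powr (- 1/2)) = 2 * sqrt t"
    using h by (simp add: set_lebesgue_integral_eq_integral(2) integral_unique)
  moreover have m: "(\<lambda>s::real. s powr (- 1/2)) \<in> borel_measurable borel" by measurable
  ultimately have "set_integrable lborel {0<..<t} (\<lambda>s. s powr (- 1/2))"
    "(LINT s:{0<..<t}|lborel. s powr (- 1/2)) = 2 * sqrt t"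
    by (simp_all add: set_integrable_lborel_iff_lebesgue)
  then have f: "integrable lborel ?f" "(\<integral>s. ?f s \<partial>lborel) = 2 * sqrt t"
    by (simp_all add: set_integrable_def set_lebesgue_integral_def)
  have "?f (t + (-1) * s) = indicator {0<..<t} s * (t - s) powr (- 1/2)" for s
    by (auto simp: indicator_def)
  moreover have "integrable lborel (\<lambda>s. ?f (t + (-1) * s))"
    by (rule lborel_integrable_real_affine[OF f(1)]) simp
  moreover have "(\<integral>s. ?f (t + (-1) * s) \<partial>lborel) = 2 * sqrt t"
    using lborel_integral_real_affine[of "-1" ?f t] f(2) by simp
  ultimately have "integrable lborel (\<lambda>s. indicator {0<..<t} s * (t - s) powr (- 1/2))"
    "(\<integral>s. indicator {0<..<t} s * (t - s) powr (- 1/2) \<partial>lborel) = 2 * sqrt t"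
    by (simp_all only:)
  then show "set_integrable lborel {0<..<t} (\<lambda>s. (t - s) powr (- 1/2))"
    "(LINT s:{0<..<t}|lborel. (t - s) powr (- 1/2)) = 2 * sqrt t"
    by (simp_all add: set_integrable_def set_lebesgue_integral_def)
qed

section \<open>Pointwise form of the weighted norms; Duhamel's formula by components\<close>

lemma Linf_norm_AE:
  fixes f :: "real^'n::finite \<Rightarrow> real^'n"
  shows "AE x in lebesgue. ereal (norm (f x)) \<le> Linf_norm \<theta> f * ereal ((1 + norm x) powr (- \<theta>))"
proof -
  have "AE x in lebesgue. ereal ((1 + norm x) powr \<theta> * norm (f x)) \<le> Linf_norm \<theta> f"
    unfolding Linf_norm_def by (rule esssup_AE)
  then show ?thesis
  proof eventually_elim
    case (elim x)
    have p: "1 + norm x > 0" by (simp add: add_pos_nonneg)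
    have "ereal ((1 + norm x) powr \<theta> * norm (f x)) * ereal ((1 + norm x) powr (- \<theta>)) \<le> Linf_norm \<theta> f * ereal ((1 + norm x) powr (- \<theta>))"
      by (rule ereal_mult_right_mono[OF elim]) simp
    moreover have "(1 + norm x) powr \<theta> * (1 + norm x) powr (- \<theta>) = 1"
      using p by (simp flip: powr_add)
    then have "(1 + norm x) powr \<theta> * norm (f x) * (1 + norm x) powr (- \<theta>) = norm (f x)"
      by (metis mult.assoc mult.commute mult.right_neutral)
    ultimately show ?case by simp
  qed
qed

lemma Linf_norm_le_AE:
  fixes f :: "real^'n::finite \<Rightarrow> real^'n"
  assumes "Linf_norm \<theta> f \<le> ereal M"
  shows "AE x in lebesgue. norm (f x) \<le> M * (1 + norm x) powr (- \<theta>)"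
  using Linf_norm_AE[of f \<theta>]
proof eventually_elim
  case (elim x)
  also have "Linf_norm \<theta> f * ereal ((1 + norm x) powr (- \<theta>)) \<le> ereal M * ereal ((1 + norm x) powr (- \<theta>))"
    by (rule ereal_mult_right_mono[OF assms]) simp
  finally show ?case by simp
qed

text \<open>One constant M serves the datum and all times of the solution, and the weighted norms
  appear as pointwise bounds almost everywhere. Only the continuity in time stays in norm form; it
  is there to make the Duhamel integrand measurable in time.\<close>

locale decaying_mild_solution =
  fixes a :: "real^'n::finite \<Rightarrow> real^'n" and u :: "real \<Rightarrow> real^'n \<Rightarrow> real^'n" and \<theta> T M :: real
  assumes dim: "CARD('n) \<ge> 2"
    and theta: "\<theta> > real CARD('n) + 1"
    and T: "T > 0"
    and M: "M > 0"
    and a_meas: "a \<in> borel_measurable lebesgue"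
    and a_bound: "AE y in lebesgue. norm (a y) \<le> M * (1 + norm y) powr (- \<theta>)"
    and u_meas: "s \<in> {0..T} \<Longrightarrow> u s \<in> borel_measurable lebesgue"
    and u_bound: "s \<in> {0..T} \<Longrightarrow> AE y in lebesgue. norm (u s y) \<le> M * decay_weight y"
    and u_cont: "s \<in> {0<..T} \<Longrightarrow>
      ((\<lambda>r. Linf_norm (real CARD('n) + 1) (\<lambda>x. u r x - u s x)) \<longlongrightarrow> 0) (at s within {0<..T})"
    and mild: "mild_solution T a u"
begin

definition quad :: "'n \<Rightarrow> 'n \<Rightarrow> real \<Rightarrow> real^'n \<Rightarrow> real" where
  "quad h k s y = u s y $ h * u s y $ k"

definition duhamel :: "real \<Rightarrow> 'n \<Rightarrow> real^'n \<Rightarrow> real \<Rightarrow> real" where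
  "duhamel t j x s = heat_leray_div (t - s) (\<lambda>y. tensor (u s y) (u s y)) x $ j"

lemma quad_meas: "s \<in> {0..T} \<Longrightarrow> quad h k s \<in> borel_measurable lebesgue"
  unfolding quad_def
proof -
  assume s: "s \<in> {0..T}"
  have nth: "(\<lambda>v::real^'n. v $ l) \<in> borel_measurable borel" for l by measurable
  show "(\<lambda>y. u s y $ h * u s y $ k) \<in> borel_measurable lebesgue"
    by (intro borel_measurable_times measurable_compose[OF u_meas[OF s] nth])
qed

lemma quad_bound:
  assumes "s \<in> {0..T}"
  shows "AE y in lebesgue. \<bar>quad h k s y\<bar> \<le> M\<^sup>2 * (decay_weight y)\<^sup>2"
  using u_bound[OF assms]
proof eventually_elim
  case (elim y)
  have "\<bar>u s y $ l\<bar> \<le> M * decay_weight y" for l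
    using component_le_norm_cart[of "u s y" l] elim by simp
  then have "\<bar>quad h k s y\<bar> \<le> (M * decay_weight y) * (M * decay_weight y)"
    unfolding quad_def abs_mult using M decay_weight_pos[of y] by (intro mult_mono) auto
  then show ?case by (simp add: power2_eq_square mult_ac)
qed

lemma quad_bound_const:
  assumes "s \<in> {0..T}"
  shows "AE y in lebesgue. \<bar>quad h k s y\<bar> \<le> M\<^sup>2"
  using quad_bound[OF assms, of h k]
proof eventually_elim
  case (elim y)
  have "(decay_weight y)\<^sup>2 \<le> 1"
    using decay_weight_pos[of y] decay_weight_le_1[of y] by (intro power_le_one) auto
  then have "M\<^sup>2 * (decay_weight y)\<^sup>2 \<le> M\<^sup>2 * 1"
    by (intro mult_left_mono) auto
  with elim show ?case by simp
qed

lemma duhamel_eq: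
  assumes "s \<in> {0..T}" "s < t"
  shows "duhamel t j x s =
    (\<Sum>h\<in>UNIV. \<Sum>k\<in>UNIV. \<integral>y. quad h k s y * oseen_kernel (t - s) h k (x - y) $ j \<partial>lebesgue)"
proof -
  have *: "tensor (u s y) (u s y) $ h $ k = quad h k s y" for h k y
    by (simp add: tensor_def quad_def)
  show ?thesis
    unfolding duhamel_def
    by (subst heat_leray_div_nth[OF dim, where B = "M\<^sup>2"])
      (use assms quad_meas quad_bound_const in \<open>simp_all add: *\<close>)
qed

lemma duhamel_bound:
  obtains K where "K > 0"
    "\<And>s t j x. s \<in> {0..T} \<Longrightarrow> s < t \<Longrightarrow> \<bar>duhamel t j x s\<bar> \<le> K * (t - s) powr (- 1/2)"
proof -
  obtain K where K: "K > 0" "\<And>\<tau> B x h k j v. \<tau> > 0 \<Longrightarrow> B \<ge> 0 \<Longrightarrow> v \<in> borel_measurable lebesgue \<Longrightarrow> (AE y in lebesgue. \<bar>v y\<bar> \<le> B) \<Longrightarrow>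
      integrable lebesgue (\<lambda>y::real^'n. v y * oseen_kernel \<tau> h k (x - y) $ j) \<and>
      (\<integral>y. \<bar>v y * oseen_kernel \<tau> h k (x - y) $ j\<bar> \<partial>lebesgue) \<le> B * K * \<tau> powr (- 1/2)"
    by (rule oseen_convolution[OF dim]) blast
  show thesis
  proof (rule that[of "real CARD('n) * (real CARD('n) * (M\<^sup>2 * K))"])
    show "real CARD('n) * (real CARD('n) * (M\<^sup>2 * K)) > 0" using K M by simp
    fix s t j x assume s: "s \<in> {0..T}" "s < t"
    have 1: "\<bar>\<integral>y. quad h k s y * oseen_kernel (t - s) h k (x - y) $ j \<partial>lebesgue\<bar> \<le> M\<^sup>2 * K * (t - s) powr (- 1/2)" for h k
    proof -
      have "\<bar>\<integral>y. quad h k s y * oseen_kernel (t - s) h k (x - y) $ j \<partial>lebesgue\<bar> \<le>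
          (\<integral>y. \<bar>quad h k s y * oseen_kernel (t - s) h k (x - y) $ j\<bar> \<partial>lebesgue)"
        using integral_norm_bound[of lebesgue "\<lambda>y. quad h k s y * oseen_kernel (t - s) h k (x - y) $ j"]
        by (simp only: real_norm_def)
      also have "\<dots> \<le> M\<^sup>2 * K * (t - s) powr (- 1/2)"
        using K(2)[of "t - s" "M\<^sup>2" "quad h k s" h k x j] s quad_meas[OF s(1)] quad_bound_const[OF s(1)] by simp
      finally show ?thesis .
    qed
    have "\<bar>duhamel t j x s\<bar> \<le> (\<Sum>h\<in>(UNIV::'n set). \<Sum>k\<in>(UNIV::'n set). M\<^sup>2 * K * (t - s) powr (- 1/2))"
      unfolding duhamel_eq[OF s]
      by (intro order_trans[OF sum_abs] sum_mono order_trans[OF sum_abs] 1)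
    then show "\<bar>duhamel t j x s\<bar> \<le> real CARD('n) * (real CARD('n) * (M\<^sup>2 * K)) * (t - s) powr (- 1/2)"
      by simp
  qed
qed

text \<open>The exceptional null set of a norm bound depends on the time. Along a sequence only
  countably many such sets have to be united.\<close>

lemma u_seq_tendsto:
  assumes s: "s \<in> {0<..T}" and X: "\<And>i. X i \<in> {0<..T}" "\<And>i. X i \<noteq> s" "X \<longlonglongrightarrow> s"
  shows "AE y in lebesgue. (\<lambda>i. u (X i) y) \<longlonglongrightarrow> u s y"
proof -
  define L where "L i = Linf_norm (real CARD('n) + 1) (\<lambda>x. u (X i) x - u s x)" for i
  have L: "L \<longlonglongrightarrow> 0"
    using u_cont[OF s] X unfolding tendsto_at_iff_sequentially L_def comp_def by blast
  have "AE y in lebesgue. \<forall>i. ereal (norm (u (X i) y - u s y)) \<le> L i * ereal (decay_weight y)"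
    unfolding AE_all_countable
  proof
    fix i
    show "AE y in lebesgue. ereal (norm (u (X i) y - u s y)) \<le> L i * ereal (decay_weight y)"
      unfolding L_def decay_weight_def
      by (rule Linf_norm_AE[of "\<lambda>x. u (X i) x - u s x" "real CARD('n) + 1"])
  qed
  then show ?thesis
  proof eventually_elim
    case (elim y)
    have "(\<lambda>i. L i * ereal (decay_weight y)) \<longlonglongrightarrow> 0 * ereal (decay_weight y)"
      by (intro tendsto_mult_ereal L tendsto_const) auto
    then have "(\<lambda>i. L i * ereal (decay_weight y)) \<longlonglongrightarrow> 0" by simp
    then have "(\<lambda>i. ereal (norm (u (X i) y - u s y))) \<longlonglongrightarrow> 0"
      by (rule tendsto_sandwich[rotated 3, where f = "\<lambda>_. 0"]) (use elim in auto)
    then have "(\<lambda>i. norm (u (X i) y - u s y)) \<longlonglongrightarrow> 0"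
      by (simp add: zero_ereal_def)
    then show ?case by (simp add: LIM_zero_iff tendsto_norm_zero_iff)
  qed
qed

text \<open>Continuity in s is what yields measurability of the time integrand. Along a sequence of
  times the velocities converge almost everywhere and the kernel converges for y \<noteq> x, so
  dominated convergence applies.\<close>

lemma duhamel_isCont:
  assumes t: "0 < t" "t \<le> T" and s: "0 < s" "s < t"
  shows "isCont (duhamel t j x) s"
proof -
  \<comment> \<open>Stopping halfway keeps t - s above a positive number, so that one Poisson kernel
    dominates the kernels at all nearby times.\<close>
  define t' where "t' = (s + t) / 2"
  have t': "s < t'" "t' < t" using s by (auto simp: t'_def)
  obtain C where C: "C > 0"
    "\<And>t j h k (x::real^'n). t > 0 \<Longrightarrow> \<bar>oseen_kernel t h k x $ j\<bar> \<le> C * (t + (norm x)\<^sup>2) powr (- ((real CARD('n) + 1) / 2))"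
    by (rule oseen_kernel_bound[OF dim]) blast
  obtain P where P: "\<And>t x::real^'n. t > 0 \<Longrightarrow> integrable lborel (\<lambda>y. (t + (norm (x - y))\<^sup>2) powr (- ((real CARD('n) + 1) / 2)))"
    by (rule poisson_kernel_integral[where 'n='n]) blast
  have "((duhamel t j x) \<longlongrightarrow> duhamel t j x s) (at s within {0<..<t'})"
    unfolding tendsto_at_iff_sequentially comp_def
  proof (intro allI impI)
    fix X assume X: "\<forall>i. X i \<in> {0<..<t'} - {s}" "X \<longlonglongrightarrow> s"
    have Xi: "X i \<in> {0..T}" "X i \<in> {0<..T}" "X i < t" "X i \<noteq> s" "t - X i > t - t'" for i
      using X(1)[rule_format, of i] t t' by auto
    have ss: "s \<in> {0..T}" "s \<in> {0<..T}" using s t by auto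
    have "(\<lambda>i. \<integral>y. quad h k (X i) y * oseen_kernel (t - X i) h k (x - y) $ j \<partial>lebesgue)
        \<longlonglongrightarrow> (\<integral>y. quad h k s y * oseen_kernel (t - s) h k (x - y) $ j \<partial>lebesgue)" for h k
    proof (rule integral_dominated_convergence[where w = "\<lambda>y. M\<^sup>2 * (C * ((t - t') + (norm (x - y))\<^sup>2) powr (- ((real CARD('n) + 1) / 2)))"])
      have km: "(\<lambda>y. oseen_kernel \<tau> h k (x - y) $ j) \<in> borel_measurable lebesgue" if "\<tau> > 0" for \<tau>
        by (intro measurable_completion measurable_compose[OF _ oseen_kernel_measurable[OF dim that]]) simp
      show "(\<lambda>y. quad h k s y * oseen_kernel (t - s) h k (x - y) $ j) \<in> borel_measurable lebesgue"
        using s by (intro borel_measurable_times quad_meas ss km) auto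
      show "(\<lambda>y. quad h k (X i) y * oseen_kernel (t - X i) h k (x - y) $ j) \<in> borel_measurable lebesgue" for i
        using Xi[of i] by (intro borel_measurable_times quad_meas km) auto
      show "integrable lebesgue (\<lambda>y. M\<^sup>2 * (C * ((t - t') + (norm (x - y))\<^sup>2) powr (- ((real CARD('n) + 1) / 2))))"
        using t' by (intro integrable_mult_right integrable_lebesgueI P) auto
      show "AE y in lebesgue. (\<lambda>i. quad h k (X i) y * oseen_kernel (t - X i) h k (x - y) $ j)
          \<longlonglongrightarrow> quad h k s y * oseen_kernel (t - s) h k (x - y) $ j"
        using u_seq_tendsto[OF ss(2) Xi(2,4) X(2)] AE_lebesgue_neq[of x]
      proof eventually_elim
        case (elim y)
        have "(\<lambda>i. quad h k (X i) y) \<longlonglongrightarrow> quad h k s y"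
          unfolding quad_def by (intro tendsto_intros elim)
        moreover have "(\<lambda>i. oseen_kernel (t - X i) h k (x - y) $ j) \<longlonglongrightarrow> oseen_kernel (t - s) h k (x - y) $ j"
        proof (rule continuous_on_tendsto_compose[OF continuous_on_oseen_kernel_time[OF dim]])
          show "(\<lambda>i. t - X i) \<longlonglongrightarrow> t - s" by (intro tendsto_intros X(2))
        qed (use elim s Xi(3) in auto)
        ultimately show ?case by (rule tendsto_mult)
      qed
      show "AE y in lebesgue. norm (quad h k (X i) y * oseen_kernel (t - X i) h k (x - y) $ j)
          \<le> M\<^sup>2 * (C * ((t - t') + (norm (x - y))\<^sup>2) powr (- ((real CARD('n) + 1) / 2)))" for i
        using quad_bound_const[OF Xi(1)[of i], of h k]
      proof eventually_elim
        case (elim y)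
        have "(t - X i + (norm (x - y))\<^sup>2) powr (- ((real CARD('n) + 1) / 2)) \<le> ((t - t') + (norm (x - y))\<^sup>2) powr (- ((real CARD('n) + 1) / 2))"
          using Xi(5)[of i] t' by (intro powr_mono2') (auto intro: add_pos_nonneg)
        then have "\<bar>oseen_kernel (t - X i) h k (x - y) $ j\<bar> \<le> C * ((t - t') + (norm (x - y))\<^sup>2) powr (- ((real CARD('n) + 1) / 2))"
          using C Xi(3)[of i] by (intro order_trans[OF C(2)] mult_left_mono) auto
        then show ?case
          unfolding real_norm_def abs_mult using elim by (intro mult_mono) auto
      qed
    qed
    then have "(\<lambda>i. \<Sum>h\<in>UNIV. \<Sum>k\<in>UNIV. \<integral>y. quad h k (X i) y * oseen_kernel (t - X i) h k (x - y) $ j \<partial>lebesgue)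
      \<longlonglongrightarrow> (\<Sum>h\<in>UNIV. \<Sum>k\<in>UNIV. \<integral>y. quad h k s y * oseen_kernel (t - s) h k (x - y) $ j \<partial>lebesgue)"
      by (intro tendsto_sum)
    then show "(\<lambda>i. duhamel t j x (X i)) \<longlonglongrightarrow> duhamel t j x s"
      using Xi(1,3) ss(1) s(2) by (simp add: duhamel_eq)
  qed
  moreover have "at s within {0<..<t'} = at s"
    using s t' by (intro at_within_open) auto
  ultimately show ?thesis by (simp add: isCont_def)
qed

lemma duhamel_integrable:
  assumes t: "0 < t" "t \<le> T"
  shows "set_integrable lborel {0<..<t} (duhamel t j x)"
proof -
  obtain K where K: "\<And>s t j x. s \<in> {0..T} \<Longrightarrow> s < t \<Longrightarrow> \<bar>duhamel t j x s\<bar> \<le> K * (t - s) powr (- 1/2)"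
    by (rule duhamel_bound) blast
  show ?thesis
  proof (rule set_integrable_bound)
    show "set_integrable lborel {0<..<t} (\<lambda>s. K * (t - s) powr (- 1/2))"
      using integral_time_singularity(1)[OF t(1)] by simp
    have "continuous_on {0<..<t} (duhamel t j x)"
      using t by (intro continuous_at_imp_continuous_on ballI duhamel_isCont) auto
    then have "(\<lambda>s. indicator {0<..<t} s *\<^sub>R duhamel t j x s) \<in> borel_measurable borel"
      by (intro borel_measurable_continuous_on_indicator) simp_all
    then show "set_borel_measurable lborel {0<..<t} (duhamel t j x)"
      unfolding set_borel_measurable_def by (simp only: measurable_lborel2)
    show "AE s in lborel. s \<in> {0<..<t} \<longrightarrow> norm (duhamel t j x s) \<le> norm (K * (t - s) powr (- 1/2))"
    proof (rule AE_I2, rule impI)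
      fix s assume "s \<in> {0<..<t}"
      then have "\<bar>duhamel t j x s\<bar> \<le> K * (t - s) powr (- 1/2)" using t by (intro K) auto
      then show "norm (duhamel t j x s) \<le> norm (K * (t - s) powr (- 1/2))" by simp
    qed
  qed
qed

lemma mild_component:
  assumes t: "0 < t" "t \<le> T"
  shows "AE x in lebesgue. \<forall>j. u t x $ j = heat t a x $ j - (LINT s:{0<..<t}|lborel. duhamel t j x s)"
proof -
  have "t \<in> {0..T}" using t by simp
  with mild have "AE x in lebesgue. u t x = heat t a x
          - (LINT s:{0..t}|lborel. heat_leray_div (t - s) (\<lambda>y. tensor (u s y) (u s y)) x)"
    by (auto simp: mild_solution_def)
  then show ?thesis
  proof eventually_elim
    case (elim x)
    let ?D = "\<lambda>s. heat_leray_div (t - s) (\<lambda>y. tensor (u s y) (u s y)) x"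
    \<comment> \<open>The endpoints form a null set; the integrand is controlled only in between,
      where t - s > 0 and u is continuous in norm.\<close>
    have "(LINT s:{0..t}|lborel. ?D s) = (LINT s:{0<..<t}|lborel. ?D s)"
      by (rule set_integral_discrete_difference[where X = "{0, t}"]) (use t in auto)
    moreover have "integrable lborel (\<lambda>s. (indicator {0<..<t} s *\<^sub>R ?D s) $ j)" for j
      using duhamel_integrable[OF t, of j x] by (simp add: set_integrable_def duhamel_def)
    from integrable_vecI(2)[OF this]
    have "(LINT s:{0<..<t}|lborel. ?D s) $ j = (LINT s:{0<..<t}|lborel. duhamel t j x s)" for j
      by (simp add: set_lebesgue_integral_def duhamel_def)
    ultimately show ?case using elim by simp
  qed
qed

end

section \<open>Asymptotics far from the origin\<close>

text \<open>The numerator is a cubic form and the remaining power of |x| has degree -d-4, whence 3 -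
  (d + 4) = -d - 1.\<close>

lemma oseen_profile_scaleR:
  fixes z :: "real^'n::finite"
  assumes "r > 0" "z \<noteq> 0"
  shows "oseen_profile j h k (r *\<^sub>R z) = r powr (- (real CARD('n) + 1)) * oseen_profile j h k z"
proof -
  have rz: "r *\<^sub>R z \<noteq> 0" using assms by simp
  have S: "oseen_sym j h k (r *\<^sub>R z) = r * oseen_sym j h k z"
    by (simp add: oseen_sym_def algebra_simps)
  have N: "(norm (r *\<^sub>R z))\<^sup>2 = r\<^sup>2 * (norm z)\<^sup>2" by (simp add: power_mult_distrib)
  have "(r\<^sup>2) powr (- (real CARD('n) / 2 + 2)) = r powr (- (real CARD('n) + 4))"
  proof -
    have "(r\<^sup>2) powr (- (real CARD('n) / 2 + 2)) = (r powr 2) powr (- (real CARD('n) / 2 + 2))"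
      using assms by simp
    also have "\<dots> = r powr (- (real CARD('n) + 4))"
      unfolding powr_powr by (intro arg_cong2[where f = "(powr)"] refl) (simp add: field_simps)
    finally show ?thesis .
  qed
  moreover have "r ^ 3 * r powr (- (real CARD('n) + 4)) = r powr (- (real CARD('n) + 1))"
  proof -
    have "r ^ 3 * r powr (- (real CARD('n) + 4)) = r powr 3 * r powr (- (real CARD('n) + 4))"
      using assms by simp
    also have "\<dots> = r powr (- (real CARD('n) + 1))"
      unfolding powr_add[symmetric] by (intro arg_cong2[where f = "(powr)"] refl) simp
    finally show ?thesis .
  qed
  moreover have "r\<^sup>2 * (norm z)\<^sup>2 * (r * oseen_sym j h k z) - (real CARD('n) + 2) * ((r * z $ j) * (r * z $ h) * (r * z $ k)) =
      r ^ 3 * ((norm z)\<^sup>2 * oseen_sym j h k z - (real CARD('n) + 2) * (z $ j * z $ h * z $ k))"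
    by (simp add: algebra_simps power2_eq_square power3_eq_cube)
  ultimately show ?thesis
    unfolding oseen_profile_eq[OF rz] oseen_profile_eq[OF assms(2)] N S powr_mult vector_scaleR_component real_scaleR_def
    by (simp add: mult_ac)
qed

lemma continuous_on_oseen_profile: "continuous_on (- {0}) (oseen_profile j h k :: real^'n::finite \<Rightarrow> real)"
proof -
  have "continuous_on (- {0 :: real^'n}) (\<lambda>x. profile_const TYPE('n) *
    ((norm x)\<^sup>2 * oseen_sym j h k x - (real CARD('n) + 2) * (x $ j * x $ h * x $ k)) *
      ((norm x)\<^sup>2) powr (- (real CARD('n) / 2 + 2)))"
    unfolding oseen_sym_def by (intro continuous_intros) auto
  then show ?thesis
    by (rule continuous_on_cong[THEN iffD1, rotated -1]) (simp_all add: oseen_profile_eq)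
qed

lemma norm_square_powr: "((norm z)\<^sup>2) powr (- (q / 2)) = norm z powr (- q)"
proof (cases "z = 0")
  case False
  have "((norm z)\<^sup>2) powr (- (q / 2)) = (norm z powr 2) powr (- (q / 2))" using False by simp
  then show ?thesis unfolding powr_powr by simp
qed simp

text \<open>By homogeneity the claim reduces to |x| = 1, where it is uniform continuity on a compact
  annulus.\<close>

lemma oseen_profile_modulus:
  assumes "\<eta> > 0"
  obtains \<delta> where "0 < \<delta>" "\<delta> \<le> 1/2"
    "\<And>j h k (x::real^'n::finite) y. x \<noteq> 0 \<Longrightarrow> norm y \<le> \<delta> * norm x \<Longrightarrow>
      \<bar>oseen_profile j h k (x - y) - oseen_profile j h k x\<bar> \<le> \<eta> * norm x powr (- (real CARD('n) + 1))"
proof -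
  \<comment> \<open>Contains every shift of a unit vector by at most 1/2 and stays away from the
    origin. Bundling all indices in one array-valued function gives one \<delta> for all j, h,
    k.\<close>
  define Z where "Z = (cball 0 (3/2) :: (real^'n) set) - ball 0 (1/2)"
  define \<Psi> where "\<Psi> z = (\<chi> j h k. oseen_profile j h k z)" for z :: "real^'n"
  have "compact Z" unfolding Z_def by (intro compact_diff) auto
  moreover have "continuous_on Z \<Psi>"
    unfolding \<Psi>_def
    by (intro continuous_on_vec_lambda continuous_on_subset[OF continuous_on_oseen_profile]) (auto simp: Z_def)
  ultimately have "uniformly_continuous_on Z \<Psi>" by (rule compact_uniformly_continuous[rotated])
  then obtain d where d: "d > 0" "\<And>z z'. z \<in> Z \<Longrightarrow> z' \<in> Z \<Longrightarrow> dist z' z < d \<Longrightarrow> dist (\<Psi> z') (\<Psi> z) < \<eta>"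
    using assms unfolding uniformly_continuous_on_def by meson
  show thesis
  proof (rule that[of "min (1/2) (d / 2)"])
    fix j h k and x y :: "real^'n" assume x: "x \<noteq> 0" and y: "norm y \<le> min (1/2) (d / 2) * norm x"
    define r where "r = norm x"
    have r: "r > 0" using x by (simp add: r_def)
    define e where "e = (1 / r) *\<^sub>R x"
    define f where "f = (1 / r) *\<^sub>R y"
    have xy: "x = r *\<^sub>R e" "x - y = r *\<^sub>R (e - f)"
      using r by (simp_all add: e_def f_def scaleR_diff_right)
    have e: "norm e = 1" using r by (simp add: e_def r_def)
    have f: "norm f \<le> 1/2" "norm f < d"
    proof -
      have "norm f = norm y / r" using r by (simp add: f_def)
      also have "\<dots> \<le> min (1/2) (d / 2)" using divide_right_mono[OF y, of r] r x unfolding r_def by simp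
      finally show "norm f \<le> 1/2" "norm f < d" using d by auto
    qed
    have Z: "e \<in> Z" "e - f \<in> Z"
      using e f norm_triangle_ineq4[of e f] norm_triangle_ineq2[of e f] by (auto simp: Z_def)
    have "dist (\<Psi> (e - f)) (\<Psi> e) < \<eta>" using Z f by (intro d) (auto simp: dist_norm)
    moreover have "\<bar>oseen_profile j h k (e - f) - oseen_profile j h k e\<bar> \<le> norm (\<Psi> (e - f) - \<Psi> e)"
    proof -
      have "\<bar>(\<Psi> (e - f) - \<Psi> e) $ j $ h $ k\<bar> \<le> norm (\<Psi> (e - f) - \<Psi> e)"
        by (rule order_trans[OF component_le_norm_cart order_trans[OF Finite_Cartesian_Product.norm_nth_le Finite_Cartesian_Product.norm_nth_le]])
      then show ?thesis by (simp add: \<Psi>_def)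
    qed
    ultimately have le: "\<bar>oseen_profile j h k (e - f) - oseen_profile j h k e\<bar> \<le> \<eta>"
      by (simp add: dist_norm)
    have nz: "e \<noteq> 0" "e - f \<noteq> 0" using Z by (auto simp: Z_def)
    have "\<bar>oseen_profile j h k (x - y) - oseen_profile j h k x\<bar> =
      r powr (- (real CARD('n) + 1)) * \<bar>oseen_profile j h k (e - f) - oseen_profile j h k e\<bar>"
    proof -
      have "oseen_profile j h k (x - y) = r powr (- (real CARD('n) + 1)) * oseen_profile j h k (e - f)"
        unfolding xy(2) by (rule oseen_profile_scaleR[OF r nz(2)])
      moreover have "oseen_profile j h k x = r powr (- (real CARD('n) + 1)) * oseen_profile j h k e"
        using oseen_profile_scaleR[OF r nz(1)] by (simp only: xy(1)[symmetric])
      ultimately show ?thesis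
        by (simp add: abs_mult flip: right_diff_distrib)
    qed
    also have "\<dots> \<le> r powr (- (real CARD('n) + 1)) * \<eta>"
      by (intro mult_left_mono le) simp
    finally show "\<bar>oseen_profile j h k (x - y) - oseen_profile j h k x\<bar> \<le> \<eta> * norm x powr (- (real CARD('n) + 1))"
      by (simp add: r_def mult.commute)
  qed (use d in auto)
qed

lemma decay_weight_le_powr:
  fixes y :: "real^'n::finite"
  assumes "0 < r" "r \<le> norm y"
  shows "decay_weight y \<le> r powr (- (real CARD('n) + 1))"
  unfolding decay_weight_def using assms by (intro powr_mono2') auto

text \<open>
  The mass of \<open>v\<close> near the origin sees the profile at \<open>x\<close>, the mass far from the origin is
  negligible because \<open>v\<close> decays twice as fast as the kernel.
\<close>

lemma oseen_convolution_asymptotics: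
  assumes n: "CARD('n::finite) \<ge> 2" and B: "B > 0" and \<epsilon>: "\<epsilon> > 0"
  obtains L where "L > 0"
    "\<And>\<tau> x h k j v. 0 < \<tau> \<Longrightarrow> \<tau> \<le> 1 \<Longrightarrow> norm (x::real^'n) \<ge> 1 \<Longrightarrow> v \<in> borel_measurable lebesgue \<Longrightarrow>
      (AE y in lebesgue. \<bar>v y\<bar> \<le> B * (decay_weight y)\<^sup>2) \<Longrightarrow>
      \<bar>(\<integral>y. v y * oseen_kernel \<tau> h k (x - y) $ j \<partial>lebesgue) - oseen_profile j h k x * (\<integral>y. v y \<partial>lebesgue)\<bar>
        \<le> norm x powr (- (real CARD('n) + 1)) * (\<epsilon> + L * (1 / norm x * \<tau> powr (- 1/2)))"
proof -
  define p where "p = real CARD('n) + 1"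
  have p: "p \<ge> 1" "p > 0" by (simp_all add: p_def)
  obtain C1 where C1: "C1 > 0"
    "\<And>t j h k (x::real^'n). t > 0 \<Longrightarrow> \<bar>oseen_kernel t h k x $ j\<bar> \<le> C1 * (t + (norm x)\<^sup>2) powr (- ((real CARD('n) + 1) / 2))"
    by (rule oseen_kernel_bound[OF n]) blast
  obtain C2 where C2: "C2 > 0"
    "\<And>t j h k (x::real^'n). t > 0 \<Longrightarrow> x \<noteq> 0 \<Longrightarrow>
      \<bar>oseen_kernel t h k x $ j - oseen_profile j h k x\<bar> \<le> C2 * t * ((norm x)\<^sup>2) powr (- ((real CARD('n) + 3) / 2))"
    by (rule oseen_kernel_profile_diff[OF n]) blast
  obtain C3 where C3: "C3 > 0"
    "\<And>j h k (x::real^'n). x \<noteq> 0 \<Longrightarrow> \<bar>oseen_profile j h k x\<bar> \<le> C3 * ((norm x)\<^sup>2) powr (- ((real CARD('n) + 1) / 2))"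
    by (rule oseen_profile_bound[where 'n='n]) blast
  obtain P where P: "P > 0"
    "\<And>t x::real^'n. t > 0 \<Longrightarrow> integrable lborel (\<lambda>y. (t + (norm (x - y))\<^sup>2) powr (- ((real CARD('n) + 1) / 2)))"
    "\<And>t x::real^'n. t > 0 \<Longrightarrow> (\<integral>y. (t + (norm (x - y))\<^sup>2) powr (- ((real CARD('n) + 1) / 2)) \<partial>lborel) = P * t powr (- 1/2)"
    by (rule poisson_kernel_integral[where 'n='n]) blast
  define W1 where "W1 = (\<integral>y. decay_weight (y::real^'n) \<partial>lborel)"
  have W1: "W1 \<ge> 0" unfolding W1_def using decay_weight_pos by (intro integral_nonneg_AE AE_I2) (auto intro: less_imp_le)
  \<comment> \<open>The oscillation of the profile allowed near the origin; it is integrated against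
    a mass of at most B * W1. The summand 1 keeps the denominator positive.\<close>
  define \<eta> where "\<eta> = \<epsilon> / (B * W1 + 1)"
  have \<eta>: "\<eta> > 0" "B * W1 * \<eta> \<le> \<epsilon>"
  proof -
    have "B * W1 + 1 > 0" using B W1 by (simp add: add_nonneg_pos)
    then show "\<eta> > 0" "B * W1 * \<eta> \<le> \<epsilon>" using \<epsilon> by (simp_all add: \<eta>_def field_simps)
  qed
  obtain \<delta> where \<delta>: "0 < \<delta>" "\<delta> \<le> 1/2"
    "\<And>j h k (x::real^'n) y. x \<noteq> 0 \<Longrightarrow> norm y \<le> \<delta> * norm x \<Longrightarrow>
      \<bar>oseen_profile j h k (x - y) - oseen_profile j h k x\<bar> \<le> \<eta> * norm x powr (- (real CARD('n) + 1))"
    by (rule oseen_profile_modulus[OF \<eta>(1), where 'n='n]) blast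
  \<comment> \<open>D2 comes from kernel minus profile for |y| \<le> \<delta>|x|; beyond that
    radius, D3 comes from the profile and D1 from the kernel. Only the D1 term meets the singularity
    at y = x, hence its companion P from the Poisson kernel.\<close>
  define D2 where "D2 = C2 * 2 powr (p + 2)"
  define D3 where "D3 = C3 * \<delta> powr (- p)"
  define D1 where "D1 = C1 * (\<delta> powr (- p) * \<delta> powr (- p))"
  have D: "D1 > 0" "D2 > 0" "D3 > 0" using C1 C2 C3 \<delta> by (simp_all add: D1_def D2_def D3_def)
  show thesis
  proof (rule that[of "B * W1 * (D2 + D3) + B * D1 * P"])
    show "B * W1 * (D2 + D3) + B * D1 * P > 0"
      using B W1 D P by (intro add_nonneg_pos) auto
    fix \<tau> :: real and x :: "real^'n" and h k j and v :: "real^'n \<Rightarrow> real"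
    assume \<tau>: "0 < \<tau>" "\<tau> \<le> 1" and x: "norm x \<ge> 1" and vm: "v \<in> borel_measurable lebesgue"
      and v: "AE y in lebesgue. \<bar>v y\<bar> \<le> B * (decay_weight y)\<^sup>2"
    define r where "r = norm x"
    have r: "r \<ge> 1" "r > 0" using x unfolding r_def by linarith+
    have x0: "x \<noteq> 0" using x by (cases "x = 0") auto
    let ?F = "\<lambda>y. oseen_kernel \<tau> h k (x - y) $ j"
    let ?\<Psi> = "oseen_profile j h k"
    let ?q = "\<lambda>y. (\<tau> + (norm (x - y))\<^sup>2) powr (- ((real CARD('n) + 1) / 2))"
    have W2: "(decay_weight y)\<^sup>2 \<le> decay_weight y" for y :: "real^'n"
      using decay_weight_pos[of y] decay_weight_le_1[of y] by (simp add: power2_eq_square mult_left_le)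
    have \<Psi>x: "\<bar>?\<Psi> x\<bar> \<le> C3 * r powr (- p)"
      using C3(2)[OF x0, of j h k] unfolding norm_square_powr r_def p_def .
    have pw: "\<bar>v y * ?F y - v y * ?\<Psi> x\<bar> \<le>
      B * (r powr (- p) * (\<eta> + (D2 + D3) * (1 / r))) * decay_weight y + B * D1 * (r powr (- p) * r powr (- p)) * ?q y"
      if vy: "\<bar>v y\<bar> \<le> B * (decay_weight y)\<^sup>2" for y
    proof (cases "norm y \<le> \<delta> * r")
      case True
      have "norm y \<le> r / 2" using True \<delta>(2) r mult_right_mono[of \<delta> "1/2" r] by linarith
      then have xy: "norm (x - y) \<ge> r / 2" using norm_triangle_ineq2[of x y] by (simp add: r_def)
      then have xy0: "x - y \<noteq> 0" using r by auto
      have "\<bar>?F y - ?\<Psi> (x - y)\<bar> \<le> C2 * \<tau> * norm (x - y) powr (- (real CARD('n) + 3))"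
        using C2(2)[OF \<tau>(1) xy0, of h k j] unfolding norm_square_powr .
      also have "\<dots> \<le> C2 * 1 * (r / 2) powr (- (real CARD('n) + 3))"
        using C2 \<tau> xy r by (intro mult_mono powr_mono2') auto
      also have "(r / 2) powr (- (real CARD('n) + 3)) = 2 powr (p + 2) * (r powr (- p) * r powr (- 2))"
      proof -
        have "(r / 2) powr (- q) = 2 powr q * r powr (- q)" for q
          using r by (simp add: powr_divide powr_minus_divide)
        then have "(r / 2) powr (- (real CARD('n) + 3)) = 2 powr (real CARD('n) + 3) * r powr (- (real CARD('n) + 3))" .
        moreover have "2 powr (real CARD('n) + 3) = (2::real) powr (p + 2)" by (simp add: p_def add.commute)
        moreover have "r powr (- (real CARD('n) + 3)) = r powr (- p) * r powr (- 2)"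
          unfolding powr_add[symmetric] by (intro arg_cong2[where f = "(powr)"] refl) (simp add: p_def)
        ultimately show ?thesis by (simp only:)
      qed
      also have "C2 * 1 * (2 powr (p + 2) * (r powr (- p) * r powr (- 2))) \<le> D2 * (r powr (- p) * (1 / r))"
      proof -
        have "r powr (- 2) \<le> r powr (- 1)" using r by (intro powr_mono) auto
        also have "r powr (- 1) = 1 / r" using r by (simp add: powr_minus_divide)
        finally show ?thesis unfolding D2_def using C2
          by (simp only: mult.assoc mult_1) (intro mult_left_mono, auto)
      qed
      finally have "\<bar>?F y - ?\<Psi> (x - y)\<bar> \<le> r powr (- p) * (D2 * (1 / r))" by (simp add: mult_ac)
      moreover have "\<bar>?\<Psi> (x - y) - ?\<Psi> x\<bar> \<le> \<eta> * r powr (- p)"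
        using \<delta>(3)[OF x0, of y j h k] True unfolding r_def p_def by simp
      moreover have "0 \<le> r powr (- p) * (D3 * (1 / r))" using D r by simp
      ultimately have "\<bar>?F y - ?\<Psi> x\<bar> \<le> r powr (- p) * (\<eta> + (D2 + D3) * (1 / r))"
        by (simp only: distrib_left distrib_right mult_ac)
      then have "\<bar>v y\<bar> * \<bar>?F y - ?\<Psi> x\<bar> \<le> (B * decay_weight y) * (r powr (- p) * (\<eta> + (D2 + D3) * (1 / r)))"
      proof (rule mult_mono[rotated])
        show "\<bar>v y\<bar> \<le> B * decay_weight y"
          using vy mult_left_mono[OF W2[of y], of B] B by linarith
      qed (use B decay_weight_pos[of y] in auto)
      then have "\<bar>v y * ?F y - v y * ?\<Psi> x\<bar> \<le> B * (r powr (- p) * (\<eta> + (D2 + D3) * (1 / r))) * decay_weight y"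
        by (simp only: right_diff_distrib[symmetric] abs_mult mult_ac)
      moreover have "0 \<le> B * D1 * (r powr (- p) * r powr (- p)) * ?q y" using B D by simp
      ultimately show ?thesis by linarith
    next
      case False
      have "0 < \<delta> * r" "\<delta> * r \<le> norm y" using \<delta> r False by auto
      then have wy: "decay_weight y \<le> \<delta> powr (- p) * r powr (- p)"
        using decay_weight_le_powr[of "\<delta> * r" y] by (simp add: p_def powr_mult)
      have w0: "0 \<le> decay_weight y" using decay_weight_pos[of y] by simp
      have "(decay_weight y)\<^sup>2 \<le> (\<delta> powr (- p) * r powr (- p)) * (\<delta> powr (- p) * r powr (- p))"
        unfolding power2_eq_square using wy w0 by (intro mult_mono) auto
      \<comment> \<open>Both factors of the decay are spent here, because the kernel has to be
        integrated across its singularity. The profile at x is constant in y, so \<open>v2\<close>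
        spends one factor and keeps the other for integrability.\<close>
      then have v1: "\<bar>v y\<bar> \<le> B * ((\<delta> powr (- p) * r powr (- p)) * (\<delta> powr (- p) * r powr (- p)))"
        using vy B by (meson less_imp_le mult_left_mono order_trans)
      have "(decay_weight y)\<^sup>2 \<le> (\<delta> powr (- p) * r powr (- p)) * decay_weight y"
        unfolding power2_eq_square using wy w0 by (intro mult_right_mono)
      then have v2: "\<bar>v y\<bar> \<le> B * ((\<delta> powr (- p) * r powr (- p)) * decay_weight y)"
        using vy B by (meson less_imp_le mult_left_mono order_trans)
      have "\<bar>v y\<bar> * \<bar>?F y\<bar> \<le> B * ((\<delta> powr (- p) * r powr (- p)) * (\<delta> powr (- p) * r powr (- p))) * (C1 * ?q y)"
        using v1 C1(2)[OF \<tau>(1), of h k "x - y" j] B by (intro mult_mono) auto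
      then have t1: "\<bar>v y * ?F y\<bar> \<le> B * D1 * (r powr (- p) * r powr (- p)) * ?q y"
        unfolding D1_def abs_mult by (simp only: mult_ac)
      have rp: "r powr (- p) \<le> 1 / r"
      proof -
        have "r powr (- p) \<le> r powr (- 1)" using r p by (intro powr_mono) auto
        then show ?thesis using r by (simp add: powr_minus_divide)
      qed
      have "\<bar>v y\<bar> * \<bar>?\<Psi> x\<bar> \<le> B * ((\<delta> powr (- p) * r powr (- p)) * decay_weight y) * (C3 * r powr (- p))"
        using v2 \<Psi>x B w0 by (intro mult_mono) auto
      also have "\<dots> = B * (r powr (- p) * (D3 * r powr (- p))) * decay_weight y"
        unfolding D3_def by (simp only: mult_ac)
      also have "\<dots> \<le> B * (r powr (- p) * (\<eta> + (D2 + D3) * (1 / r))) * decay_weight y"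
      proof -
        have "D3 * r powr (- p) \<le> D3 * (1 / r)" using rp D by (intro mult_left_mono) auto
        moreover have "0 \<le> D2 * (1 / r)" using D r by simp
        ultimately have "D3 * r powr (- p) \<le> \<eta> + (D2 + D3) * (1 / r)"
          using \<eta> unfolding distrib_right by linarith
        then show ?thesis using B w0 by (intro mult_right_mono mult_left_mono) auto
      qed
      finally have t2: "\<bar>v y * ?\<Psi> x\<bar> \<le> B * (r powr (- p) * (\<eta> + (D2 + D3) * (1 / r))) * decay_weight y"
        unfolding abs_mult .
      show ?thesis using t1 t2 abs_triangle_ineq4[of "v y * ?F y" "v y * ?\<Psi> x"] by linarith
    qed
    have vi: "integrable lebesgue v"
    proof (rule Bochner_Integration.integrable_bound)
      show "integrable lebesgue (\<lambda>y::real^'n. B * decay_weight y)"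
        by (intro integrable_mult_right integrable_decay_weight_lebesgue)
      show "AE y in lebesgue. norm (v y) \<le> norm (B * decay_weight y)"
        using v
      proof eventually_elim
        case (elim y)
        moreover have "B * (decay_weight y)\<^sup>2 \<le> B * decay_weight y"
          using B by (intro mult_left_mono W2) auto
        ultimately have "\<bar>v y\<bar> \<le> B * decay_weight y" by linarith
        then show ?case using B decay_weight_pos[of y] by simp
      qed
    qed (rule vm)
    obtain K where "\<And>\<tau> B x h k j v. \<tau> > 0 \<Longrightarrow> B \<ge> 0 \<Longrightarrow> v \<in> borel_measurable lebesgue \<Longrightarrow> (AE y in lebesgue. \<bar>v y\<bar> \<le> B) \<Longrightarrow>
      integrable lebesgue (\<lambda>y::real^'n. v y * oseen_kernel \<tau> h k (x - y) $ j) \<and>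
      (\<integral>y. \<bar>v y * oseen_kernel \<tau> h k (x - y) $ j\<bar> \<partial>lebesgue) \<le> B * K * \<tau> powr (- 1/2)"
      by (rule oseen_convolution[OF n]) blast
    moreover have "AE y in lebesgue. \<bar>v y\<bar> \<le> B"
      using v
    proof eventually_elim
      case (elim y)
      have "(decay_weight y)\<^sup>2 \<le> 1" using W2[of y] decay_weight_le_1[of y] by linarith
      then have "B * (decay_weight y)\<^sup>2 \<le> B * 1" using B by (intro mult_left_mono) auto
      then show ?case using elim by simp
    qed
    ultimately have Fi: "integrable lebesgue (\<lambda>y. v y * ?F y)"
      using \<tau> B vm by (meson less_imp_le)
    define a1 where "a1 = B * (r powr (- p) * (\<eta> + (D2 + D3) * (1 / r)))"
    define a2 where "a2 = B * D1 * (r powr (- p) * r powr (- p))"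
    define G where "G y = a1 * decay_weight y + a2 * ?q y" for y
    have gi: "integrable lborel G" "(\<integral>y. G y \<partial>lborel) = a1 * W1 + a2 * (P * \<tau> powr (- 1/2))"
    proof -
      have "has_bochner_integral lborel (decay_weight :: real^'n \<Rightarrow> real) W1"
        using integrable_decay_weight[where 'n='n] by (simp add: has_bochner_integral_iff W1_def)
      moreover have "has_bochner_integral lborel ?q (P * \<tau> powr (- 1/2))"
        using P(2,3)[OF \<tau>(1), of x] by (simp only: has_bochner_integral_iff)
      ultimately have "has_bochner_integral lborel G (a1 * W1 + a2 * (P * \<tau> powr (- 1/2)))"
        unfolding G_def by (intro has_bochner_integral_add has_bochner_integral_mult_right)
      then show "integrable lborel G" "(\<integral>y. G y \<partial>lborel) = a1 * W1 + a2 * (P * \<tau> powr (- 1/2))"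
        by (simp_all only: has_bochner_integral_iff)
    qed
    have Gm: "G \<in> borel_measurable borel" using gi(1) by auto
    have "(\<integral>y. v y * ?F y \<partial>lebesgue) - ?\<Psi> x * (\<integral>y. v y \<partial>lebesgue) = (\<integral>y. v y * ?F y - v y * ?\<Psi> x \<partial>lebesgue)"
      using Fi vi by simp
    also have "norm \<dots> \<le> (\<integral>y. G y \<partial>lebesgue)"
    proof (rule norm_integral_le_AE)
      show "AE y in lebesgue. norm (v y * ?F y - v y * ?\<Psi> x) \<le> G y"
        using v unfolding G_def a1_def a2_def by eventually_elim (simp only: real_norm_def pw)
    qed (rule integrable_lebesgueI[OF gi(1)])
    also have "(\<integral>y. G y \<partial>lebesgue) = (\<integral>y. G y \<partial>lborel)"
      by (rule integral_lebesgue_eq_lborel[OF Gm])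
    also have "\<dots> = B * (r powr (- p) * (\<eta> + (D2 + D3) * (1 / r))) * W1 + B * D1 * (r powr (- p) * r powr (- p)) * (P * \<tau> powr (- 1/2))"
      unfolding gi(2) a1_def a2_def ..
    also have "\<dots> \<le> r powr (- p) * (\<epsilon> + (B * W1 * (D2 + D3) + B * D1 * P) * (1 / r * \<tau> powr (- 1/2)))"
    proof -
      \<comment> \<open>As \<tau> \<le> 1 and |x| \<ge> 1, both T \<ge> 1 and r^(-p) \<le> 1/r hold,
        so every error except \<epsilon> takes the form of a constant times T/r.\<close>
      define T where "T = \<tau> powr (- 1/2)"
      have T1: "T \<ge> 1" using powr_mono2'[of "-1/2" \<tau> 1] \<tau> by (simp add: T_def)
      have rp: "r powr (- p) \<le> 1 / r"
      proof -
        have "r powr (- p) \<le> r powr (- 1)" using r p by (intro powr_mono) auto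
        then show ?thesis using r by (simp add: powr_minus_divide)
      qed
      have "B * W1 * (D2 + D3) * (1 / r) * 1 \<le> B * W1 * (D2 + D3) * (1 / r) * T"
        using B W1 D r T1 by (intro mult_left_mono) auto
      moreover have "B * D1 * P * T * r powr (- p) \<le> B * D1 * P * T * (1 / r)"
        using B D P rp T1 by (intro mult_left_mono) auto
      ultimately have "B * W1 * \<eta> + B * W1 * (D2 + D3) * (1 / r) + B * D1 * P * T * r powr (- p) \<le>
          \<epsilon> + (B * W1 * (D2 + D3) * (1 / r) * T + B * D1 * P * T * (1 / r))"
        using \<eta>(2) by linarith
      from mult_left_mono[OF this powr_ge_zero, of r "- p"]
      show ?thesis unfolding T_def[symmetric] by (simp only: distrib_left distrib_right mult_ac)
    qed
    finally show "\<bar>(\<integral>y. v y * oseen_kernel \<tau> h k (x - y) $ j \<partial>lebesgue) - oseen_profile j h k x * (\<integral>y. v y \<partial>lebesgue)\<bar>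
        \<le> norm x powr (- (real CARD('n) + 1)) * (\<epsilon> + (B * W1 * (D2 + D3) + B * D1 * P) * (1 / norm x * \<tau> powr (- 1/2)))"
      unfolding r_def p_def real_norm_def .
  qed
qed

context decaying_mild_solution
begin

section \<open>Second moments for small times and the asymptotic expansion\<close>

definition moment :: "'n \<Rightarrow> 'n \<Rightarrow> real" where
  "moment h k = (\<integral>y. a y $ h * a y $ k \<partial>lebesgue)"

definition limit_profile :: "'n \<Rightarrow> real^'n \<Rightarrow> real" where
  "limit_profile j x = (\<Sum>h\<in>UNIV. \<Sum>k\<in>UNIV. oseen_profile j h k x * moment h k)"

text \<open>The singularity (t - s)^(-1/2) integrates to 2 t^(1/2). The bound carries no decay in x
  but is uniform, which is what the limit of the moments uses.\<close>

lemma u_heat_diff: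
  obtains K where "K > 0"
    "\<And>t. 0 < t \<Longrightarrow> t \<le> T \<Longrightarrow> AE x in lebesgue. \<forall>j. \<bar>u t x $ j - heat t a x $ j\<bar> \<le> K * sqrt t"
proof -
  obtain K where K: "K > 0"
    "\<And>s t j x. s \<in> {0..T} \<Longrightarrow> s < t \<Longrightarrow> \<bar>duhamel t j x s\<bar> \<le> K * (t - s) powr (- 1/2)"
    by (rule duhamel_bound) blast
  show thesis
  proof (rule that[of "2 * K"])
    fix t assume t: "0 < t" "t \<le> T"
    have le: "\<bar>LINT s:{0<..<t}|lborel. duhamel t j x s\<bar> \<le> K * (2 * sqrt t)" for j x
    proof -
      have "norm (\<integral>s. indicator {0<..<t} s *\<^sub>R duhamel t j x s \<partial>lborel) \<le>
          (\<integral>s. K * (indicator {0<..<t} s *\<^sub>R (t - s) powr (- 1/2)) \<partial>lborel)"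
      proof (rule norm_integral_le_AE)
        show "integrable lborel (\<lambda>s. K * (indicator {0<..<t} s *\<^sub>R (t - s) powr (- 1/2)))"
          using integral_time_singularity(1)[OF t(1)] unfolding set_integrable_def
          by (rule integrable_mult_right)
        show "AE s in lborel. norm (indicator {0<..<t} s *\<^sub>R duhamel t j x s) \<le> K * (indicator {0<..<t} s *\<^sub>R (t - s) powr (- 1/2))"
          using K(2)[of _ t j x] t by (intro AE_I2) (auto simp: indicator_def)
      qed
      also have "\<dots> = K * (2 * sqrt t)"
        using integral_time_singularity(2)[OF t(1)] unfolding set_lebesgue_integral_def by simp
      finally show ?thesis unfolding set_lebesgue_integral_def by simp
    qed
    show "AE x in lebesgue. \<forall>j. \<bar>u t x $ j - heat t a x $ j\<bar> \<le> 2 * K * sqrt t"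
      using mild_component[OF t]
    proof eventually_elim
      case (elim x)
      show ?case
      proof
        fix j
        show "\<bar>u t x $ j - heat t a x $ j\<bar> \<le> 2 * K * sqrt t"
          using elim[rule_format, of j] le[of j x] by simp
      qed
    qed
  qed (use K in simp)
qed

lemma a_nth_meas: "(\<lambda>y. a y $ l) \<in> borel_measurable lebesgue"
proof -
  have "(\<lambda>v::real^'n. v $ l) \<in> borel_measurable borel" by measurable
  then show ?thesis by (rule measurable_compose[OF a_meas])
qed

lemma a_nth_bound: "AE y in lebesgue. \<forall>l. \<bar>a y $ l\<bar> \<le> M * decay_weight y"
  using a_bound
proof eventually_elim
  case (elim y)
  have "(1 + norm y) powr (- \<theta>) \<le> decay_weight y"
    unfolding decay_weight_def using theta by (intro powr_mono) auto
  then have "M * (1 + norm y) powr (- \<theta>) \<le> M * decay_weight y"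
    using M by (intro mult_left_mono) auto
  with elim show ?case
    by (intro allI order_trans[OF component_le_norm_cart]) linarith
qed

lemma heat_nth:
  assumes "t > 0"
  shows "heat t a x $ j = (\<integral>y. heat_kernel t (x - y) * a y $ j \<partial>lebesgue)"
proof -
  have "integrable lebesgue (\<lambda>y. (heat_kernel t (x - y) *\<^sub>R a y) $ l)" for l
  proof (rule Bochner_Integration.integrable_bound)
    show "integrable lebesgue (\<lambda>y. heat_kernel t (x - y) * M)"
      by (intro integrable_mult_left integrable_lebesgueI integral_heat_kernel_diff assms)
    have "(\<lambda>y. heat_kernel t (x - y)) \<in> borel_measurable lebesgue"
      by (intro measurable_completion) measurable
    then show "(\<lambda>y. (heat_kernel t (x - y) *\<^sub>R a y) $ l) \<in> borel_measurable lebesgue"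
      using a_nth_meas[of l] by simp
    show "AE y in lebesgue. norm ((heat_kernel t (x - y) *\<^sub>R a y) $ l) \<le> norm (heat_kernel t (x - y) * M)"
      using a_nth_bound
    proof eventually_elim
      case (elim y)
      have "\<bar>a y $ l\<bar> \<le> M"
        using elim[rule_format, of l] mult_left_le[OF decay_weight_le_1[of y], of M] M by linarith
      then show ?case using M by (simp add: abs_mult mult_left_mono)
    qed
  qed
  from integrable_vecI(2)[OF this, of j] show ?thesis
    using assms by (simp add: heat_def)
qed

lemma quad_integrable:
  assumes "s \<in> {0..T}"
  shows "integrable lebesgue (quad h k s)"
proof (rule Bochner_Integration.integrable_bound)
  show "integrable lebesgue (\<lambda>y::real^'n. M\<^sup>2 * decay_weight y)"
    by (intro integrable_mult_right integrable_decay_weight_lebesgue)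
  show "AE y in lebesgue. norm (quad h k s y) \<le> norm (M\<^sup>2 * decay_weight y)"
    using quad_bound[OF assms, of h k]
  proof eventually_elim
    case (elim y)
    have "(decay_weight y)\<^sup>2 \<le> decay_weight y"
      using decay_weight_pos[of y] decay_weight_le_1[of y] by (simp add: power2_eq_square mult_left_le)
    then have "M\<^sup>2 * (decay_weight y)\<^sup>2 \<le> M\<^sup>2 * decay_weight y" by (intro mult_left_mono) auto
    then show ?case using elim decay_weight_pos[of y] by simp
  qed
qed (rule quad_meas[OF assms])

lemma a_product_integrable: "integrable lebesgue (\<lambda>y. a y $ h * a y $ k)"
proof (rule Bochner_Integration.integrable_bound)
  show "integrable lebesgue (\<lambda>y::real^'n. M * M * decay_weight y)"
    by (intro integrable_mult_right integrable_decay_weight_lebesgue)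
  show "AE y in lebesgue. norm (a y $ h * a y $ k) \<le> norm (M * M * decay_weight y)"
    using a_nth_bound
  proof eventually_elim
    case (elim y)
    have "\<bar>a y $ h\<bar> \<le> M"
      using elim[rule_format, of h] mult_left_le[OF decay_weight_le_1[of y], of M] M by linarith
    then have "\<bar>a y $ h\<bar> * \<bar>a y $ k\<bar> \<le> M * (M * decay_weight y)"
      using elim M by (intro mult_mono) auto
    then show ?case using M decay_weight_pos[of y] by (simp add: abs_mult)
  qed
qed (intro borel_measurable_times a_nth_meas)

text \<open>Weak convergence does not pass to products. Here u(t) - a splits into the Duhamel part,
  uniformly O(t^(1/2)), and the heat part, which tends to 0 in L^1; the other factor of each product
  supplies integrable decay for the former and a sup bound for the latter.\<close>

lemma quad_tendsto: "((\<lambda>s. \<integral>y. quad h k s y \<partial>lebesgue) \<longlongrightarrow> moment h k) (at_right 0)"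
proof -
  obtain K where K: "K > 0"
    "\<And>t. 0 < t \<Longrightarrow> t \<le> T \<Longrightarrow> AE x in lebesgue. \<forall>j. \<bar>u t x $ j - heat t a x $ j\<bar> \<le> K * sqrt t"
    by (rule u_heat_diff) blast
  define H where "H l t x = \<bar>(\<integral>y. heat_kernel t (x - y) * a y $ l \<partial>lebesgue) - a x $ l\<bar>" for l t x
  have H: "t > 0 \<Longrightarrow> integrable lebesgue (H l t)" "((\<lambda>t. \<integral>x. H l t x \<partial>lebesgue) \<longlongrightarrow> 0) (at_right 0)" for l t
    unfolding H_def
    by (rule heat_L1_convergence[where B = M], use a_nth_meas M a_nth_bound in \<open>auto elim: eventually_mono\<close>)+
  define W1 where "W1 = (\<integral>y. decay_weight (y::real^'n) \<partial>lebesgue)"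
  define E where "E t = M * (2 * (K * sqrt t)) * W1 + M * ((\<integral>x. H h t x \<partial>lebesgue) + (\<integral>x. H k t x \<partial>lebesgue))" for t
  have "((\<lambda>t. (\<integral>y. quad h k t y \<partial>lebesgue) - moment h k) \<longlongrightarrow> 0) (at_right 0)"
  proof (rule Lim_null_comparison)
    have "(E \<longlongrightarrow> M * (2 * (K * sqrt 0)) * W1 + M * (0 + 0)) (at_right 0)"
      unfolding E_def by (intro tendsto_intros H)
    then show "(E \<longlongrightarrow> 0) (at_right 0)" by simp
    have "eventually (\<lambda>t. t \<in> {0<..<T}) (at_right 0)"
      using T by (rule eventually_at_right_real)
    then show "eventually (\<lambda>t. norm ((\<integral>y. quad h k t y \<partial>lebesgue) - moment h k) \<le> E t) (at_right 0)"
    proof eventually_elim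
      case (elim t)
      then have t: "0 < t" "t \<le> T" "t \<in> {0..T}" by auto
      let ?g = "\<lambda>y. M * (2 * (K * sqrt t)) * decay_weight y + M * (H h t y + H k t y)"
      have "(\<integral>y. quad h k t y \<partial>lebesgue) - moment h k = (\<integral>y. quad h k t y - a y $ h * a y $ k \<partial>lebesgue)"
        unfolding moment_def using quad_integrable[OF t(3), of h k] a_product_integrable[of h k] by simp
      also have "norm \<dots> \<le> (\<integral>y. ?g y \<partial>lebesgue)"
      proof (rule norm_integral_le_AE)
        show "integrable lebesgue ?g"
          by (intro Bochner_Integration.integrable_add integrable_mult_right integrable_decay_weight_lebesgue H t)
        show "AE y in lebesgue. norm (quad h k t y - a y $ h * a y $ k) \<le> ?g y"
          using a_nth_bound u_bound[OF t(3)] K(2)[OF t(1,2)]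
        proof eventually_elim
          case (elim y)
          have d: "\<bar>u t y $ l - a y $ l\<bar> \<le> K * sqrt t + H l t y" for l
            using elim(3)[rule_format, of l] unfolding H_def heat_nth[OF t(1), symmetric] by linarith
          have b: "\<bar>u t y $ l\<bar> \<le> M * decay_weight y" for l
            using component_le_norm_cart[of "u t y" l] elim(2) by linarith
          have w: "0 \<le> M * decay_weight y" "M * decay_weight y \<le> M"
            using M decay_weight_pos[of y] mult_left_mono[OF decay_weight_le_1[of y], of M] by auto
          have s: "0 \<le> K * sqrt t" using K t by simp
          have h0: "0 \<le> H l t y" for l by (simp add: H_def)
          have "quad h k t y - a y $ h * a y $ k = (u t y $ h - a y $ h) * u t y $ k + a y $ h * (u t y $ k - a y $ k)"
            by (simp add: quad_def algebra_simps)
          also have "\<bar>\<dots>\<bar> \<le> \<bar>u t y $ h - a y $ h\<bar> * \<bar>u t y $ k\<bar> + \<bar>a y $ h\<bar> * \<bar>u t y $ k - a y $ k\<bar>"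
            unfolding abs_mult[symmetric] by (rule abs_triangle_ineq)
          also have "\<dots> \<le> (K * sqrt t + H h t y) * (M * decay_weight y) + (M * decay_weight y) * (K * sqrt t + H k t y)"
            using d b elim(1) w s h0 by (intro add_mono mult_mono) auto
          also have "\<dots> = M * (2 * (K * sqrt t)) * decay_weight y + (M * decay_weight y) * (H h t y + H k t y)"
            by (simp add: algebra_simps)
          also have "\<dots> \<le> ?g y"
            using w h0[of h] h0[of k] by (intro add_left_mono mult_right_mono) auto
          finally show ?case by simp
        qed
      qed
      also have "\<dots> = E t"
        unfolding E_def W1_def using integrable_decay_weight_lebesgue[where 'n='n] H(1)[OF t(1)]
        by (subst Bochner_Integration.integral_add) auto
      finally show ?case .
    qed
  qed
  then show ?thesis by (rule LIM_zero_cancel)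
qed

lemma heat_far:
  obtains C where "C > 0" "\<And>t x j. 0 < t \<Longrightarrow> t \<le> 1 \<Longrightarrow> \<bar>heat t a x $ j\<bar> \<le> C * (1 + norm x) powr (- \<theta>)"
proof -
  have "\<theta> \<ge> 0" using theta by simp
  then obtain C where C: "C > 0"
    "\<And>(t::real) M x (f :: real^'n \<Rightarrow> real^'n). 0 < t \<Longrightarrow> t \<le> 1 \<Longrightarrow> M \<ge> 0 \<Longrightarrow>
      (AE y in lebesgue. norm (f y) \<le> M * (1 + norm y) powr (- \<theta>)) \<Longrightarrow>
      norm (\<integral>y. heat_kernel t (x - y) *\<^sub>R f y \<partial>lebesgue) \<le> M * C * (1 + norm x) powr (- \<theta>)"
    by (rule heat_decay_bound[where 'n='n and 'b="real^'n"]) blast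
  show thesis
  proof (rule that[of "M * C"])
    show "M * C > 0" using M C by simp
    fix t x j assume t: "0 < t" "t \<le> (1::real)"
    have "norm (heat t a x) \<le> M * C * (1 + norm x) powr (- \<theta>)"
      using C(2)[OF t, of M a x] M a_bound t by (simp add: heat_def)
    then show "\<bar>heat t a x $ j\<bar> \<le> M * C * (1 + norm x) powr (- \<theta>)"
      by (rule order_trans[OF component_le_norm_cart])
  qed
qed

text \<open>Integration over s of the kernel asymptotics. Two errors are small multiples of t, the
  third is a multiple of t^(1/2)/|x|, and the lower bound on |x| converts it into a small multiple
  of t.\<close>

lemma duhamel_asymptotics:
  assumes \<epsilon>: "\<epsilon> > 0"
  obtains t0 C where "0 < t0" "t0 \<le> T" "t0 \<le> 1" "C \<ge> 1"
    "\<And>t x j. 0 < t \<Longrightarrow> t \<le> t0 \<Longrightarrow> norm x \<ge> C * t powr (- 1/2) \<Longrightarrow>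
      \<bar>(LINT s:{0<..<t}|lborel. duhamel t j x s) - t * limit_profile j x\<bar> \<le> \<epsilon> * t * norm x powr (- (real CARD('n) + 1))"
proof -
  define p where "p = real CARD('n) + 1"
  define d where "d = real CARD('n) * real CARD('n)"
  have d: "d > 0" using dim by (simp add: d_def)
  obtain C3 where C3: "C3 > 0"
    "\<And>j h k (x::real^'n). x \<noteq> 0 \<Longrightarrow> \<bar>oseen_profile j h k x\<bar> \<le> C3 * ((norm x)\<^sup>2) powr (- ((real CARD('n) + 1) / 2))"
    by (rule oseen_profile_bound[where 'n='n]) blast
  \<comment> \<open>Half of \<epsilon>, shared among the d pairs of indices. In 1 + C3, the 1 pays
    for the convolution asymptotics and C3 for replacing the moments at time s by those of the
    datum.\<close>
  define \<epsilon>1 where "\<epsilon>1 = \<epsilon> / (2 * d * (1 + C3))"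
  have \<epsilon>1: "\<epsilon>1 > 0" "d * (\<epsilon>1 * (1 + C3)) = \<epsilon> / 2"
  proof -
    have "1 + C3 > 0" using C3(1) by simp
    then show "\<epsilon>1 > 0" "d * (\<epsilon>1 * (1 + C3)) = \<epsilon> / 2"
      using \<epsilon> d by (simp_all add: \<epsilon>1_def del: distrib_left)
  qed
  have "M\<^sup>2 > 0" using M by simp
  then obtain L where L: "L > 0"
    "\<And>\<tau> x h k j v. 0 < \<tau> \<Longrightarrow> \<tau> \<le> 1 \<Longrightarrow> norm (x::real^'n) \<ge> 1 \<Longrightarrow> v \<in> borel_measurable lebesgue \<Longrightarrow>
      (AE y in lebesgue. \<bar>v y\<bar> \<le> M\<^sup>2 * (decay_weight y)\<^sup>2) \<Longrightarrow>
      \<bar>(\<integral>y. v y * oseen_kernel \<tau> h k (x - y) $ j \<partial>lebesgue) - oseen_profile j h k x * (\<integral>y. v y \<partial>lebesgue)\<bar>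
        \<le> norm x powr (- (real CARD('n) + 1)) * (\<epsilon>1 + L * (1 / norm x * \<tau> powr (- 1/2)))"
    by (rule oseen_convolution_asymptotics[OF dim _ \<epsilon>1(1)]) blast
  have "eventually (\<lambda>s. \<forall>h\<in>UNIV. \<forall>k\<in>UNIV. dist (\<integral>y. quad h k s y \<partial>lebesgue) (moment h k) < \<epsilon>1) (at_right 0)"
    by (intro eventually_ball_finite ballI tendstoD[OF quad_tendsto] \<epsilon>1) auto
  then obtain t1 where t1_pos: "t1 > 0"
    and t1': "\<forall>s>0. s < t1 \<longrightarrow> (\<forall>h\<in>UNIV. \<forall>k\<in>UNIV. dist (\<integral>y. quad h k s y \<partial>lebesgue) (moment h k) < \<epsilon>1)"
    unfolding eventually_at_right_field by blast
  have t1: "\<bar>(\<integral>y. quad h k s y \<partial>lebesgue) - moment h k\<bar> \<le> \<epsilon>1" if "0 < s" "s < t1" for s h k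
    using t1' that by (simp add: dist_real_def less_imp_le)
  \<comment> \<open>Before t1 the moments are within \<epsilon>1 of their limits. The entry 1 in the
    maximum ensures |x| \<ge> 1, because t \<le> 1; the entry 4dL/\<epsilon> makes 2dL t^(1/2)/|x|
    at most \<epsilon>t/2.\<close>
  show thesis
  proof (rule that[of "min (min T 1) t1" "max 1 (4 * d * L / \<epsilon>)"])
    fix t :: real and x :: "real^'n" and j :: 'n
    assume t: "0 < t" "t \<le> min (min T 1) t1" and x: "norm x \<ge> max 1 (4 * d * L / \<epsilon>) * t powr (- 1/2)"
    define r where "r = norm x"
    have tp: "t powr (- 1/2) \<ge> 1" using powr_mono2'[of "-1/2" t 1] t by simp
    have r1: "r \<ge> t powr (- 1/2)"
      using x mult_right_mono[of 1 "max 1 (4 * d * L / \<epsilon>)" "t powr (- 1/2)"] by (simp add: r_def)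
    have r: "r \<ge> 1" "r > 0" using r1 tp by linarith+
    have x0: "x \<noteq> 0" using r(2) by (auto simp: r_def)
    have r2: "4 * d * L / \<epsilon> * t powr (- 1/2) \<le> r"
      using x mult_right_mono[of "4 * d * L / \<epsilon>" "max 1 (4 * d * L / \<epsilon>)" "t powr (- 1/2)"] by (simp add: r_def)
    have rt: "2 * d * L * (1 / r) * sqrt t \<le> \<epsilon> / 2 * t"
    proof -
      have T: "t powr (- 1/2) * sqrt t = 1" using t by (simp add: powr_minus_divide powr_half_sqrt)
      have "\<epsilon> * (4 * d * L / \<epsilon> * t powr (- 1/2)) \<le> \<epsilon> * r"
        using r2 \<epsilon> by (intro mult_left_mono) auto
      then have "4 * d * L * t powr (- 1/2) \<le> \<epsilon> * r" using \<epsilon> by simp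
      then have "4 * d * L * t powr (- 1/2) * sqrt t \<le> \<epsilon> * r * sqrt t"
        using t by (intro mult_right_mono) auto
      then have "4 * d * L \<le> \<epsilon> * r * sqrt t"
        using T by (simp only: mult.assoc[of "4 * d * L"] mult_1_right)
      then have "4 * d * L * sqrt t \<le> \<epsilon> * r * sqrt t * sqrt t"
        using t by (intro mult_right_mono) auto
      moreover have "sqrt t * sqrt t = t" using t by simp
      ultimately have "4 * d * L * sqrt t \<le> \<epsilon> * r * t" by (simp only: mult.assoc)
      then show ?thesis using r by (simp add: field_simps)
    qed
    have diff: "\<bar>duhamel t j x s - limit_profile j x\<bar> \<le>
        d * (r powr (- p) * (\<epsilon>1 * (1 + C3) + L * (1 / r) * (t - s) powr (- 1/2)))" if s: "0 < s" "s < t" for s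
    proof -
      have sT: "s \<in> {0..T}" using s t by auto
      have "\<bar>(\<integral>y. quad h k s y * oseen_kernel (t - s) h k (x - y) $ j \<partial>lebesgue) - oseen_profile j h k x * moment h k\<bar>
         \<le> r powr (- p) * (\<epsilon>1 * (1 + C3) + L * (1 / r) * (t - s) powr (- 1/2))" for h k
      proof -
        have 1: "\<bar>(\<integral>y. quad h k s y * oseen_kernel (t - s) h k (x - y) $ j \<partial>lebesgue) - oseen_profile j h k x * (\<integral>y. quad h k s y \<partial>lebesgue)\<bar>
          \<le> r powr (- p) * (\<epsilon>1 + L * (1 / r * (t - s) powr (- 1/2)))"
          unfolding r_def p_def using s t r
          by (intro L(2) quad_meas[OF sT] quad_bound[OF sT]) (auto simp: r_def)
        have "\<bar>oseen_profile j h k x\<bar> * \<bar>(\<integral>y. quad h k s y \<partial>lebesgue) - moment h k\<bar> \<le> (C3 * r powr (- p)) * \<epsilon>1"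
        proof (rule mult_mono)
          show "\<bar>oseen_profile j h k x\<bar> \<le> C3 * r powr (- p)"
            using C3(2)[OF x0, of j h k] unfolding norm_square_powr r_def p_def .
          show "\<bar>(\<integral>y. quad h k s y \<partial>lebesgue) - moment h k\<bar> \<le> \<epsilon>1"
            using s t by (intro t1) auto
        qed (use C3 in auto)
        then have 2: "\<bar>oseen_profile j h k x * (\<integral>y. quad h k s y \<partial>lebesgue) - oseen_profile j h k x * moment h k\<bar> \<le> (C3 * r powr (- p)) * \<epsilon>1"
          by (simp only: right_diff_distrib[symmetric] abs_mult)
        have "r powr (- p) * (\<epsilon>1 * (1 + C3) + L * (1 / r) * (t - s) powr (- 1/2)) =
          r powr (- p) * (\<epsilon>1 + L * (1 / r * (t - s) powr (- 1/2))) + (C3 * r powr (- p)) * \<epsilon>1"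
          by (simp add: algebra_simps)
        then show ?thesis using 1 2 by linarith
      qed
      then have "\<bar>\<Sum>h\<in>UNIV. \<Sum>k\<in>UNIV. ((\<integral>y. quad h k s y * oseen_kernel (t - s) h k (x - y) $ j \<partial>lebesgue) - oseen_profile j h k x * moment h k)\<bar>
        \<le> (\<Sum>h\<in>(UNIV::'n set). \<Sum>k\<in>(UNIV::'n set). r powr (- p) * (\<epsilon>1 * (1 + C3) + L * (1 / r) * (t - s) powr (- 1/2)))"
        by (intro order_trans[OF sum_abs] sum_mono)
      then show ?thesis
        unfolding duhamel_eq[OF sT s(2)] limit_profile_def sum_subtractf[symmetric] by (simp add: d_def)
    qed
    let ?g = "\<lambda>s. d * r powr (- p) * (\<epsilon>1 * (1 + C3)) * indicator {0<..<t} s +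
        d * r powr (- p) * (L * (1 / r)) * (indicator {0<..<t} s *\<^sub>R (t - s) powr (- 1/2))"
    have i1: "integrable lborel (\<lambda>s. indicator {0<..<t} s *\<^sub>R duhamel t j x s)"
      using duhamel_integrable[of t j x] t by (simp add: set_integrable_def)
    have i2: "integrable lborel (\<lambda>s. indicator {0<..<t} s :: real)"
      using t(1) by (intro integrable_real_indicator) auto
    have i3: "integrable lborel (\<lambda>s. indicator {0<..<t} s *\<^sub>R (t - s) powr (- 1/2))"
      using integral_time_singularity(1)[OF t(1)] by (simp add: set_integrable_def)
    have e1: "(LINT s:{0<..<t}|lborel. duhamel t j x s) - t * limit_profile j x =
       (\<integral>s. indicator {0<..<t} s *\<^sub>R duhamel t j x s - indicator {0<..<t} s * limit_profile j x \<partial>lborel)"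
      using i1 i2 t unfolding set_lebesgue_integral_def by simp
    have e2: "norm (\<integral>s. indicator {0<..<t} s *\<^sub>R duhamel t j x s - indicator {0<..<t} s * limit_profile j x \<partial>lborel) \<le> (\<integral>s. ?g s \<partial>lborel)"
    proof (rule norm_integral_le_AE)
      show "integrable lborel ?g"
        by (intro Bochner_Integration.integrable_add integrable_mult_right i2 i3)
      show "AE s in lborel. norm (indicator {0<..<t} s *\<^sub>R duhamel t j x s - indicator {0<..<t} s * limit_profile j x) \<le> ?g s"
      proof (rule AE_I2)
        fix s
        show "norm (indicator {0<..<t} s *\<^sub>R duhamel t j x s - indicator {0<..<t} s * limit_profile j x) \<le> ?g s"
          using diff[of s] by (cases "s \<in> {0<..<t}") (simp_all add: algebra_simps)
      qed
    qed
    have e3: "(\<integral>s. ?g s \<partial>lborel) = d * r powr (- p) * (\<epsilon>1 * (1 + C3)) * t + d * r powr (- p) * (L * (1 / r)) * (2 * sqrt t)"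
    proof -
      have "has_bochner_integral lborel (\<lambda>s. indicator {0<..<t} s :: real) t"
        using i2 t(1) by (simp add: has_bochner_integral_iff)
      moreover have "has_bochner_integral lborel (\<lambda>s. indicator {0<..<t} s *\<^sub>R (t - s) powr (- 1/2)) (2 * sqrt t)"
        using i3 integral_time_singularity(2)[OF t(1)]
        by (simp only: has_bochner_integral_iff set_lebesgue_integral_def)
      ultimately have "has_bochner_integral lborel ?g
          (d * r powr (- p) * (\<epsilon>1 * (1 + C3)) * t + d * r powr (- p) * (L * (1 / r)) * (2 * sqrt t))"
        by (intro has_bochner_integral_add has_bochner_integral_mult_right)
      then show ?thesis by (simp only: has_bochner_integral_iff)
    qed
    have "d * r powr (- p) * (\<epsilon>1 * (1 + C3)) * t + d * r powr (- p) * (L * (1 / r)) * (2 * sqrt t) =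
      r powr (- p) * (d * (\<epsilon>1 * (1 + C3)) * t + 2 * d * L * (1 / r) * sqrt t)"
      by (simp only: distrib_left distrib_right mult_ac)
    also have "\<dots> \<le> r powr (- p) * (\<epsilon> / 2 * t + \<epsilon> / 2 * t)"
      unfolding \<epsilon>1(2) by (intro mult_left_mono add_left_mono rt) simp
    also have "\<dots> = \<epsilon> * t * r powr (- p)" by simp
    finally have "norm (\<integral>s. indicator {0<..<t} s *\<^sub>R duhamel t j x s - indicator {0<..<t} s * limit_profile j x \<partial>lborel) \<le> \<epsilon> * t * r powr (- p)"
      using e2 unfolding e3 by (rule order_trans[rotated])
    then show "\<bar>(LINT s:{0<..<t}|lborel. duhamel t j x s) - t * limit_profile j x\<bar> \<le> \<epsilon> * t * norm x powr (- (real CARD('n) + 1))"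
      unfolding e1 real_norm_def r_def p_def .
  qed (use T t1_pos in auto)
qed

text \<open>The linear term O(|x|^(-\<theta>)) has to fit under (\<epsilon>/2) t |x|^(-d-1). For t
  \<le> 1 the threshold with exponent -1/\<gamma>, where \<gamma> is the smaller of 2 and \<theta> -
  d - 1, dominates those of both terms.\<close>

lemma solution_asymptotics:
  assumes \<epsilon>: "\<epsilon> > 0"
  obtains t0 C where "0 < t0" "t0 \<le> T" "C > 0"
    "\<And>t. 0 < t \<Longrightarrow> t \<le> t0 \<Longrightarrow> AE x in lebesgue. norm x \<ge> C * t powr (- 1 / min 2 (\<theta> - real CARD('n) - 1)) \<longrightarrow>
      (\<forall>j. \<bar>u t x $ j + t * limit_profile j x\<bar> \<le> \<epsilon> * t * norm x powr (- (real CARD('n) + 1)))"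
proof -
  define p where "p = real CARD('n) + 1"
  define \<eta> where "\<eta> = \<theta> - p"
  define \<gamma> where "\<gamma> = min 2 \<eta>"
  have \<eta>: "\<eta> > 0" using theta by (simp add: \<eta>_def p_def)
  have \<gamma>: "\<gamma> > 0" "\<gamma> \<le> 2" "\<gamma> \<le> \<eta>" using \<eta> by (auto simp: \<gamma>_def)
  have \<epsilon>2: "\<epsilon> / 2 > 0" using \<epsilon> by simp
  obtain t0 C where t0: "0 < t0" "t0 \<le> T" "t0 \<le> 1" and C: "C \<ge> 1"
    "\<And>t x j. 0 < t \<Longrightarrow> t \<le> t0 \<Longrightarrow> norm x \<ge> C * t powr (- 1/2) \<Longrightarrow>
      \<bar>(LINT s:{0<..<t}|lborel. duhamel t j x s) - t * limit_profile j x\<bar> \<le> \<epsilon> / 2 * t * norm x powr (- (real CARD('n) + 1))"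
    by (rule duhamel_asymptotics[OF \<epsilon>2]) blast
  obtain Ch where Ch: "Ch > 0" "\<And>t x j. 0 < t \<Longrightarrow> t \<le> 1 \<Longrightarrow> \<bar>heat t a x $ j\<bar> \<le> Ch * (1 + norm x) powr (- \<theta>)"
    by (rule heat_far) blast
  \<comment> \<open>With \<eta> = \<theta> - d - 1, the linear term is small once |x|^\<eta> \<ge> 2
    Ch/(\<epsilon> t); the second entry is the \<eta>-th root of the constant part.\<close>
  define C' where "C' = max C ((2 * Ch / \<epsilon>) powr (1 / \<eta>))"
  have C': "C' \<ge> C" "C' > 0" "C' powr \<eta> \<ge> 2 * Ch / \<epsilon>"
  proof -
    show "C' \<ge> C" "C' > 0" using C(1) by (auto simp: C'_def)
    have "2 * Ch / \<epsilon> = ((2 * Ch / \<epsilon>) powr (1 / \<eta>)) powr \<eta>"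
      using \<eta> Ch \<epsilon> by (simp add: powr_powr)
    also have "\<dots> \<le> C' powr \<eta>" using \<eta> by (intro powr_mono2) (auto simp: C'_def)
    finally show "C' powr \<eta> \<ge> 2 * Ch / \<epsilon>" .
  qed
  have main: "\<bar>u t x $ j + t * limit_profile j x\<bar> \<le> \<epsilon> * t * norm x powr (- p)"
    if t: "0 < t" "t \<le> t0" and x: "norm x \<ge> C' * t powr (- 1 / \<gamma>)"
      and eq: "u t x $ j = heat t a x $ j - (LINT s:{0<..<t}|lborel. duhamel t j x s)" for t x j
  proof -
    define r where "r = norm x"
    have t1: "t \<le> 1" using t t0 by simp
    have "t powr (- 1/2) \<le> t powr (- 1 / \<gamma>)"
    proof -
      have "- 1 / \<gamma> \<le> - 1 / 2" using \<gamma> by (simp add: field_simps)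
      then show ?thesis using t t1 by (intro powr_mono') auto
    qed
    then have "C * t powr (- 1/2) \<le> C' * t powr (- 1 / \<gamma>)"
      using C' C by (intro mult_mono) auto
    then have N: "\<bar>(LINT s:{0<..<t}|lborel. duhamel t j x s) - t * limit_profile j x\<bar> \<le> \<epsilon> / 2 * t * r powr (- p)"
      unfolding r_def p_def using x t by (intro C) auto
    have tg: "0 < t powr (- 1 / \<gamma>)" using t by simp
    have r: "r > 0" using x C'(2) tg unfolding r_def by (smt (verit) mult_pos_pos)
    have "Ch * r powr (- \<theta>) \<le> \<epsilon> / 2 * t * r powr (- p)"
    proof -
      have "2 * Ch / \<epsilon> * (1 / t) \<le> C' powr \<eta> * t powr (- \<eta> / \<gamma>)"
      proof (rule mult_mono)
        have "t powr (- 1) \<le> t powr (- \<eta> / \<gamma>)"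
          using t t1 \<gamma> by (intro powr_mono') (auto simp: field_simps)
        then show "1 / t \<le> t powr (- \<eta> / \<gamma>)" using t by (simp add: powr_minus_divide)
      qed (use C' t in auto)
      also have "\<dots> = (C' * t powr (- 1 / \<gamma>)) powr \<eta>"
        using C' t by (simp add: powr_mult powr_powr)
      also have "\<dots> \<le> r powr \<eta>"
        using x \<eta> C' tg unfolding r_def by (intro powr_mono2) auto
      finally have "Ch \<le> \<epsilon> / 2 * t * r powr \<eta>"
        using \<epsilon> t by (simp add: field_simps)
      then have "Ch * r powr (- \<theta>) \<le> \<epsilon> / 2 * t * r powr \<eta> * r powr (- \<theta>)"
        by (rule mult_right_mono) simp
      also have "\<dots> = \<epsilon> / 2 * t * (r powr \<eta> * r powr (- \<theta>))" by simp
      also have "r powr \<eta> * r powr (- \<theta>) = r powr (- p)"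
        unfolding powr_add[symmetric] \<eta>_def by simp
      finally show ?thesis .
    qed
    moreover have "\<bar>heat t a x $ j\<bar> \<le> Ch * r powr (- \<theta>)"
    proof -
      have "(1 + norm x) powr (- \<theta>) \<le> r powr (- \<theta>)"
        using r theta unfolding r_def by (intro powr_mono2') auto
      then show ?thesis using Ch(2)[OF t(1) t1, of x j] Ch(1) by (meson less_imp_le mult_left_mono order_trans)
    qed
    ultimately have "\<bar>heat t a x $ j\<bar> \<le> \<epsilon> / 2 * t * r powr (- p)" by linarith
    with N show ?thesis unfolding eq r_def by linarith
  qed
  show thesis
  proof (rule that[of t0 C'])
    fix t assume t: "0 < t" "t \<le> t0"
    then have "t \<le> T" using t0 by simp
    from mild_component[OF t(1) this]
    show "AE x in lebesgue. norm x \<ge> C' * t powr (- 1 / min 2 (\<theta> - real CARD('n) - 1)) \<longrightarrow>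
      (\<forall>j. \<bar>u t x $ j + t * limit_profile j x\<bar> \<le> \<epsilon> * t * norm x powr (- (real CARD('n) + 1)))"
    proof eventually_elim
      case (elim x)
      have "min 2 (\<theta> - real CARD('n) - 1) = \<gamma>" by (simp add: \<gamma>_def \<eta>_def p_def algebra_simps)
      then show ?case using main[OF t, of x] elim by (auto simp: p_def)
    qed
  qed (use t0 C' in auto)
qed

end

section \<open>Lower bounds\<close>

lemma sum_of_bool_mem:
  fixes f :: "'n::finite \<Rightarrow> real"
  shows "(\<Sum>h\<in>UNIV. of_bool (h \<in> S) * f h) = sum f S"
  by (simp add: of_bool_def if_distrib[of "\<lambda>c. c * _"] sum.If_cases cong: if_cong)

text \<open>
  Up to a positive factor the profile is
  \<open>\<bar>z\<bar>\<^sup>2 (2 (A z)\<^sub>j + tr A z\<^sub>j) - (d + 2) (z \<bullet> A z) z\<^sub>j\<close>; testing it on indicator vectors of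
  sets with at most three elements shows that it vanishes only if \<open>A\<close> is scalar.
\<close>

lemma oseen_profile_sum_nonzero:
  fixes A :: "'n::finite \<Rightarrow> 'n \<Rightarrow> real"
  assumes sym: "\<And>h k. A h k = A k h"
    and nonscalar: "\<exists>m n. m \<noteq> n \<and> (A m n \<noteq> 0 \<or> A m m \<noteq> A n n)"
  shows "\<exists>z. z \<noteq> 0 \<and> (\<Sum>h\<in>UNIV. \<Sum>k\<in>UNIV. oseen_profile j h k z * A h k) \<noteq> 0"
proof (rule ccontr)
  assume "\<not> ?thesis"
  then have zero: "(\<Sum>h\<in>UNIV. \<Sum>k\<in>UNIV. oseen_profile j h k z * A h k) = 0" if "z \<noteq> 0" for z :: "real^'n"
    using that by blast
  define tr where "tr = (\<Sum>h\<in>UNIV. A h h)"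
  \<comment> \<open>For the indicator vector of S, |z|^2 is the cardinality of S, and vanishing of
    the profile becomes a linear relation between entries of A. The index j is fixed throughout:
    each single component already detects a nonscalar matrix.\<close>
  have id: "real (card S) * (2 * (\<Sum>k\<in>S. A j k) + of_bool (j \<in> S) * tr) =
      (real CARD('n) + 2) * (of_bool (j \<in> S) * (\<Sum>h\<in>S. \<Sum>k\<in>S. A h k))" if "S \<noteq> {}" for S
  proof -
    define z :: "real^'n" where "z = (\<chi> h. of_bool (h \<in> S))"
    have z: "z $ h = of_bool (h \<in> S)" for h by (simp add: z_def)
    have z0: "z \<noteq> 0" using that by (auto simp: vec_eq_iff z)
    have nz: "(norm z)\<^sup>2 = real (card S)"
    proof -
      have "(norm z)\<^sup>2 = (\<Sum>h\<in>UNIV. (z $ h)\<^sup>2)"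
        by (simp add: norm_vec_def L2_set_def sum_nonneg)
      also have "\<dots> = (\<Sum>h\<in>UNIV. of_bool (h \<in> S) * (1::real))"
        by (intro sum.cong refl) (auto simp: z)
      finally have "(norm z)\<^sup>2 = (\<Sum>h\<in>UNIV. of_bool (h \<in> S) * (1::real))" .
      then show ?thesis unfolding sum_of_bool_mem by simp
    qed
    have s1: "(\<Sum>h\<in>UNIV. \<Sum>k\<in>UNIV. oseen_sym j h k z * A h k) = 2 * (\<Sum>k\<in>S. A j k) + of_bool (j \<in> S) * tr"
    proof -
      have "(\<Sum>h\<in>UNIV. \<Sum>k\<in>UNIV. oseen_sym j h k z * A h k) =
         (\<Sum>h\<in>UNIV. \<Sum>k\<in>UNIV. of_bool (h = j) * (of_bool (k \<in> S) * A h k)) +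
         (\<Sum>h\<in>UNIV. \<Sum>k\<in>UNIV. of_bool (k = j) * (of_bool (h \<in> S) * A h k)) +
         (\<Sum>h\<in>UNIV. \<Sum>k\<in>UNIV. of_bool (k = h) * (of_bool (j \<in> S) * A h k))"
        unfolding sum.distrib[symmetric] oseen_sym_def z by (intro sum.cong refl) (auto simp: algebra_simps)
      also have "(\<Sum>h\<in>UNIV. \<Sum>k\<in>UNIV. of_bool (h = j) * (of_bool (k \<in> S) * A h k)) = (\<Sum>k\<in>S. A j k)"
      proof -
        have "(\<Sum>h\<in>UNIV. \<Sum>k\<in>UNIV. of_bool (h = j) * (of_bool (k \<in> S) * A h k)) =
            (\<Sum>h\<in>UNIV. of_bool (h \<in> {j}) * (\<Sum>k\<in>UNIV. of_bool (k \<in> S) * A h k))"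
          by (simp only: sum_distrib_left singleton_iff)
        then show ?thesis unfolding sum_of_bool_mem by simp
      qed
      also have "(\<Sum>h\<in>UNIV. \<Sum>k\<in>UNIV. of_bool (k = j) * (of_bool (h \<in> S) * A h k)) = (\<Sum>k\<in>S. A j k)"
      proof -
        have "(\<Sum>k\<in>UNIV. of_bool (k = j) * (of_bool (h \<in> S) * A h k)) = of_bool (h \<in> S) * A h j" for h
          using sum_of_bool_mem[of "{j}" "\<lambda>k. of_bool (h \<in> S) * A h k"] by simp
        then show ?thesis using sum_of_bool_mem[of S "\<lambda>h. A h j"] by (simp add: sym[of _ j])
      qed
      also have "(\<Sum>h\<in>UNIV. \<Sum>k\<in>UNIV. of_bool (k = h) * (of_bool (j \<in> S) * A h k)) = of_bool (j \<in> S) * tr"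
      proof -
        have "(\<Sum>k\<in>UNIV. of_bool (k = h) * (of_bool (j \<in> S) * A h k)) = of_bool (j \<in> S) * A h h" for h
          using sum_of_bool_mem[of "{h}" "\<lambda>k. of_bool (j \<in> S) * A h k"] by simp
        then show ?thesis by (simp add: tr_def sum_distrib_left)
      qed
      finally show ?thesis by simp
    qed
    have s2: "(\<Sum>h\<in>UNIV. \<Sum>k\<in>UNIV. z $ j * z $ h * z $ k * A h k) = of_bool (j \<in> S) * (\<Sum>h\<in>S. \<Sum>k\<in>S. A h k)"
    proof -
      have "(\<Sum>h\<in>UNIV. \<Sum>k\<in>UNIV. z $ j * z $ h * z $ k * A h k) =
        of_bool (j \<in> S) * (\<Sum>h\<in>UNIV. of_bool (h \<in> S) * (\<Sum>k\<in>UNIV. of_bool (k \<in> S) * A h k))"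
        unfolding z by (simp only: sum_distrib_left mult.assoc)
      then show ?thesis unfolding sum_of_bool_mem .
    qed
    define c where "c = profile_const TYPE('n) * ((norm z)\<^sup>2) powr (- (real CARD('n) / 2 + 2))"
    have c: "c \<noteq> 0" using profile_const_pos[where 'n='n] z0 by (simp add: c_def)
    have "(\<Sum>h\<in>UNIV. \<Sum>k\<in>UNIV. oseen_profile j h k z * A h k) =
      (\<Sum>h\<in>UNIV. \<Sum>k\<in>UNIV. c * ((norm z)\<^sup>2 * (oseen_sym j h k z * A h k) - (real CARD('n) + 2) * (z $ j * z $ h * z $ k * A h k)))"
      unfolding oseen_profile_eq[OF z0] c_def by (intro sum.cong refl) (simp add: algebra_simps)
    also have "\<dots> = c * ((norm z)\<^sup>2 * (\<Sum>h\<in>UNIV. \<Sum>k\<in>UNIV. oseen_sym j h k z * A h k) -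
        (real CARD('n) + 2) * (\<Sum>h\<in>UNIV. \<Sum>k\<in>UNIV. z $ j * z $ h * z $ k * A h k))"
      by (simp only: sum_distrib_left[symmetric] sum_subtractf)
    finally show ?thesis using zero[OF z0] c unfolding s1 s2 nz by simp
  qed
  \<comment> \<open>S = {i} without j isolates the off-diagonal entry in row j.\<close>
  have off: "A j i = 0" if "i \<noteq> j" for i
    using id[of "{i}"] that by simp
  \<comment> \<open>S = {j} expresses the trace as d times the entry \<open>A j j\<close>.\<close>
  have jj: "2 * A j j + tr = (real CARD('n) + 2) * A j j"
    using id[of "{j}"] by simp
  have d: "real CARD('n) + 2 \<noteq> 0" by linarith
  \<comment> \<open>S = {j, i}: with the entries of row j gone and the trace eliminated by
    \<open>jj\<close>, the two diagonal entries must agree.\<close>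
  have diag: "A i i = A j j" for i
  proof (cases "i = j")
    case False
    then have "2 * (2 * A j j + tr) = (real CARD('n) + 2) * (A j j + A i i)"
      using id[of "{j, i}"] off[OF False] sym[of i j] by simp
    then have "(real CARD('n) + 2) * (2 * A j j) = (real CARD('n) + 2) * (A j j + A i i)"
      unfolding jj by simp
    then show ?thesis using d by (simp only: mult_cancel_left) simp
  qed simp
  \<comment> \<open>S = {j, i, l} reaches the entries outside row and column j; the diagonal terms
    cancel and twice \<open>A i l\<close> remains.\<close>
  have rest: "A i l = 0" if "i \<noteq> l" for i l
  proof (cases "i = j \<or> l = j")
    case True
    then show ?thesis using off[of i] off[of l] sym[of i l] that by auto
  next
    case False
    then have "j \<noteq> i" "j \<noteq> l" by auto
    then have "3 * (2 * A j j + tr) = (real CARD('n) + 2) * (A j j + A i i + A l l + 2 * A i l)"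
      using id[of "{j, i, l}"] off[of i] off[of l] sym[of i j] sym[of l j] sym[of l i] that by simp
    then have "(real CARD('n) + 2) * (3 * A j j) = (real CARD('n) + 2) * (3 * A j j + 2 * A i l)"
      unfolding jj diag[of i] diag[of l] by simp
    then show ?thesis using d by (simp only: mult_cancel_left) simp
  qed
  show False using nonscalar rest diag by metis
qed

text \<open>A point where Q does not vanish is moved slightly along e_k off the hyperplane of
  vanishing k-th coordinate, which the weight |x_k| requires, and scaled to norm 3/2, inside the
  annulus 1 < |y| < 2. Dilates by R of a small ball there stay between the radii R and 2R.\<close>

lemma homogeneous_ball:
  fixes Q :: "real^'n::finite \<Rightarrow> real"
  assumes cont: "continuous_on (- {0}) Q"
    and hom: "\<And>r z. r > 0 \<Longrightarrow> z \<noteq> 0 \<Longrightarrow> Q (r *\<^sub>R z) = r powr e * Q z"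
    and nz: "z \<noteq> 0" "Q z \<noteq> 0"
  obtains z0 \<rho> q b where "\<rho> > 0" "q > 0" "b > 0"
    "\<And>y. y \<in> ball z0 \<rho> \<Longrightarrow> 1 < norm y \<and> norm y < 2 \<and> q \<le> \<bar>Q y\<bar> \<and> b \<le> \<bar>y $ k\<bar>"
proof -
  have isC: "isCont Q y" if "y \<noteq> 0" for y
    using cont that by (simp add: continuous_on_eq_continuous_at open_Compl)
  obtain y1 where y1: "y1 \<noteq> 0" "Q y1 \<noteq> 0" "y1 $ k \<noteq> 0"
  proof (cases "z $ k = 0")
    case False
    then show ?thesis using that nz by blast
  next
    case True
    have "((\<lambda>s. z + s *\<^sub>R axis k 1) \<longlongrightarrow> z + 0 *\<^sub>R axis k 1) (at_right 0)"
      by (intro tendsto_intros)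
    then have l: "((\<lambda>s. z + s *\<^sub>R axis k 1) \<longlongrightarrow> z) (at_right 0)" by simp
    have "((\<lambda>s. Q (z + s *\<^sub>R axis k 1)) \<longlongrightarrow> Q z) (at_right 0)"
      by (rule isCont_tendsto_compose[OF isC[OF nz(1)] l])
    then have "eventually (\<lambda>s. Q (z + s *\<^sub>R axis k 1) \<noteq> 0) (at_right 0)"
      by (rule tendsto_imp_eventually_ne[OF _ nz(2)])
    moreover have "eventually (\<lambda>s. z + s *\<^sub>R axis k 1 \<noteq> 0) (at_right 0)"
      by (rule tendsto_imp_eventually_ne[OF l nz(1)])
    moreover have "eventually (\<lambda>s::real. s > 0) (at_right 0)" by (simp add: eventually_at_right_less)
    ultimately have "eventually (\<lambda>s. Q (z + s *\<^sub>R axis k 1) \<noteq> 0 \<and> z + s *\<^sub>R axis k 1 \<noteq> 0 \<and> s > 0) (at_right 0)"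
      by eventually_elim blast
    then obtain s where "Q (z + s *\<^sub>R axis k 1) \<noteq> 0" "z + s *\<^sub>R axis k 1 \<noteq> 0" "s > 0"
      using eventually_happens'[OF trivial_limit_at_right_real] by blast
    then show ?thesis using that[of "z + s *\<^sub>R axis k 1"] True by (simp add: axis_def)
  qed
  define r where "r = 3 / 2 / norm y1"
  have r: "r > 0" using y1 by (simp add: r_def)
  define z0 where "z0 = r *\<^sub>R y1"
  have z0: "z0 \<noteq> 0" "norm z0 = 3/2" "Q z0 \<noteq> 0" "z0 $ k \<noteq> 0"
    using y1 r hom[OF r y1(1)] by (simp_all add: z0_def) (simp add: r_def)
  have id: "((\<lambda>y. y) \<longlongrightarrow> z0) (nhds z0)" by (rule filterlim_ident)
  have Qt: "(Q \<longlongrightarrow> Q z0) (nhds z0)"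
    using isC[OF z0(1)] by (simp add: isCont_def tendsto_nhds_iff)
  have "eventually (\<lambda>y. 1 < norm y) (nhds z0)" "eventually (\<lambda>y. norm y < 2) (nhds z0)"
    using tendsto_norm[OF id] z0(2) by (auto intro: order_tendstoD)
  moreover have "eventually (\<lambda>y. \<bar>Q z0\<bar> / 2 < \<bar>Q y\<bar>) (nhds z0)"
    by (rule order_tendstoD[OF tendsto_rabs[OF Qt]]) (use z0 in simp)
  moreover have "eventually (\<lambda>y. \<bar>z0 $ k\<bar> / 2 < \<bar>y $ k\<bar>) (nhds z0)"
    by (rule order_tendstoD[OF tendsto_rabs[OF tendsto_vec_nth[OF id]]]) (use z0 in simp)
  ultimately have "eventually (\<lambda>y. 1 < norm y \<and> norm y < 2 \<and> \<bar>Q z0\<bar> / 2 \<le> \<bar>Q y\<bar> \<and> \<bar>z0 $ k\<bar> / 2 \<le> \<bar>y $ k\<bar>) (nhds z0)"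
    by eventually_elim auto
  then obtain \<rho> where "\<rho> > 0" "\<And>y. dist y z0 < \<rho> \<Longrightarrow> 1 < norm y \<and> norm y < 2 \<and> \<bar>Q z0\<bar> / 2 \<le> \<bar>Q y\<bar> \<and> \<bar>z0 $ k\<bar> / 2 \<le> \<bar>y $ k\<bar>"
    unfolding eventually_nhds_metric by blast
  then show thesis
    using that[of \<rho> "\<bar>Q z0\<bar> / 2" "\<bar>z0 $ k\<bar> / 2" z0] z0 by (simp add: dist_commute)
qed

section \<open>From lower bounds on dilated balls to integrals of the solution\<close>

lemma emeasure_scaled_ball:
  fixes z0 :: "real^'n::finite"
  assumes "R \<ge> 0" "\<rho> \<ge> 0"
  shows "emeasure lebesgue (ball (R *\<^sub>R z0) (R * \<rho>)) = ennreal (unit_ball_vol (real CARD('n)) * (R * \<rho>) ^ CARD('n))"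
  using emeasure_ball[of "R * \<rho>" "R *\<^sub>R z0"] assms by simp

lemma scaled_ball:
  fixes z0 :: "real^'n::finite"
  assumes R: "R > 0" and x: "x \<in> ball (R *\<^sub>R z0) (R * \<rho>)"
  obtains y where "y \<in> ball z0 \<rho>" "x = R *\<^sub>R y"
proof
  show "x = R *\<^sub>R ((1 / R) *\<^sub>R x)" using R by simp
  have "dist (R *\<^sub>R z0) (R *\<^sub>R ((1 / R) *\<^sub>R x)) = R * dist z0 ((1 / R) *\<^sub>R x)"
    using R by (simp only: dist_norm scaleR_diff_right[symmetric] norm_scaleR)
  then show "(1 / R) *\<^sub>R x \<in> ball z0 \<rho>" using x R by simp
qed

context decaying_mild_solution
begin

lemma limit_profile_continuous: "continuous_on (- {0}) (limit_profile j)"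
  unfolding limit_profile_def by (intro continuous_on_sum continuous_on_mult continuous_on_const continuous_on_oseen_profile)

lemma limit_profile_scaleR:
  assumes "r > 0" "z \<noteq> 0"
  shows "limit_profile j (r *\<^sub>R z) = r powr (- (real CARD('n) + 1)) * limit_profile j z"
  unfolding limit_profile_def oseen_profile_scaleR[OF assms] by (simp add: sum_distrib_left mult.assoc)

text \<open>A finite minimum makes q common to all components: it fixes the precision of the
  asymptotics and thereby t0 and C, which must not depend on j. The radii and the bounds on |y_k|
  may depend on the indices.\<close>

lemma limit_profile_ball:
  assumes "\<exists>m n. m \<noteq> n \<and> (moment m n \<noteq> 0 \<or> moment m m \<noteq> moment n n)"
  obtains z0 \<rho> q b where "\<And>j k. \<rho> j k > 0" "q > 0" "\<And>j k. b j k > 0"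
    "\<And>j k y. y \<in> ball (z0 j k) (\<rho> j k) \<Longrightarrow> 1 < norm y \<and> norm y < 2 \<and> q \<le> \<bar>limit_profile j y\<bar> \<and> b j k \<le> \<bar>y $ k\<bar>"
proof -
  have "\<exists>z0 \<rho> q b. \<rho> > 0 \<and> q > 0 \<and> b > 0 \<and>
    (\<forall>y. y \<in> ball z0 \<rho> \<longrightarrow> 1 < norm y \<and> norm y < 2 \<and> q \<le> \<bar>limit_profile j y\<bar> \<and> b \<le> \<bar>y $ k\<bar>)" for j k
  proof -
    have "\<exists>z. z \<noteq> 0 \<and> limit_profile j z \<noteq> 0"
      unfolding limit_profile_def
      by (rule oseen_profile_sum_nonzero[OF _ assms]) (simp add: moment_def mult.commute)
    then obtain z where z: "z \<noteq> 0" "limit_profile j z \<noteq> 0" by blast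
    show ?thesis
      by (rule homogeneous_ball[OF limit_profile_continuous limit_profile_scaleR z, of k]) blast+
  qed
  then obtain z0 \<rho> q b where *: "\<And>j k. \<rho> j k > 0" "\<And>j k. q j k > 0" "\<And>j k. b j k > 0"
    "\<And>j k y. y \<in> ball (z0 j k) (\<rho> j k) \<Longrightarrow> 1 < norm y \<and> norm y < 2 \<and> q j k \<le> \<bar>limit_profile j y\<bar> \<and> b j k \<le> \<bar>y $ k\<bar>"
    by metis
  define q0 where "q0 = Min (range (\<lambda>(j, k). q j k))"
  have q0: "q0 \<le> q j k" for j k
    unfolding q0_def by (rule Min_le) (auto intro: image_eqI[of _ _ "(j, k)"])
  have "q0 \<in> range (\<lambda>(j, k). q j k)" unfolding q0_def by (rule Min_in) auto
  then have "q0 > 0" using *(2) by auto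
  show thesis
  proof (rule that[of \<rho> q0 b z0])
    fix j k y assume "y \<in> ball (z0 j k) (\<rho> j k)"
    then show "1 < norm y \<and> norm y < 2 \<and> q0 \<le> \<bar>limit_profile j y\<bar> \<and> b j k \<le> \<bar>y $ k\<bar>"
      using *(4)[of y j k] q0[of j k] by linarith
  qed (use * \<open>q0 > 0\<close> in auto)
qed

text \<open>On the dilated ball the profile has size at least q R^(-d-1), and precision q/2 in the
  asymptotics leaves half of it.\<close>

lemma pointwise_lower_bound:
  assumes q: "q > 0"
    and ball: "\<And>y. y \<in> ball z0 \<rho> \<Longrightarrow> 1 < norm y \<and> norm y < 2 \<and> q \<le> \<bar>limit_profile j y\<bar>"
    and ae: "AE x in lebesgue. norm x \<ge> R0 \<longrightarrow>
      (\<forall>j. \<bar>u t x $ j + t * limit_profile j x\<bar> \<le> q / 2 * t * norm x powr (- (real CARD('n) + 1)))"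
    and R: "R \<ge> R0" "R > 0" and t: "t > 0"
  shows "AE x in lebesgue. x \<in> ball (R *\<^sub>R z0) (R * \<rho>) \<longrightarrow> t * (q / 2) * R powr (- (real CARD('n) + 1)) \<le> \<bar>u t x $ j\<bar>"
  using ae
proof eventually_elim
  case (elim x)
  let ?p = "- (real CARD('n) + 1)"
  show ?case
  proof
    assume "x \<in> ball (R *\<^sub>R z0) (R * \<rho>)"
    then obtain y where y: "y \<in> ball z0 \<rho>" "x = R *\<^sub>R y" by (rule scaled_ball[OF R(2)])
    have y': "1 < norm y" "q \<le> \<bar>limit_profile j y\<bar>" using ball[OF y(1)] by auto
    have y0: "y \<noteq> 0" using y'(1) by (cases "y = 0") auto
    have nx: "norm x \<ge> R" using y' R by (simp add: y(2))
    have "norm x powr ?p \<le> R powr ?p" using nx R by (intro powr_mono2') auto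
    then have "q / 2 * t * norm x powr ?p \<le> q / 2 * t * R powr ?p"
      using q t by (intro mult_left_mono) auto
    moreover have "\<bar>u t x $ j + t * limit_profile j x\<bar> \<le> q / 2 * t * norm x powr ?p"
      using elim nx R by auto
    ultimately have 1: "\<bar>u t x $ j + t * limit_profile j x\<bar> \<le> q / 2 * t * R powr ?p" by linarith
    have "\<bar>t * limit_profile j x\<bar> = t * (R powr ?p * \<bar>limit_profile j y\<bar>)"
      unfolding y(2) limit_profile_scaleR[OF R(2) y0] using t by (simp add: abs_mult)
    also have "\<dots> \<ge> t * (R powr ?p * q)"
      using y' t by (intro mult_left_mono) auto
    finally have "t * (R powr ?p * q) \<le> \<bar>t * limit_profile j x\<bar>" .
    moreover have "t * (R powr ?p * q) = 2 * (q / 2 * t * R powr ?p)" by simp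
    moreover have "t * (q / 2) * R powr ?p = q / 2 * t * R powr ?p" by simp
    ultimately show "t * (q / 2) * R powr ?p \<le> \<bar>u t x $ j\<bar>" using 1 by linarith
  qed
qed

lemma u_nth_meas:
  assumes "t \<in> {0..T}"
  shows "(\<lambda>x. u t x $ j) \<in> borel_measurable lebesgue"
proof -
  have "(\<lambda>v::real^'n. v $ j) \<in> borel_measurable borel" by measurable
  then show ?thesis by (rule measurable_compose[OF u_meas[OF assms]])
qed

lemma u_nth_integrable:
  assumes "t \<in> {0..T}"
  shows "integrable lebesgue (\<lambda>x. \<bar>u t x $ j\<bar>)"
proof (rule Bochner_Integration.integrable_bound)
  show "integrable lebesgue (\<lambda>y::real^'n. M * decay_weight y)"
    by (intro integrable_mult_right integrable_decay_weight_lebesgue)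
  show "(\<lambda>x. \<bar>u t x $ j\<bar>) \<in> borel_measurable lebesgue"
    by (intro borel_measurable_abs u_nth_meas assms)
  show "AE x in lebesgue. norm \<bar>u t x $ j\<bar> \<le> norm (M * decay_weight x)"
    using u_bound[OF assms]
  proof eventually_elim
    case (elim x)
    then have "\<bar>u t x $ j\<bar> \<le> M * decay_weight x"
      by (rule order_trans[OF component_le_norm_cart])
    then show ?case by simp
  qed
qed

text \<open>The ball has volume of order R^d and the solution has size at least of order t R^(-d-1)
  on it, whence t/R.\<close>

lemma annulus_lower_bound:
  assumes t: "t \<in> {0..T}" "t > 0" and R: "R > 0" and \<rho>: "\<rho> > 0" and q: "q > 0"
    and ball: "\<And>y. y \<in> ball z0 \<rho> \<Longrightarrow> 1 < norm y \<and> norm y < 2"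
    and ae: "AE x in lebesgue. x \<in> ball (R *\<^sub>R z0) (R * \<rho>) \<longrightarrow> t * (q / 2) * R powr (- (real CARD('n) + 1)) \<le> \<bar>u t x $ j\<bar>"
  shows "q / 2 * (unit_ball_vol (real CARD('n)) * \<rho> ^ CARD('n)) * t / R \<le>
    (LINT x:{x. R \<le> norm x \<and> norm x \<le> 2 * R}|lebesgue. \<bar>u t x $ j\<bar>)"
proof -
  define c where "c = t * (q / 2) * R powr (- (real CARD('n) + 1))"
  let ?A = "{x :: real^'n. R \<le> norm x \<and> norm x \<le> 2 * R}"
  let ?B = "ball (R *\<^sub>R z0) (R * \<rho>)"
  have A: "?A \<in> sets lebesgue"
  proof -
    have "closed ?A" by (intro closed_Collect_conj closed_Collect_le continuous_intros)
    then show ?thesis by (intro sets_completionI_sets) auto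
  qed
  have B: "?B \<in> sets lebesgue" by (intro sets_completionI_sets) auto
  have em: "emeasure lebesgue ?B = ennreal (unit_ball_vol (real CARD('n)) * (R * \<rho>) ^ CARD('n))"
    using R \<rho> by (intro emeasure_scaled_ball) auto
  have hb: "has_bochner_integral lebesgue (indicator ?B :: _ \<Rightarrow> real) (measure lebesgue ?B)"
    using em by (intro has_bochner_integral_real_indicator B) simp
  have mB: "measure lebesgue ?B = unit_ball_vol (real CARD('n)) * (R * \<rho>) ^ CARD('n)"
    unfolding measure_def em using R \<rho> by simp
  have sub: "R \<le> norm x \<and> norm x \<le> 2 * R" if x: "x \<in> ?B" for x
  proof -
    obtain y where y: "y \<in> ball z0 \<rho>" "x = R *\<^sub>R y" by (rule scaled_ball[OF R x])
    show ?thesis using ball[OF y(1)] R by (simp add: y(2) mult.commute)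
  qed
  have hbc: "has_bochner_integral lebesgue (\<lambda>x. indicator ?B x * c) (measure lebesgue ?B * c)"
    by (intro has_bochner_integral_mult_left hb)
  have "measure lebesgue ?B * c = (\<integral>x. indicator ?B x * c \<partial>lebesgue)"
    using hbc by (simp only: has_bochner_integral_iff)
  also have "\<dots> \<le> (\<integral>x. indicator ?A x *\<^sub>R \<bar>u t x $ j\<bar> \<partial>lebesgue)"
  proof (rule integral_mono_AE)
    show "integrable lebesgue (\<lambda>x. indicator ?B x * c)" using hbc by (simp only: has_bochner_integral_iff)
    show "integrable lebesgue (\<lambda>x. indicator ?A x *\<^sub>R \<bar>u t x $ j\<bar>)"
      by (intro integrable_mult_indicator A u_nth_integrable t)
    show "AE x in lebesgue. indicator ?B x * c \<le> indicator ?A x *\<^sub>R \<bar>u t x $ j\<bar>"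
      using ae
    proof eventually_elim
      case (elim x)
      show ?case
      proof (cases "x \<in> ?B")
        case True
        then show ?thesis using elim sub[OF True] by (simp add: c_def)
      next
        case False
        then show ?thesis by simp
      qed
    qed
  qed
  finally have le: "measure lebesgue ?B * c \<le> (LINT x:?A|lebesgue. \<bar>u t x $ j\<bar>)"
    unfolding set_lebesgue_integral_def .
  have "measure lebesgue ?B * c = q / 2 * (unit_ball_vol (real CARD('n)) * \<rho> ^ CARD('n)) * t / R"
  proof -
    have "R ^ CARD('n) * R powr (- (real CARD('n) + 1)) = 1 / R"
    proof -
      have "R ^ CARD('n) * R powr (- (real CARD('n) + 1)) = R powr real CARD('n) * R powr (- (real CARD('n) + 1))"
        using R by (simp add: powr_realpow)
      also have "\<dots> = R powr (- 1)" unfolding powr_add[symmetric] by simp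
      finally show ?thesis using R by (simp add: powr_minus_divide)
    qed
    then have "(R ^ CARD('n) * R powr (- (real CARD('n) + 1))) * (q / 2 * (unit_ball_vol (real CARD('n)) * \<rho> ^ CARD('n)) * t) =
      (1 / R) * (q / 2 * (unit_ball_vol (real CARD('n)) * \<rho> ^ CARD('n)) * t)" by (simp only:)
    then show ?thesis unfolding mB c_def power_mult_distrib by (simp add: mult_ac)
  qed
  with le show ?thesis by (simp only:)
qed

text \<open>Dilated balls at geometrically growing radii are disjoint, and each contributes at least
  \<kappa>. The contribution scales like R^(\<alpha>p - (d+1)p + d), whose exponent is nonnegative
  exactly under the stated condition; in the borderline case it is the number of balls that makes
  the integral diverge.\<close>

lemma weighted_integral_infinite:
  assumes t: "t > 0" and \<rho>: "\<rho> > 0" and q: "q > 0" and b: "b > 0"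
    and ball: "\<And>y. y \<in> ball z0 \<rho> \<Longrightarrow> 1 < norm y \<and> norm y < 2 \<and> b \<le> \<bar>y $ k\<bar>"
    and ae: "\<And>R. R \<ge> R0 \<Longrightarrow> R > 0 \<Longrightarrow>
      AE x in lebesgue. x \<in> ball (R *\<^sub>R z0) (R * \<rho>) \<longrightarrow> t * (q / 2) * R powr (- (real CARD('n) + 1)) \<le> \<bar>u t x $ j\<bar>"
    and p: "1 \<le> p" and \<alpha>: "\<alpha> + real CARD('n) / p \<ge> real CARD('n) + 1"
  shows "(\<integral>\<^sup>+ x. ennreal (\<bar>x $ k\<bar> powr (\<alpha> * p) * \<bar>u t x $ j\<bar> powr p) \<partial>lebesgue) = \<infinity>"
proof -
  define d where "d = real CARD('n)"
  let ?f = "\<lambda>x. ennreal (\<bar>x $ k\<bar> powr (\<alpha> * p) * \<bar>u t x $ j\<bar> powr p)"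
  have "d / p \<le> d" using p by (simp add: d_def divide_le_eq mult_le_cancel_left1)
  \<comment> \<open>As p \<ge> 1, the condition forces \<alpha> \<ge> 1. A nonnegative exponent is
    what turns a lower bound for |x_k| into one for its power.\<close>
  then have \<alpha>p: "\<alpha> * p \<ge> 0" using \<alpha> p by (simp add: d_def)
  have ex: "\<alpha> * p - (d + 1) * p + d \<ge> 0"
  proof -
    have "(d + 1) * p \<le> (\<alpha> + d / p) * p" using \<alpha> p by (intro mult_right_mono) (auto simp: d_def)
    also have "\<dots> = \<alpha> * p + d" using p by (simp add: distrib_right)
    finally show ?thesis by simp
  qed
  define V where "V = unit_ball_vol d * \<rho> ^ CARD('n)"
  have V: "V > 0" unfolding V_def d_def using \<rho> by simp
  define \<kappa> where "\<kappa> = b powr (\<alpha> * p) * (t * (q / 2)) powr p * V"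
  have \<kappa>: "\<kappa> > 0" unfolding \<kappa>_def using b t q V by simp
  \<comment> \<open>The ratio 3 exceeds the ratio 2 between the radii of one annulus, which
    separates consecutive annuli. Starting at 1 or beyond makes nonnegative powers of R at least
    1.\<close>
  define R where "R i = max 1 R0 * 3 ^ i" for i :: nat
  have R: "R i \<ge> R0" "R i \<ge> 1" "R i > 0" for i
  proof -
    have "max 1 R0 * 1 \<le> R i" unfolding R_def by (intro mult_left_mono) auto
    then show "R i \<ge> R0" "R i \<ge> 1" "R i > 0" by auto
  qed
  define B where "B i = ball (R i *\<^sub>R z0) (R i * \<rho>)" for i
  define c where "c i = (b * R i) powr (\<alpha> * p) * (t * (q / 2) * R i powr (- (d + 1))) powr p" for i
  have c0: "c i \<ge> 0" for i by (simp add: c_def)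
  have Bn: "R i < norm x \<and> norm x < 2 * R i \<and> b * R i \<le> \<bar>x $ k\<bar>" if "x \<in> B i" for i x
  proof -
    obtain y where y: "y \<in> ball z0 \<rho>" "x = R i *\<^sub>R y" using scaled_ball[OF R(3)] \<open>x \<in> B i\<close> unfolding B_def by blast
    show ?thesis using ball[OF y(1)] R(3)[of i] by (simp add: y(2) abs_mult mult.commute mult_left_mono)
  qed
  have disj: "i = i'" if "x \<in> B i" "x \<in> B i'" for i i' x
  proof -
    have no: False if "x \<in> B i" "x \<in> B i'" "i < i'" for i i'
    proof -
      have "(3::real) ^ Suc i \<le> 3 ^ i'" using that by (intro power_increasing) auto
      then have "max 1 R0 * 3 ^ Suc i \<le> max 1 R0 * 3 ^ i'" by (intro mult_left_mono) auto
      then have "3 * R i \<le> R i'" by (simp add: R_def)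
      then show False using Bn[OF that(1)] Bn[OF that(2)] R(3)[of i] by linarith
    qed
    show ?thesis using no[of i i'] no[of i' i] that by (cases i i' rule: linorder_cases) auto
  qed
  have cB: "ennreal \<kappa> \<le> ennreal (c i) * emeasure lebesgue (B i)" for i
  proof -
    have "emeasure lebesgue (B i) = ennreal (unit_ball_vol d * (R i * \<rho>) ^ CARD('n))"
      unfolding B_def d_def using R(3)[of i] \<rho> by (intro emeasure_scaled_ball) auto
    also have "unit_ball_vol d * (R i * \<rho>) ^ CARD('n) = V * R i powr d"
      using R(3)[of i] by (simp add: V_def d_def power_mult_distrib powr_realpow)
    finally have e: "ennreal (c i) * emeasure lebesgue (B i) = ennreal (c i * (V * R i powr d))"
      using c0 V by (simp add: ennreal_mult)
    have "c i * (V * R i powr d) = \<kappa> * (R i powr (\<alpha> * p) * R i powr (- (d + 1) * p) * R i powr d)"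
      unfolding c_def \<kappa>_def powr_mult powr_powr by (simp only: mult_ac)
    also have "R i powr (\<alpha> * p) * R i powr (- (d + 1) * p) * R i powr d = R i powr (\<alpha> * p - (d + 1) * p + d)"
      unfolding powr_add[symmetric] by (intro arg_cong2[where f = "(powr)"] refl) (simp add: algebra_simps)
    finally have "c i * (V * R i powr d) = \<kappa> * R i powr (\<alpha> * p - (d + 1) * p + d)" .
    moreover have "R i powr (\<alpha> * p - (d + 1) * p + d) \<ge> 1"
      using R(2)[of i] ex by (intro ge_one_powr_ge_zero) auto
    ultimately have "\<kappa> \<le> c i * (V * R i powr d)"
      using \<kappa> mult_left_mono[of 1 "R i powr (\<alpha> * p - (d + 1) * p + d)" \<kappa>] by simp
    then show ?thesis unfolding e by (rule ennreal_leI)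
  qed
  have le: "ennreal (real N * \<kappa>) \<le> (\<integral>\<^sup>+ x. ?f x \<partial>lebesgue)" for N
  proof -
    have Bs: "B i \<in> sets lebesgue" for i unfolding B_def by (intro sets_completionI_sets) auto
    have "ennreal (real N * \<kappa>) = (\<Sum>i<N. ennreal \<kappa>)"
      using \<kappa> by (simp add: ennreal_mult ennreal_of_nat_eq_real_of_nat)
    also have "\<dots> \<le> (\<Sum>i<N. ennreal (c i) * emeasure lebesgue (B i))"
      by (intro sum_mono cB)
    also have "\<dots> = (\<Sum>i<N. \<integral>\<^sup>+ x. ennreal (c i) * indicator (B i) x \<partial>lebesgue)"
      by (intro sum.cong refl nn_integral_cmult_indicator[symmetric] Bs)
    also have "\<dots> = (\<integral>\<^sup>+ x. (\<Sum>i<N. ennreal (c i) * indicator (B i) x) \<partial>lebesgue)"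
      using Bs by (intro nn_integral_sum[symmetric]) auto
    also have "\<dots> \<le> (\<integral>\<^sup>+ x. ?f x \<partial>lebesgue)"
    proof (rule nn_integral_mono_AE)
      have "AE x in lebesgue. \<forall>i. x \<in> B i \<longrightarrow> t * (q / 2) * R i powr (- (d + 1)) \<le> \<bar>u t x $ j\<bar>"
        unfolding AE_all_countable B_def d_def using ae R by blast
      then show "AE x in lebesgue. (\<Sum>i<N. ennreal (c i) * indicator (B i) x) \<le> ?f x"
      proof eventually_elim
        case (elim x)
        show ?case
        proof (cases "\<exists>i<N. x \<in> B i")
          case True
          then obtain i where i: "i < N" "x \<in> B i" by blast
          have "(\<Sum>i'<N. ennreal (c i') * indicator (B i') x) = (\<Sum>i'\<in>{i}. ennreal (c i') * indicator (B i') x)"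
          proof (rule sum.mono_neutral_right)
            show "\<forall>i'\<in>{..<N} - {i}. ennreal (c i') * indicator (B i') x = 0"
              using disj[OF i(2)] by (auto simp: indicator_def)
          qed (use i in auto)
          also have "\<dots> = ennreal (c i)" using i by simp
          also have "\<dots> \<le> ?f x"
          proof (rule ennreal_leI)
            show "c i \<le> \<bar>x $ k\<bar> powr (\<alpha> * p) * \<bar>u t x $ j\<bar> powr p"
              unfolding c_def
            proof (rule mult_mono)
              show "(b * R i) powr (\<alpha> * p) \<le> \<bar>x $ k\<bar> powr (\<alpha> * p)"
                using Bn[OF i(2)] b R(3)[of i] \<alpha>p by (intro powr_mono2) auto
              show "(t * (q / 2) * R i powr (- (d + 1))) powr p \<le> \<bar>u t x $ j\<bar> powr p"
                using elim i(2) t q p by (intro powr_mono2) auto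
            qed auto
          qed
          finally show ?thesis .
        next
          case False
          then have "(\<Sum>i<N. ennreal (c i) * indicator (B i) x) = 0"
            by (intro sum.neutral) auto
          then show ?thesis by (simp only: zero_le)
        qed
      qed
    qed
    finally show ?thesis .
  qed
  show ?thesis
  proof (rule ccontr)
    assume "(\<integral>\<^sup>+ x. ?f x \<partial>lebesgue) \<noteq> \<infinity>"
    then obtain r where r: "r \<ge> 0" "(\<integral>\<^sup>+ x. ?f x \<partial>lebesgue) = ennreal r"
      by (cases "\<integral>\<^sup>+ x. ?f x \<partial>lebesgue") auto
    obtain N where N: "r < real N * \<kappa>" using reals_Archimedean3[OF \<kappa>] by blast
    have "ennreal (real N * \<kappa>) \<le> ennreal r" using le[of N] unfolding r(2) .
    then show False using N r(1) by (simp add: ennreal_le_iff)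
  qed
qed

end

theorem corollary3p3:
  fixes a :: "real ^ 'n::finite \<Rightarrow> real ^ 'n"
    and u :: "real \<Rightarrow> real ^ 'n \<Rightarrow> real ^ 'n"
    and \<theta> T :: real
  assumes "CARD('n) \<ge> 2"
    and "\<theta> > real CARD('n) + 1"
    and "a \<in> Linf \<theta>"
    and "div_free a"
    and "T > 0"
    and "u \<in> Cw T (real CARD('n) + 1)"
    and "mild_solution T a u"
    and "\<exists>m n. m \<noteq> n \<and>
           ((LINT x|lebesgue. a x $ m * a x $ n) \<noteq> 0 \<or>
            (LINT x|lebesgue. (a x $ m)\<^sup>2) \<noteq> (LINT x|lebesgue. (a x $ n)\<^sup>2))"
  shows "\<exists>t0 c0 C. 0 < t0 \<and> t0 \<le> T \<and> 0 < c0 \<and> 0 < C \<and>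
    (\<forall>t\<in>{0<..t0}.
       (\<forall>j. \<forall>R. R \<ge> C * t powr (- 1 / min 2 (\<theta> - real CARD('n) - 1)) \<longrightarrow>
          (LINT x:{x. R \<le> norm x \<and> norm x \<le> 2 * R}|lebesgue. \<bar>u t x $ j\<bar>) \<ge> c0 * t / R) \<and>
       (\<forall>j k p \<alpha>. 1 \<le> p \<and> \<alpha> + real CARD('n) / p \<ge> real CARD('n) + 1 \<longrightarrow>
          (\<integral>\<^sup>+ x. ennreal (\<bar>x $ k\<bar> powr (\<alpha> * p) * \<bar>u t x $ j\<bar> powr p) \<partial>lebesgue) = \<infinity>))"
proof -
  obtain Mu where Mu: "\<And>t. t \<in> {0..T} \<Longrightarrow> Linf_norm (real CARD('n) + 1) (u t) \<le> ereal Mu"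
    using assms(6) unfolding Cw_def by blast
  have "Linf_norm \<theta> a \<noteq> \<infinity>" using assms(3) by (auto simp: Linf_def)
  then obtain N :: nat where N: "Linf_norm \<theta> a < ereal (real N)"
    unfolding less_PInf_Ex_of_nat by blast
  define M where "M = max 1 (max Mu (real N))"
  interpret decaying_mild_solution a u \<theta> T M
  proof
    show "CARD('n) \<ge> 2" "\<theta> > real CARD('n) + 1" "T > 0" "mild_solution T a u" by fact+
    show "M > 0" by (simp add: M_def)
    show "a \<in> borel_measurable lebesgue" using assms(3) by (simp add: Linf_def)
    have "real N \<le> M" by (simp add: M_def)
    then have "Linf_norm \<theta> a \<le> ereal M"
      by (intro order_trans[OF less_imp_le[OF N]]) simp
    then show "AE y in lebesgue. norm (a y) \<le> M * (1 + norm y) powr (- \<theta>)"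
      by (rule Linf_norm_le_AE)
    fix s assume s: "s \<in> {0..T}"
    then show "u s \<in> borel_measurable lebesgue" using assms(6) by (simp add: Cw_def Linf_def)
    have "Mu \<le> M" by (simp add: M_def)
    then have "Linf_norm (real CARD('n) + 1) (u s) \<le> ereal M"
      by (intro order_trans[OF Mu[OF s]]) simp
    then show "AE y in lebesgue. norm (u s y) \<le> M * decay_weight y"
      unfolding decay_weight_def by (rule Linf_norm_le_AE)
  next
    fix s assume "s \<in> {0<..T}"
    then show "((\<lambda>r. Linf_norm (real CARD('n) + 1) (\<lambda>x. u r x - u s x)) \<longlongrightarrow> 0) (at s within {0<..T})"
      using assms(6) by (simp add: Cw_def)
  qed
  have "\<exists>m n. m \<noteq> n \<and> (moment m n \<noteq> 0 \<or> moment m m \<noteq> moment n n)"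
    using assms(8) by (simp add: moment_def power2_eq_square)
  then obtain z0 \<rho> q b where \<rho>: "\<And>j k. \<rho> j k > 0" and q: "q > 0" and b: "\<And>j k. b j k > 0"
    and ball: "\<And>j k y. y \<in> ball (z0 j k) (\<rho> j k) \<Longrightarrow>
      1 < norm y \<and> norm y < 2 \<and> q \<le> \<bar>limit_profile j y\<bar> \<and> b j k \<le> \<bar>y $ k\<bar>"
    by (rule limit_profile_ball) blast
  have "q / 2 > 0" using q by simp
  then obtain t0 C where t0: "0 < t0" "t0 \<le> T" and C: "C > 0"
    and asym: "\<And>t. 0 < t \<Longrightarrow> t \<le> t0 \<Longrightarrow> AE x in lebesgue. norm x \<ge> C * t powr (- 1 / min 2 (\<theta> - real CARD('n) - 1)) \<longrightarrow>
      (\<forall>j. \<bar>u t x $ j + t * limit_profile j x\<bar> \<le> q / 2 * t * norm x powr (- (real CARD('n) + 1)))"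
    by (rule solution_asymptotics) blast
  \<comment> \<open>The bound on the annuli is insensitive to k, and k = j is taken. The smallest of
    the finitely many radii makes c0 independent of j.\<close>
  define r where "r = Min (range (\<lambda>j. \<rho> j j))"
  have r_le: "r \<le> \<rho> j j" for j unfolding r_def by (rule Min_le) auto
  have "r \<in> range (\<lambda>j. \<rho> j j)" unfolding r_def by (rule Min_in) auto
  then have r: "r > 0" using \<rho> by auto
  define c0 where "c0 = q / 2 * (unit_ball_vol (real CARD('n)) * r ^ CARD('n))"
  have c0: "c0 > 0" using q r by (simp add: c0_def)
  \<comment> \<open>The free radius s serves both claims: the common radius r on the annuli and the
    full radius in the weighted integrals.\<close>
  have lower: "AE x in lebesgue. x \<in> ball (R *\<^sub>R z0 j k) (R * s) \<longrightarrow> t * (q / 2) * R powr (- (real CARD('n) + 1)) \<le> \<bar>u t x $ j\<bar>"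
    if "0 < t" "t \<le> t0" "R \<ge> C * t powr (- 1 / min 2 (\<theta> - real CARD('n) - 1))" "R > 0" "s \<le> \<rho> j k" for t R j k s
  proof (rule pointwise_lower_bound[OF q _ asym[OF that(1,2)] that(3,4,1)])
    fix y assume "y \<in> ball (z0 j k) s"
    then have "y \<in> ball (z0 j k) (\<rho> j k)" using that(5) by auto
    from ball[OF this] show "1 < norm y \<and> norm y < 2 \<and> q \<le> \<bar>limit_profile j y\<bar>" by blast
  qed
  have "\<forall>t\<in>{0<..t0}.
       (\<forall>j. \<forall>R. R \<ge> C * t powr (- 1 / min 2 (\<theta> - real CARD('n) - 1)) \<longrightarrow>
          (LINT x:{x. R \<le> norm x \<and> norm x \<le> 2 * R}|lebesgue. \<bar>u t x $ j\<bar>) \<ge> c0 * t / R) \<and>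
       (\<forall>j k p \<alpha>. 1 \<le> p \<and> \<alpha> + real CARD('n) / p \<ge> real CARD('n) + 1 \<longrightarrow>
          (\<integral>\<^sup>+ x. ennreal (\<bar>x $ k\<bar> powr (\<alpha> * p) * \<bar>u t x $ j\<bar> powr p) \<partial>lebesgue) = \<infinity>)"
  proof (intro ballI conjI allI impI)
    fix t j R assume t: "t \<in> {0<..t0}" and R: "R \<ge> C * t powr (- 1 / min 2 (\<theta> - real CARD('n) - 1))"
    then have t': "0 < t" "t \<le> t0" "t \<in> {0..T}" using t0 by auto
    have "0 < C * t powr (- 1 / min 2 (\<theta> - real CARD('n) - 1))" using C t' by simp
    then have R0: "R > 0" using R by linarith
    show "(LINT x:{x. R \<le> norm x \<and> norm x \<le> 2 * R}|lebesgue. \<bar>u t x $ j\<bar>) \<ge> c0 * t / R"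
      unfolding c0_def
    proof (rule annulus_lower_bound[OF t'(3,1) R0 r q _ lower[OF t'(1,2) R R0 r_le]])
      fix y assume "y \<in> ball (z0 j j) r"
      then have "y \<in> ball (z0 j j) (\<rho> j j)" using r_le[of j] by auto
      then show "1 < norm y \<and> norm y < 2" using ball by blast
    qed
  next
    fix t j k p \<alpha> assume t: "t \<in> {0<..t0}" and p: "1 \<le> p \<and> \<alpha> + real CARD('n) / p \<ge> real CARD('n) + 1"
    then have t': "0 < t" "t \<le> t0" by auto
    show "(\<integral>\<^sup>+ x. ennreal (\<bar>x $ k\<bar> powr (\<alpha> * p) * \<bar>u t x $ j\<bar> powr p) \<partial>lebesgue) = \<infinity>"
    proof (rule weighted_integral_infinite[OF t'(1) \<rho>[of j k] q b[of j k] _ _ conjunct1[OF p] conjunct2[OF p]])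
      show "1 < norm y \<and> norm y < 2 \<and> b j k \<le> \<bar>y $ k\<bar>" if "y \<in> ball (z0 j k) (\<rho> j k)" for y
        using ball[OF that] by blast
      show "AE x in lebesgue. x \<in> ball (R *\<^sub>R z0 j k) (R * \<rho> j k) \<longrightarrow> t * (q / 2) * R powr (- (real CARD('n) + 1)) \<le> \<bar>u t x $ j\<bar>"
        if "R \<ge> C * t powr (- 1 / min 2 (\<theta> - real CARD('n) - 1))" "R > 0" for R
        by (rule lower[OF t' that order_refl])
    qed
  qed
  then show ?thesis using t0 C c0 by blast
qed

end
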